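(* Let $r\in[-1,1]$ and $b\in[0,1]$ with $r\le b$, and assume: (i) there is $R>0$ with $\mathbb E\big[K(x_n,x_n)\,K_{x_n}\otimes K_{x_n}\big]\preccurlyeq R^2\Sigma$; (ii) there is $\sigma>0$ with $\mathbb E\big[\varepsilon_n^2\,K_{x_n}\otimes K_{x_n}\big]\preccurlyeq\sigma^2\Sigma$, where $\varepsilon_n=y_n-\theta_*(x_n)$; (iii) $\|\Sigma^{r/2}\theta_*\|_{\mathcal H}<\infty$; (iv) $\operatorname{tr}(\Sigma^b)<\infty$. For a horizon $n\ge1$, a step-size $\gamma$ and $\lambda=\frac1{\gamma n}$ (both constant along the iterations), let $\theta_0\in\mathcal H$ and, for $1\le k\le n$, $$\theta_k=\big[I-\gamma\,K_{x_k}\otimes K_{x_k}-\gamma\lambda I\big]\theta_{k-1}+\gamma\,y_kK_{x_k}+\lambda\gamma\,\theta_0,\qquad \bar\theta_n=\frac1{n+1}\sum_{i=0}^n\theta_i .$$ Then, for any constant step-size $\gamma\le\frac1{2R^2}$ with $\gamma\propto n^{\frac{-b+r}{b+1-r}}$, $$\mathbb E f(\bar\theta_n)-f(\theta_* )\le\Big((27+o(1))\,\big\|\Sigma^{r/2}(\theta_0-\theta_* )\big\|_{\mathcal H}^2+6\sigma^2\operatorname{tr}(\Sigma^b)\Big)\,n^{-\frac{1-r}{b+1-r}},$$ where $o(1)$ denotes a quantity decreasing to $0$ as $n\to\infty$.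
   Context: $(x_n,y_n)_{n\ge1}$ are i.i.d. with law $\rho$ on $\mathcal X\times\mathbb R$; $\rho_X$ is the law of $x_n$; $\mathbb E y_n^2<\infty$. $\mathcal H$ is a reproducing kernel Hilbert space of functions on $\mathcal X$ with kernel $K$, $\mathbb E K(x_n,x_n)<\infty$, $\mathcal H\subset L^2_{\rho_X}$; $K_x=K(x,\cdot)\in\mathcal H$, so $\langle g,K_x\rangle_{\mathcal H}=g(x)$. The objective is $f(g)=\mathbb E[(g(x_n)-y_n)^2]$. The covariance operator $\Sigma=\mathbb E[K_{x_n}\otimes K_{x_n}]:\mathcal H\to\mathcal H$ is self-adjoint, positive and trace class, and is assumed injective. $\theta_*$ (also denoted $g_{\mathcal H}$) is the minimizer of $f$ over the closure $\overline{\mathcal H}$ of $\mathcal H$ in $L^2_{\rho_X}$, so that $f(\theta_* )=\inf_{g\in\mathcal H}f(g)$; $\theta_*$ need not belong to $\mathcal H$. If $(\mu_i,e_i)$ are the eigenvalues and $\mathcal H$-orthonormal eigenvectors of $\Sigma$, then $(\mu_i^{-1/2}e_i)$ is an orthonormal basis of $\overline{\mathcal H}\subset L^2_{\rho_X}$, and for $g=\sum_ia_ie_i\in\overline{\mathcal H}$ one sets $\|\Sigma^{r/2}g\|_{\mathcal H}^2=\sum_i\mu_i^ra_i^2\in[0,\infty]$. $A\preccurlyeq B$ means that $B-A$ is positive semi-definite. The symbol $\propto$ means "proportional to", as a function of the horizon $n$.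
   Formalization: With step-size γ = c·n^{(-b+r)/(b+1-r)}, c>0, the bias term carries an extra factor c^{r-1} and the variance term c^b; both are 1 when c=1, and the bound without them fails for general proportionality constants. *)

theory Defs
  imports "HOL-Probability.Probability"
begin

section \<open>Operators on a Hilbert space\<close>

text \<open>The rank-one operator \<open>u \<otimes> v\<close>, i.e. \<open>g \<mapsto> \<langle>g, v\<rangle> u\<close>.\<close>

definition rank_one :: "'h::real_inner \<Rightarrow> 'h \<Rightarrow> 'h \<Rightarrow>\<^sub>L 'h" where
  "rank_one u v = blinfun_scaleR_left u o\<^sub>L blinfun_inner_left v"

lemma rank_one_apply: "blinfun_apply (rank_one u v) g = inner g v *\<^sub>R u"
  by (simp add: rank_one_def inner_commute)

definition psd :: "('h::real_inner \<Rightarrow>\<^sub>L 'h) \<Rightarrow> bool" where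
  "psd T \<longleftrightarrow> (\<forall>g h. inner (T g) h = inner g (T h)) \<and> (\<forall>g. 0 \<le> inner (T g) g)"

definition loewner_le :: "('h::real_inner \<Rightarrow>\<^sub>L 'h) \<Rightarrow> ('h \<Rightarrow>\<^sub>L 'h) \<Rightarrow> bool"  (infix "\<preceq>\<^sub>L" 50) where
  "A \<preceq>\<^sub>L B \<longleftrightarrow> psd (B - A)"

text \<open>Expectation of a random operator in the weak sense:
  \<open>\<langle>\<bbbE>[T] g, h\<rangle> = \<bbbE> \<langle>T g, h\<rangle>\<close>, all these scalar expectations being finite. The Bochner integral of
  the library is not available here, since the space of bounded operators on an infinite-dimensional
  Hilbert space is not second countable. The operator \<open>A\<close> is determined uniquely.\<close>

definition has_op_expectation ::
  "'z measure \<Rightarrow> ('z \<Rightarrow> 'h::real_inner \<Rightarrow>\<^sub>L 'h) \<Rightarrow> ('h \<Rightarrow>\<^sub>L 'h) \<Rightarrow> bool" where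
  "has_op_expectation P T A \<longleftrightarrow>
     (\<forall>g h. has_bochner_integral P (\<lambda>z. inner (T z g) h) (inner (A g) h))"

text \<open>The index set \<open>I\<close> is finite exactly when the space is finite-dimensional.\<close>

definition eigenbasis ::
  "('h::real_inner \<Rightarrow>\<^sub>L 'h) \<Rightarrow> nat set \<Rightarrow> (nat \<Rightarrow> real) \<Rightarrow> (nat \<Rightarrow> 'h) \<Rightarrow> bool" where
  "eigenbasis T I \<mu> e \<longleftrightarrow>
     (\<forall>i\<in>I. blinfun_apply T (e i) = \<mu> i *\<^sub>R e i) \<and>
     (\<forall>i\<in>I. \<forall>j\<in>I. inner (e i) (e j) = (if i = j then 1 else 0)) \<and>
     closure (span (e ` I)) = UNIV"

text \<open>\<open>tr(\<Sigma>\<^sup>b)\<close> for an operator \<open>\<Sigma>\<close> with eigenvalues \<open>\<mu> i > 0\<close>, \<open>i \<in> I\<close>, as an element of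
  \<open>[0,\<infinity>]\<close>. For \<open>b = 0\<close> this is the dimension.\<close>

definition trace_power :: "nat set \<Rightarrow> (nat \<Rightarrow> real) \<Rightarrow> real \<Rightarrow> ennreal" where
  "trace_power I \<mu> b = (\<Sum>\<^sub>\<infinity>i\<in>I. ennreal (\<mu> i powr b))"


section \<open>Reproducing kernel Hilbert spaces\<close>

text \<open>The Hilbert space is a type \<open>'h\<close> and \<open>fn g\<close> is the function on \<open>X\<close> that the element \<open>g\<close> is.
  The first clause says that distinct elements are distinct functions on \<open>X\<close>; linearity of \<open>fn\<close> on
  \<open>X\<close> follows from the second one.\<close>

definition rkhs ::
  "'x set \<Rightarrow> ('x \<Rightarrow> 'x \<Rightarrow> real) \<Rightarrow> ('h::real_inner \<Rightarrow> 'x \<Rightarrow> real) \<Rightarrow> ('x \<Rightarrow> 'h) \<Rightarrow> bool" where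
  "rkhs X K fn Kx \<longleftrightarrow>
     (\<forall>g h. (\<forall>x\<in>X. fn g x = fn h x) \<longrightarrow> g = h) \<and>
     (\<forall>g. \<forall>x\<in>X. fn g x = inner g (Kx x)) \<and>
     (\<forall>x\<in>X. \<forall>x'\<in>X. fn (Kx x) x' = K x x')"

definition square_integrable :: "'x measure \<Rightarrow> ('x \<Rightarrow> real) set" where
  "square_integrable P = {u \<in> borel_measurable P. integrable P (\<lambda>x. (u x)\<^sup>2)}"

text \<open>Closure in \<open>L\<^sup>2(P)\<close> of the space of functions \<open>fn g\<close>. Its elements are functions, not classes
  modulo null sets.\<close>

definition L2_closure :: "'x measure \<Rightarrow> ('h \<Rightarrow> 'x \<Rightarrow> real) \<Rightarrow> ('x \<Rightarrow> real) set" where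
  "L2_closure P fn = {u \<in> square_integrable P.
     \<forall>\<epsilon>>0. \<exists>g. (LINT x|P. (fn g x - u x)\<^sup>2) < \<epsilon>}"

text \<open>The coefficients \<open>a\<^sub>i\<close> of the \<open>L\<^sup>2\<close> expansion \<open>u = \<Sum>\<^sub>i a\<^sub>i e\<^sub>i\<close>. Since \<open>\<mu>\<^sub>i\<^sup>-\<^sup>1\<^sup>/\<^sup>2 e\<^sub>i\<close> is orthonormal in
  \<open>L\<^sup>2\<close>, \<open>a\<^sub>i = \<mu>\<^sub>i\<^sup>-\<^sup>1\<^sup>/\<^sup>2 \<langle>u, \<mu>\<^sub>i\<^sup>-\<^sup>1\<^sup>/\<^sup>2 e\<^sub>i\<rangle>\<close>. For \<open>u = fn g\<close> this is \<open>\<langle>g, e\<^sub>i\<rangle>\<close> in the Hilbert space.\<close>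

definition eigen_coeff ::
  "'x measure \<Rightarrow> ('h \<Rightarrow> 'x \<Rightarrow> real) \<Rightarrow> (nat \<Rightarrow> real) \<Rightarrow> (nat \<Rightarrow> 'h) \<Rightarrow> ('x \<Rightarrow> real) \<Rightarrow> nat \<Rightarrow> real" where
  "eigen_coeff P fn \<mu> e u i = (LINT x|P. u x * fn (e i) x) / \<mu> i"

text \<open>\<open>\<parallel>\<Sigma>\<^sup>r\<^sup>/\<^sup>2 u\<parallel>\<^sup>2\<close>, as an element of \<open>[0,\<infinity>]\<close>, for \<open>u\<close> in the \<open>L\<^sup>2\<close> closure.\<close>

definition power_norm_sq ::
  "'x measure \<Rightarrow> ('h \<Rightarrow> 'x \<Rightarrow> real) \<Rightarrow> nat set \<Rightarrow> (nat \<Rightarrow> real) \<Rightarrow> (nat \<Rightarrow> 'h) \<Rightarrow> real \<Rightarrow> ('x \<Rightarrow> real)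
    \<Rightarrow> ennreal" where
  "power_norm_sq P fn I \<mu> e r u =
     (\<Sum>\<^sub>\<infinity>i\<in>I. ennreal (\<mu> i powr r * (eigen_coeff P fn \<mu> e u i)\<^sup>2))"


section \<open>Least-squares regression by averaged regularized stochastic gradient descent\<close>

definition risk :: "('x \<times> real) measure \<Rightarrow> ('x \<Rightarrow> real) \<Rightarrow> real" where
  "risk \<rho> u = (LINT z|\<rho>. (u (fst z) - snd z)\<^sup>2)"

primrec sgd ::
  "('x \<Rightarrow> 'h::real_inner) \<Rightarrow> real \<Rightarrow> real \<Rightarrow> 'h \<Rightarrow> (nat \<Rightarrow> 'x) \<Rightarrow> (nat \<Rightarrow> real) \<Rightarrow> nat \<Rightarrow> 'h" where
  "sgd Kx \<gamma> reg \<theta>0 xs ys 0 = \<theta>0"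
| "sgd Kx \<gamma> reg \<theta>0 xs ys (Suc k) =
     (id_blinfun - \<gamma> *\<^sub>R rank_one (Kx (xs (Suc k))) (Kx (xs (Suc k))) - (\<gamma> * reg) *\<^sub>R id_blinfun)
       (sgd Kx \<gamma> reg \<theta>0 xs ys k)
     + (\<gamma> * ys (Suc k)) *\<^sub>R Kx (xs (Suc k)) + (reg * \<gamma>) *\<^sub>R \<theta>0"

definition sgd_average ::
  "('x \<Rightarrow> 'h::real_inner) \<Rightarrow> real \<Rightarrow> real \<Rightarrow> 'h \<Rightarrow> (nat \<Rightarrow> 'x) \<Rightarrow> (nat \<Rightarrow> real) \<Rightarrow> nat \<Rightarrow> 'h" where
  "sgd_average Kx \<gamma> reg \<theta>0 xs ys n = (1 / (real n + 1)) *\<^sub>R (\<Sum>i\<le>n. sgd Kx \<gamma> reg \<theta>0 xs ys i)"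

text \<open>The step-size proportional to \<open>n\<^bsup>(-b+r)/(b+1-r)\<^esup>\<close>, with proportionality constant \<open>c\<close>.
  With this step-size,
  \<open>(\<gamma> n)\<^bsup>-(1-r)\<^esup> = c\<^bsup>r-1\<^esup> n\<^bsup>-(1-r)/(b+1-r)\<^esup>\<close> and \<open>\<gamma>\<^bsup>b\<^esup> n\<^bsup>b-1\<^esup> = c\<^bsup>b\<^esup> n\<^bsup>-(1-r)/(b+1-r)\<^esup>\<close>. So the
  constant \<open>c\<close> enters an explicit bound through the factors \<open>c\<^bsup>r-1\<^esup>\<close> (bias) and \<open>c\<^bsup>b\<^esup>\<close> (variance),
  both of which are \<open>1\<close> for \<open>c = 1\<close>; a bound with explicit constants that does not depend on \<open>c\<close> fails.\<close>

definition step_size :: "real \<Rightarrow> real \<Rightarrow> real \<Rightarrow> nat \<Rightarrow> real" where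
  "step_size c b r n = c * real n powr ((- b + r) / (b + 1 - r))"

end

(*
The iterate is theta_0 plus a deterministic drift plus two centred processes in the Hilbert space, one
driven by the noise y - theta_*(x) and one by the sampling of the bias; the constants 27 and 6 start from
|a + b + c|^2 <= 3 (|a|^2 + |b|^2 + |c|^2).  In the eigenbasis of the covariance the drift is an explicit
scalar recursion, which gives the squared bias.  Each centred process is a linear recursion with the mean
operator and martingale increments, so the coordinates of its average have variance at most
1/(n(mu + lambda))^2 times the sum of the variances of the increments.  For the noise, the second moment
of the iterates stays below 2 gamma sigma^2, hence the increments have covariance at most 2 sigma^2 Sigma
and the factor is 3 * 2 = 6.  For the bias, the increments are controlled by the L^2 norm of the iterates,
which the decrease of the Hilbert norm bounds by that of the drift; this part is absorbed by the slack in
27 when r >= 0 and is of lower order (the o(1)) when r < 0.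
*)
theory Submission
  imports Defs
begin

section \<open>Scalar recursions\<close>

lemma averaged_power_sum_bound:
  fixes q x :: real
  assumes "n \<ge> 1" "q = 1 / real n" "0 \<le> x" "x \<le> 1/2" "m \<le> n"
  shows "((\<Sum>l<m. (1 - q - x) ^ l) / (real n + 1))\<^sup>2 \<le> (1 / (real n * (q + x)))\<^sup>2"
proof -
  let ?G = "\<Sum>l<m. (1 - q - x) ^ l"
  have qpos: "q > 0" using assms by simp
  have "0 \<le> ?G \<and> ?G / (real n + 1) \<le> 1 / (real n * (q + x))"
  proof (cases "n = 1")
    case True
    then have "m = 0 \<or> m = 1" using assms by auto
    with True assms show ?thesis by (auto simp: divide_simps)
  next
    case False
    then have "real n \<ge> 2" using assms by linarith
    then have q: "q \<le> 1/2" unfolding assms(2) by (intro frac_le) auto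
    have r: "0 \<le> 1 - q - x" "1 - q - x \<le> 1" using q qpos assms(3,4) by auto
    have eq: "?G * (q + x) = 1 - (1 - q - x) ^ m"
      using one_diff_power_eq[of "1 - q - x" m] by (simp add: mult.commute)
    have "0 \<le> ?G" using r by (intro sum_nonneg) auto
    have "?G * (q + x) \<le> 1" unfolding eq using r by simp
    then have "?G \<le> 1 / (q + x)" using qpos assms(3) by (simp add: pos_le_divide_eq)
    then have "?G / (real n + 1) \<le> (1 / (q+x)) / (real n + 1)"
      by (intro divide_right_mono) auto
    also have "\<dots> \<le> (1 / (q + x)) / real n"
      using qpos assms by (intro divide_left_mono) auto
    finally show ?thesis using \<open>0 \<le> ?G\<close> by (simp add: mult.commute)
  qed
  then show ?thesis by (intro power_mono) auto
qed

locale bias_recursion =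
  fixes n :: nat and q x :: real and c :: "nat \<Rightarrow> real"
  assumes n: "n \<ge> 1" and q: "q = 1 / real n" and x: "0 \<le> x" "x \<le> 1/2"
    and c0: "c 0 = 1" and cSuc: "\<And>k. c (Suc k) = (1 - q - x) * c k + q"
begin

lemma q_pos: "q > 0"
  using n q by simp

lemma coefficient_bounds: "k \<le> n \<Longrightarrow> 0 \<le> c k \<and> c k \<le> 1"
proof (cases "n = 1")
  case True
  moreover assume "k \<le> n"
  ultimately have "k = 0 \<or> k = 1" by auto
  then show ?thesis using True q x c0 cSuc[of 0] by auto
next
  case False
  then have "real n \<ge> 2" using n by linarith
  then have "q \<le> 1/2" unfolding q by (intro frac_le) auto
  then have r: "0 \<le> 1 - q - x" using x by simp
  show ?thesis
  proof (induction k)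
    case 0 then show ?case by (simp add: c0)
  next
    case (Suc k)
    have "(1 - q - x) * c k \<le> (1 - q - x) * 1" using Suc r by (intro mult_left_mono) auto
    then show ?case using Suc r q_pos x by (simp add: cSuc)
  qed
qed

lemma sum_identity: "(q + x) * (\<Sum>k<m. c k) = 1 - c m + real m * q"
  by (induction m) (auto simp: c0 cSuc algebra_simps)

lemma sum_bound: "(\<Sum>k<n. c k) \<le> 2 / (q + x)"
proof -
  have "(q + x) * (\<Sum>k<n. c k) \<le> 2"
    using sum_identity[of n] coefficient_bounds[of n] q n by simp
  then show ?thesis using q_pos x by (simp add: pos_le_divide_eq mult.commute)
qed

lemma sum_squares_bound: "(\<Sum>k<n. (c k)\<^sup>2) \<le> 2 / (q + x)"
proof -
  have "(\<Sum>k<n. (c k)\<^sup>2) \<le> (\<Sum>k<n. c k)"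
    using coefficient_bounds by (intro sum_mono) (auto simp: power2_eq_square intro!: mult_left_le)
  with sum_bound show ?thesis by simp
qed

lemma average_bound: "((\<Sum>k\<le>n. c k) / (real n + 1))\<^sup>2 \<le> 25/4 * (q / (q + x))\<^sup>2"
proof -
  have "(\<Sum>k\<le>n. c k) = (\<Sum>k<n. c k) + c n" by (simp flip: lessThan_Suc_atMost)
  also have "\<dots> \<le> 2 / (q + x) + 1" using sum_bound coefficient_bounds[of n] by simp
  also have "\<dots> \<le> 2 / (q + x) + (q + 1/2) / (q + x)"
  proof -
    have "1 \<le> (q + 1/2) / (q + x)" using q_pos x by (simp add: pos_le_divide_eq)
    then show ?thesis by simp
  qed
  also have "\<dots> = (5/2 + q) / (q + x)" by (simp flip: add_divide_distrib)
  finally have "(\<Sum>k\<le>n. c k) / (real n + 1) \<le> (5/2 + q) / (q + x) / (real n + 1)"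
    by (intro divide_right_mono) auto
  also have "\<dots> = ((5/2 + q) / (real n + 1)) / (q + x)" by simp
  also have "\<dots> \<le> (5/2 * q) / (q + x)"
  proof (rule divide_right_mono)
    show "(5/2 + q) / (real n + 1) \<le> 5/2 * q"
    proof (subst pos_divide_le_eq)
      have "real n * q = 1" using n q by simp
      then have "5/2 * q * (real n + 1) = 5/2 + 5/2 * q" by (simp add: algebra_simps)
      then show "5/2 + q \<le> 5/2 * q * (real n + 1)" using q_pos by simp
    qed simp
  qed (use q_pos x in auto)
  finally have *: "(\<Sum>k\<le>n. c k) / (real n + 1) \<le> 5/2 * (q / (q + x))" by simp
  have "0 \<le> (\<Sum>k\<le>n. c k) / (real n + 1)" using coefficient_bounds by (intro divide_nonneg_pos sum_nonneg) auto
  then have "((\<Sum>k\<le>n. c k) / (real n + 1))\<^sup>2 \<le> (5/2 * (q / (q + x)))\<^sup>2"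
    using * by (intro power_mono) auto
  also have "\<dots> = 25/4 * (q / (q + x))\<^sup>2"
    by (simp only: power_mult_distrib) (simp add: power2_eq_square)
  finally show ?thesis .
qed

end

section \<open>Countable orthonormal bases\<close>

definition weakly_measurable :: "'p measure \<Rightarrow> ('p \<Rightarrow> 'h::real_inner) \<Rightarrow> bool" where
  "weakly_measurable P X \<longleftrightarrow> (\<forall>g. (\<lambda>p. inner (X p) g) \<in> borel_measurable P)"

lemma weakly_measurableD:
  "weakly_measurable P X \<Longrightarrow> (\<lambda>p. inner (X p) g) \<in> borel_measurable P"
  by (simp add: weakly_measurable_def)

lemma weakly_measurable_const [simp]: "weakly_measurable P (\<lambda>p. c)"
  by (simp add: weakly_measurable_def)

lemma weakly_measurable_add:
  "weakly_measurable P X \<Longrightarrow> weakly_measurable P Y \<Longrightarrow> weakly_measurable P (\<lambda>p. X p + Y p)"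
  by (auto simp: weakly_measurable_def inner_add_left intro!: borel_measurable_add)

lemma weakly_measurable_diff:
  "weakly_measurable P X \<Longrightarrow> weakly_measurable P Y \<Longrightarrow> weakly_measurable P (\<lambda>p. X p - Y p)"
  by (auto simp: weakly_measurable_def inner_diff_left intro!: borel_measurable_diff)

lemma weakly_measurable_sum:
  "(\<And>i. i \<in> A \<Longrightarrow> weakly_measurable P (X i)) \<Longrightarrow> weakly_measurable P (\<lambda>p. \<Sum>i\<in>A. X i p)"
  by (auto simp: weakly_measurable_def inner_sum_left intro!: borel_measurable_sum)

lemma weakly_measurable_scaleR:
  "f \<in> borel_measurable P \<Longrightarrow> weakly_measurable P X \<Longrightarrow> weakly_measurable P (\<lambda>p. f p *\<^sub>R X p)"
  by (auto simp: weakly_measurable_def intro!: borel_measurable_times)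

lemma weakly_measurable_compose:
  "weakly_measurable Q X \<Longrightarrow> f \<in> measurable P Q \<Longrightarrow> weakly_measurable P (\<lambda>p. X (f p))"
  unfolding weakly_measurable_def using measurable_compose[of f P Q] by auto

text \<open>The vectors \<open>e i\<close> with \<open>i \<notin> I\<close> are \<open>0\<close>, so that the basis is finite or infinite but always
  indexed by all natural numbers.\<close>

locale orthonormal_basis =
  fixes e :: "nat \<Rightarrow> 'h::real_inner" and I :: "nat set"
  assumes orthonormal: "\<And>i j. inner (e i) (e j) = (if i = j \<and> i \<in> I then 1 else 0)"
    and total: "closure (span (range e)) = UNIV"
begin

lemma basis_eq_0: "i \<notin> I \<Longrightarrow> e i = 0"
  using orthonormal[of i i] by simp

definition proj :: "nat \<Rightarrow> 'h \<Rightarrow> 'h" where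
  "proj n h = (\<Sum>i<n. inner h (e i) *\<^sub>R e i)"

lemma proj_add: "proj n (g + h) = proj n g + proj n h"
  by (simp add: proj_def inner_add_left scaleR_add_left sum.distrib)

lemma proj_scaleR: "proj n (c *\<^sub>R h) = c *\<^sub>R proj n h"
  by (simp add: proj_def scaleR_sum_right)

lemma proj_diff: "proj n (g - h) = proj n g - proj n h"
  by (simp add: proj_def inner_diff_left scaleR_diff_left sum_subtractf)

lemma inner_proj: "inner (proj n h) g = (\<Sum>i<n. inner h (e i) * inner g (e i))"
  by (simp add: proj_def inner_sum_left inner_commute[of "e _" g])

lemma inner_proj_basis: "inner (proj n h) (e j) = (if j < n then inner h (e j) else 0)"
proof -
  have "inner (proj n h) (e j) = (\<Sum>i<n. if i = j then inner h (e j) else 0)"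
    unfolding inner_proj by (intro sum.cong refl) (auto simp: orthonormal basis_eq_0)
  then show ?thesis by simp
qed

lemma norm_diff_proj: "(norm (h - proj n h))\<^sup>2 = (norm h)\<^sup>2 - (\<Sum>i<n. (inner h (e i))\<^sup>2)"
proof -
  have 1: "inner (proj n h) (proj n h) = (\<Sum>i<n. (inner h (e i))\<^sup>2)"
    by (subst inner_proj) (auto intro!: sum.cong simp: inner_proj_basis power2_eq_square)
  have 2: "inner (proj n h) h = (\<Sum>i<n. (inner h (e i))\<^sup>2)"
    by (simp add: inner_proj power2_eq_square)
  have "(norm (h - proj n h))\<^sup>2 = inner h h - 2 * inner (proj n h) h + inner (proj n h) (proj n h)"
    by (simp add: power2_norm_eq_inner inner_diff_left inner_diff_right inner_commute)
  then show ?thesis by (simp add: 1 2 power2_norm_eq_inner)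
qed

lemma span_proj_eventually:
  assumes "h \<in> span (range e)"
  shows "\<exists>n. \<forall>m\<ge>n. proj m h = h"
  using assms
proof (induction rule: span_induct_alt)
  case base
  show ?case by (simp add: proj_def)
next
  case (step c x y)
  then obtain i n where i: "x = e i" and n: "\<And>m. m \<ge> n \<Longrightarrow> proj m y = y" by auto
  have "proj m (e i) = e i" if "m > i" for m
  proof -
    have "proj m (e i) = (\<Sum>j<m. if j = i then e i else 0)"
      unfolding proj_def by (intro sum.cong refl) (auto simp: orthonormal basis_eq_0)
    then show ?thesis using that by simp
  qed
  then have "proj m (c *\<^sub>R x + y) = c *\<^sub>R x + y" if "m \<ge> max n (Suc i)" for m
    using that n[of m] by (simp add: proj_add proj_scaleR i)
  then show ?case by blast
qed

lemma proj_tendsto: "(\<lambda>n. proj n h) \<longlonglongrightarrow> h"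
proof (rule LIMSEQ_I)
  fix r :: real assume "r > 0"
  have "h \<in> closure (span (range e))" by (simp add: total)
  then obtain g where g: "g \<in> span (range e)" "dist g h < r"
    using \<open>r > 0\<close> unfolding closure_approachable by blast
  then obtain n where n: "\<And>m. m \<ge> n \<Longrightarrow> proj m g = g" using span_proj_eventually by blast
  have "norm (proj m h - h) < r" if "m \<ge> n" for m
  proof -
    have "(norm (h - proj m h))\<^sup>2 = (norm ((h - g) - proj m (h - g)))\<^sup>2"
      using n[OF that] by (simp add: proj_diff)
    also have "\<dots> \<le> (norm (h - g))\<^sup>2"
      unfolding norm_diff_proj by (simp add: sum_nonneg)
    finally have "norm (h - proj m h) \<le> norm (h - g)" by (rule power2_le_imp_le) simp
    then show ?thesis using g by (simp add: dist_norm norm_minus_commute)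
  qed
  then show "\<exists>no. \<forall>n\<ge>no. norm (proj n h - h) < r" by blast
qed

lemma parseval_inner: "(\<lambda>i. inner h (e i) * inner g (e i)) sums inner h g"
  unfolding sums_def using tendsto_inner[OF proj_tendsto tendsto_const, of h g]
  by (simp add: inner_proj)

lemma parseval: "(\<lambda>i. (inner h (e i))\<^sup>2) sums (norm h)\<^sup>2"
  using parseval_inner[of h h] by (simp add: power2_norm_eq_inner flip: power2_eq_square)

lemma borel_measurable_inner:
  fixes X Y :: "'p \<Rightarrow> 'h"
  assumes "weakly_measurable P X" "weakly_measurable P Y"
  shows "(\<lambda>p. inner (X p) (Y p)) \<in> borel_measurable P"
proof (rule borel_measurable_LIMSEQ_real)
  show "(\<lambda>n. \<Sum>i<n. inner (X p) (e i) * inner (Y p) (e i)) \<longlonglongrightarrow> inner (X p) (Y p)" for p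
    using parseval_inner unfolding sums_def .
  show "(\<lambda>p. \<Sum>i<n. inner (X p) (e i) * inner (Y p) (e i)) \<in> borel_measurable P" for n
    using assms by (intro borel_measurable_sum borel_measurable_times) (auto dest: weakly_measurableD)
qed

lemma borel_measurable_norm2:
  fixes X :: "'p \<Rightarrow> 'h"
  assumes "weakly_measurable P X"
  shows "(\<lambda>p. (norm (X p))\<^sup>2) \<in> borel_measurable P"
  using borel_measurable_inner[OF assms assms] by (simp add: power2_norm_eq_inner)

end

section \<open>Square-integrable functions\<close>

lemma square_integrableI:
  "f \<in> borel_measurable P \<Longrightarrow> integrable P (\<lambda>x. (f x)\<^sup>2) \<Longrightarrow> f \<in> square_integrable P"
  by (simp add: square_integrable_def)

lemma square_integrableD:
  assumes "f \<in> square_integrable P"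
  shows "f \<in> borel_measurable P" "integrable P (\<lambda>x. (f x)\<^sup>2)"
  using assms by (simp_all add: square_integrable_def)

lemma square_integrable_mult:
  assumes f: "f \<in> square_integrable P" and g: "g \<in> square_integrable P"
  shows "integrable P (\<lambda>x. f x * g x)"
proof (rule Bochner_Integration.integrable_bound)
  show "integrable P (\<lambda>x. (f x)\<^sup>2 + (g x)\<^sup>2)" using assms by (intro Bochner_Integration.integrable_add) (auto dest: square_integrableD)
  show "(\<lambda>x. f x * g x) \<in> borel_measurable P" using assms by (intro borel_measurable_times) (auto dest: square_integrableD)
  have "\<bar>f x * g x\<bar> \<le> (f x)\<^sup>2 + (g x)\<^sup>2" for x
    using sum_squares_bound[of "\<bar>f x\<bar>" "\<bar>g x\<bar>"] mult_nonneg_nonneg[OF abs_ge_zero abs_ge_zero, of "f x" "g x"]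
    by (simp only: abs_mult power2_abs)
  then show "AE x in P. norm (f x * g x) \<le> norm ((f x)\<^sup>2 + (g x)\<^sup>2)" by simp
qed

lemma square_integrable_scale:
  "f \<in> square_integrable P \<Longrightarrow> (\<lambda>x. c * f x) \<in> square_integrable P"
  by (auto simp: square_integrable_def power_mult_distrib)

lemma square_integrable_add:
  assumes f: "f \<in> square_integrable P" and g: "g \<in> square_integrable P"
  shows "(\<lambda>x. f x + g x) \<in> square_integrable P"
    and "(LINT x|P. (f x + g x)\<^sup>2) = (LINT x|P. (f x)\<^sup>2) + 2 * (LINT x|P. f x * g x) + (LINT x|P. (g x)\<^sup>2)"
proof -
  have *: "(\<lambda>x. (f x + g x)\<^sup>2) = (\<lambda>x. (f x)\<^sup>2 + 2 * (f x * g x) + (g x)\<^sup>2)"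
    by (simp add: power2_sum algebra_simps)
  note [simp] = square_integrableD[OF f] square_integrableD[OF g] square_integrable_mult[OF assms]
  show "(\<lambda>x. f x + g x) \<in> square_integrable P"
    by (rule square_integrableI) (auto simp: * intro!: borel_measurable_add)
  show "(LINT x|P. (f x + g x)\<^sup>2) = (LINT x|P. (f x)\<^sup>2) + 2 * (LINT x|P. f x * g x) + (LINT x|P. (g x)\<^sup>2)"
    by (simp add: *)
qed

lemma square_integrable_diff:
  assumes f: "f \<in> square_integrable P" and g: "g \<in> square_integrable P"
  shows "(\<lambda>x. f x - g x) \<in> square_integrable P"
    and "(LINT x|P. (f x - g x)\<^sup>2) = (LINT x|P. (f x)\<^sup>2) - 2 * (LINT x|P. f x * g x) + (LINT x|P. (g x)\<^sup>2)"
  using square_integrable_add[OF f square_integrable_scale[OF g, of "-1"]] by simp_all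

lemma square_integrable_Cauchy_Schwarz:
  assumes f: "f \<in> square_integrable P" and g: "g \<in> square_integrable P"
  shows "(LINT x|P. f x * g x)\<^sup>2 \<le> (LINT x|P. (f x)\<^sup>2) * (LINT x|P. (g x)\<^sup>2)"
proof -
  define A B D where "A = (LINT x|P. (f x)\<^sup>2)" and "B = (LINT x|P. f x * g x)" and "D = (LINT x|P. (g x)\<^sup>2)"
  have "0 \<le> A + 2 * t * B + t\<^sup>2 * D" for t
  proof -
    have "0 \<le> (LINT x|P. (f x + t * g x)\<^sup>2)" by simp
    also have "\<dots> = A + 2 * t * B + t\<^sup>2 * D"
      unfolding square_integrable_add(2)[OF f square_integrable_scale[OF g, of t]] A_def B_def D_def
      by (simp add: power_mult_distrib mult.left_commute[of "f _" t] mult.assoc)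
    finally show ?thesis .
  qed note pos = this
  have "B\<^sup>2 \<le> A * D"
  proof (cases "D = 0")
    case True
    have "B = 0"
    proof (rule ccontr)
      assume "B \<noteq> 0"
      then show False using pos[of "- (A + 1) / (2 * B)"] True by (simp add: field_simps)
    qed
    then show ?thesis using True by simp
  next
    case False
    moreover have "D \<ge> 0" by (simp add: D_def)
    ultimately have D: "D > 0" by simp
    have "0 \<le> (A + 2 * (- B / D) * B + (- B / D)\<^sup>2 * D) * D" using pos[of "- B / D"] D by simp
    also have "\<dots> = A * D - B\<^sup>2" using D by (simp add: field_simps power2_eq_square)
    finally show ?thesis by simp
  qed
  then show ?thesis by (simp add: A_def B_def D_def)
qed

lemma integrable_nn_integral_le:
  assumes "f \<in> borel_measurable P" "\<And>x. 0 \<le> f x" "(\<integral>\<^sup>+x. ennreal (f x) \<partial>P) \<le> ennreal c" "0 \<le> c"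
  shows "integrable P f" "(LINT x|P. f x) \<le> c"
proof -
  show "integrable P f"
    using assms by (intro integrableI_bounded) (auto intro: le_less_trans)
  then have "ennreal (LINT x|P. f x) \<le> ennreal c"
    using assms(2,3) by (subst nn_integral_eq_integral[symmetric]) auto
  then show "(LINT x|P. f x) \<le> c" using assms(4) by simp
qed

section \<open>The covariance operator of a random feature vector\<close>

locale features = prob_space Q + orthonormal_basis e I
  for Q :: "'z measure" and e :: "nat \<Rightarrow> 'h::{real_inner, complete_space}" and I :: "nat set" +
  fixes \<phi> :: "'z \<Rightarrow> 'h" and C :: "'h \<Rightarrow>\<^sub>L 'h" and \<mu> :: "nat \<Rightarrow> real" and R :: real
  assumes phi_measurable: "weakly_measurable Q \<phi>"
    and cov: "\<And>g h. has_bochner_integral Q (\<lambda>z. inner (\<phi> z) g * inner (\<phi> z) h) (inner (C g) h)"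
    and fourth_integrable: "\<And>g. integrable Q (\<lambda>z. (norm (\<phi> z))\<^sup>2 * (inner (\<phi> z) g)\<^sup>2)"
    and fourth_le: "\<And>g. (LINT z|Q. (norm (\<phi> z))\<^sup>2 * (inner (\<phi> z) g)\<^sup>2) \<le> R\<^sup>2 * inner (C g) g"
    and eigen: "\<And>i. C (e i) = \<mu> i *\<^sub>R e i"
    and mu_pos: "\<And>i. 0 < \<mu> i"
    and mu_outside: "\<And>i. i \<notin> I \<Longrightarrow> \<mu> i \<le> R\<^sup>2"
begin

lemma cov_sym: "inner (C g) h = inner (C h) g"
  using has_bochner_integral_eq[OF cov[of g h]] cov[of h g] by (simp add: mult.commute)

lemma cov_integral: "(LINT z|Q. inner (\<phi> z) g * inner (\<phi> z) h) = inner (C g) h"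
  by (rule has_bochner_integral_integral_eq[OF cov])

lemma inner_phi_square_integrable: "(\<lambda>z. inner (\<phi> z) g) \<in> square_integrable Q"
  using phi_measurable cov[of g g]
  by (intro square_integrableI) (auto dest: weakly_measurableD simp: has_bochner_integral_iff power2_eq_square)

lemma cov_diag: "(LINT z|Q. (inner (\<phi> z) g)\<^sup>2) = inner (C g) g"
  using cov_integral[of g g] by (simp add: power2_eq_square)

lemma cov_nonneg: "0 \<le> inner (C g) g"
  unfolding cov_diag[symmetric] by simp

lemma weakly_measurable_cov:
  assumes "weakly_measurable P X"
  shows "weakly_measurable P (\<lambda>p. C (X p))"
proof -
  have "inner (C (X p)) g = inner (X p) (C g)" for p g
    by (metis cov_sym inner_commute)
  then show ?thesis using assms by (simp add: weakly_measurable_def)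
qed

lemma deviation_norm:
  assumes u: "u \<in> square_integrable Q" and u4: "integrable Q (\<lambda>z. (norm (\<phi> z))\<^sup>2 * (u z)\<^sup>2)"
    and s: "\<And>h. (LINT z|Q. u z * inner (\<phi> z) h) = inner s h"
  shows "integrable Q (\<lambda>z. (norm (s - u z *\<^sub>R \<phi> z))\<^sup>2)"
    and "(LINT z|Q. (norm (s - u z *\<^sub>R \<phi> z))\<^sup>2) = (LINT z|Q. (norm (\<phi> z))\<^sup>2 * (u z)\<^sup>2) - (norm s)\<^sup>2"
proof -
  have eq: "(norm (s - u z *\<^sub>R \<phi> z))\<^sup>2
      = (norm s)\<^sup>2 - 2 * (u z * inner (\<phi> z) s) + (norm (\<phi> z))\<^sup>2 * (u z)\<^sup>2" for z
    by (simp only: power2_norm_eq_inner)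
      (simp add: inner_diff_left inner_diff_right inner_commute power2_eq_square algebra_simps)
  have i: "integrable Q (\<lambda>z. u z * inner (\<phi> z) s)"
    by (rule square_integrable_mult[OF u inner_phi_square_integrable])
  show "integrable Q (\<lambda>z. (norm (s - u z *\<^sub>R \<phi> z))\<^sup>2)"
    unfolding eq using i u4 by simp
  show "(LINT z|Q. (norm (s - u z *\<^sub>R \<phi> z))\<^sup>2) = (LINT z|Q. (norm (\<phi> z))\<^sup>2 * (u z)\<^sup>2) - (norm s)\<^sup>2"
    unfolding eq using i u4 by (simp add: s prob_space power2_norm_eq_inner)
qed

lemma cov_deviation:
  shows "integrable Q (\<lambda>z. (norm (C g - inner (\<phi> z) g *\<^sub>R \<phi> z))\<^sup>2)"
    and "(LINT z|Q. (norm (C g - inner (\<phi> z) g *\<^sub>R \<phi> z))\<^sup>2) \<le> R\<^sup>2 * inner (C g) g - (norm (C g))\<^sup>2"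
  using deviation_norm[OF inner_phi_square_integrable fourth_integrable cov_integral, of g] fourth_le[of g]
  by auto

lemma norm_cov_le: "(norm (C g))\<^sup>2 \<le> R\<^sup>2 * inner (C g) g"
proof -
  have "0 \<le> (LINT z|Q. (norm (C g - inner (\<phi> z) g *\<^sub>R \<phi> z))\<^sup>2)" by simp
  then show ?thesis using cov_deviation(2)[of g] by linarith
qed

lemma cov_le: "inner (C g) g \<le> R\<^sup>2 * (norm g)\<^sup>2"
proof (cases "inner (C g) g = 0")
  case False
  then have pos: "inner (C g) g > 0" using cov_nonneg[of g] by simp
  have "(inner (C g) g)\<^sup>2 \<le> (norm (C g))\<^sup>2 * (norm g)\<^sup>2"
    using Cauchy_Schwarz_ineq[of "C g" g] by (simp add: power2_norm_eq_inner)
  also have "\<dots> \<le> (R\<^sup>2 * inner (C g) g) * (norm g)\<^sup>2" using norm_cov_le by (intro mult_right_mono) auto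
  finally have "inner (C g) g * inner (C g) g \<le> inner (C g) g * (R\<^sup>2 * (norm g)\<^sup>2)"
    by (simp add: power2_eq_square mult_ac)
  then show ?thesis using pos by simp
qed simp

lemma mu_le: "\<mu> i \<le> R\<^sup>2"
proof (cases "i \<in> I")
  case True
  have "(norm (C (e i)))\<^sup>2 \<le> R\<^sup>2 * inner (C (e i)) (e i)" by (rule norm_cov_le)
  then have "\<mu> i * \<mu> i \<le> R\<^sup>2 * \<mu> i"
    using True by (simp only: power2_norm_eq_inner eigen inner_scaleR_left inner_scaleR_right orthonormal) simp
  then show ?thesis using mu_pos[of i] by simp
qed (rule mu_outside)

definition in_closure :: "('z \<Rightarrow> real) \<Rightarrow> bool" where
  "in_closure u \<longleftrightarrow> u \<in> square_integrable Q \<and> (\<forall>\<epsilon>>0. \<exists>g. (LINT z|Q. (inner (\<phi> z) g - u z)\<^sup>2) < \<epsilon>)"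

lemma in_closure_square_integrable: "in_closure u \<Longrightarrow> u \<in> square_integrable Q"
  by (simp add: in_closure_def)

lemma in_closure_sequence:
  assumes "in_closure u"
  obtains g where "(\<lambda>n::nat. LINT z|Q. (inner (\<phi> z) (g n) - u z)\<^sup>2) \<longlonglongrightarrow> 0"
proof -
  have "\<forall>n::nat. \<exists>g. (LINT z|Q. (inner (\<phi> z) g - u z)\<^sup>2) < 1 / real (Suc n)"
    using assms by (auto simp: in_closure_def)
  then obtain g where g: "\<And>n::nat. (LINT z|Q. (inner (\<phi> z) (g n) - u z)\<^sup>2) < 1 / real (Suc n)" by metis
  have "(\<lambda>n::nat. LINT z|Q. (inner (\<phi> z) (g n) - u z)\<^sup>2) \<longlonglongrightarrow> 0"
  proof (rule tendsto_sandwich[OF _ _ tendsto_const])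
    show "(\<lambda>n. 1 / real (Suc n)) \<longlonglongrightarrow> 0" by (rule LIMSEQ_Suc[OF lim_1_over_n])
    show "\<forall>\<^sub>F n in sequentially. (LINT z|Q. (inner (\<phi> z) (g n) - u z)\<^sup>2) \<le> 1 / real (Suc n)"
      using g by (intro always_eventually) (auto intro: less_imp_le)
  qed simp
  then show ?thesis by (rule that)
qed

lemma in_closure_add:
  assumes "in_closure u"
  shows "in_closure (\<lambda>z. u z + inner (\<phi> z) d)"
  unfolding in_closure_def
proof (intro conjI allI impI)
  show "(\<lambda>z. u z + inner (\<phi> z) d) \<in> square_integrable Q"
    using assms inner_phi_square_integrable by (intro square_integrable_add) (auto simp: in_closure_def)
  fix \<epsilon> :: real assume "\<epsilon> > 0"
  then obtain g where "(LINT z|Q. (inner (\<phi> z) g - u z)\<^sup>2) < \<epsilon>" using assms by (auto simp: in_closure_def)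
  moreover have "inner (\<phi> z) (g + d) - (u z + inner (\<phi> z) d) = inner (\<phi> z) g - u z" for z
    by (simp add: inner_add_right)
  ultimately show "\<exists>g. (LINT z|Q. (inner (\<phi> z) g - (u z + inner (\<phi> z) d))\<^sup>2) < \<epsilon>"
    by (intro exI[of _ "g + d"]) (simp add: inner_add_right)
qed

text \<open>The representer is the limit of \<open>C g\<^sub>n\<close> for any \<open>g\<^sub>n\<close> that approximate \<open>u\<close> in \<open>L\<^sup>2\<close>.\<close>

lemma representer_exists:
  assumes u: "in_closure u"
  shows "\<exists>t. \<forall>h. (LINT z|Q. u z * inner (\<phi> z) h) = inner t h"
proof -
  note uQ = in_closure_square_integrable[OF u]
  obtain g where g: "(\<lambda>n::nat. LINT z|Q. (inner (\<phi> z) (g n) - u z)\<^sup>2) \<longlonglongrightarrow> 0"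
    using in_closure_sequence[OF u] .
  define \<delta> where "\<delta> n = (LINT z|Q. (inner (\<phi> z) (g n) - u z)\<^sup>2)" for n
  have sq: "(\<lambda>z. inner (\<phi> z) (g n) - u z) \<in> square_integrable Q" for n
    by (rule square_integrable_diff[OF inner_phi_square_integrable uQ])
  have dist: "(norm (C (g n) - C (g m)))\<^sup>2 \<le> 2 * R\<^sup>2 * (\<delta> n + \<delta> m)" for n m
  proof -
    have 1: "(norm (C (g n - g m)))\<^sup>2 \<le> R\<^sup>2 * (LINT z|Q. (inner (\<phi> z) (g n - g m))\<^sup>2)"
      using norm_cov_le[of "g n - g m"] by (simp add: cov_diag)
    have "(LINT z|Q. (inner (\<phi> z) (g n - g m))\<^sup>2)
        \<le> (LINT z|Q. 2 * (inner (\<phi> z) (g n) - u z)\<^sup>2 + 2 * (inner (\<phi> z) (g m) - u z)\<^sup>2)"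
    proof (rule integral_mono)
      fix z
      have "2 * a\<^sup>2 + 2 * b\<^sup>2 - (a - b)\<^sup>2 = (a + b)\<^sup>2" for a b :: real by (simp add: power2_eq_square algebra_simps)
      from this[of "inner (\<phi> z) (g n) - u z" "inner (\<phi> z) (g m) - u z"]
      show "(inner (\<phi> z) (g n - g m))\<^sup>2 \<le> 2 * (inner (\<phi> z) (g n) - u z)\<^sup>2 + 2 * (inner (\<phi> z) (g m) - u z)\<^sup>2"
        by (simp add: inner_diff_right) (smt (verit) zero_le_power2)
    qed (use sq[THEN square_integrableD(2)] inner_phi_square_integrable[THEN square_integrableD(2)] in auto)
    also have "\<dots> = 2 * \<delta> n + 2 * \<delta> m"
      using sq[of n] sq[of m] by (simp add: \<delta>_def square_integrableD)
    finally have "R\<^sup>2 * (LINT z|Q. (inner (\<phi> z) (g n - g m))\<^sup>2) \<le> R\<^sup>2 * (2 * \<delta> n + 2 * \<delta> m)"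
      by (rule mult_left_mono) simp
    with 1 show ?thesis by (simp add: blinfun.diff_right distrib_left mult.left_commute)
  qed
  have "Cauchy (\<lambda>n. C (g n))"
  proof (rule metric_CauchyI)
    fix \<epsilon> :: real assume "\<epsilon> > 0"
    define \<eta> where "\<eta> = \<epsilon>\<^sup>2 / (4 * R\<^sup>2 + 1)"
    have pos: "4 * R\<^sup>2 + 1 > 0" by (simp add: add_nonneg_pos)
    have "\<eta> > 0" using \<open>\<epsilon> > 0\<close> pos by (simp add: \<eta>_def)
    then have "\<forall>\<^sub>F n in sequentially. \<delta> n < \<eta>" using order_tendstoD(2)[OF g, of \<eta>] by (simp add: \<delta>_def)
    then obtain N where N: "\<And>n. n \<ge> N \<Longrightarrow> \<delta> n < \<eta>" by (auto simp: eventually_sequentially)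
    have "dist (C (g m)) (C (g n)) < \<epsilon>" if "m \<ge> N" "n \<ge> N" for m n
    proof -
      have "(norm (C (g m) - C (g n)))\<^sup>2 \<le> 2 * R\<^sup>2 * (\<eta> + \<eta>)"
        using dist[of m n] N[OF that(1)] N[OF that(2)]
        by (elim order_trans) (intro mult_left_mono, auto)
      also have "\<dots> < (4 * R\<^sup>2 + 1) * \<eta>" using \<open>\<eta> > 0\<close> by (simp add: algebra_simps)
      also have "\<dots> = \<epsilon>\<^sup>2" using pos by (simp add: \<eta>_def)
      finally show ?thesis using \<open>\<epsilon> > 0\<close> by (simp add: dist_norm power2_less_imp_less)
    qed
    then show "\<exists>M. \<forall>m\<ge>M. \<forall>n\<ge>M. dist (C (g m)) (C (g n)) < \<epsilon>" by blast
  qed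
  then obtain t where t: "(\<lambda>n. C (g n)) \<longlonglongrightarrow> t" using Cauchy_convergent convergent_def by blast
  have "(LINT z|Q. u z * inner (\<phi> z) h) = inner t h" for h
  proof -
    have "(\<lambda>n. (LINT z|Q. (inner (\<phi> z) (g n) - u z) * inner (\<phi> z) h)\<^sup>2) \<longlonglongrightarrow> 0"
    proof (rule tendsto_sandwich[OF _ _ tendsto_const])
      show "(\<lambda>n. \<delta> n * inner (C h) h) \<longlonglongrightarrow> 0"
        using tendsto_mult_right[OF g, of "inner (C h) h"] by (simp add: \<delta>_def)
      show "\<forall>\<^sub>F n in sequentially. (LINT z|Q. (inner (\<phi> z) (g n) - u z) * inner (\<phi> z) h)\<^sup>2 \<le> \<delta> n * inner (C h) h"
        using square_integrable_Cauchy_Schwarz[OF sq inner_phi_square_integrable]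
        by (intro always_eventually) (auto simp: \<delta>_def cov_diag)
    qed simp
    then have "(\<lambda>n. LINT z|Q. (inner (\<phi> z) (g n) - u z) * inner (\<phi> z) h) \<longlonglongrightarrow> 0"
      by (simp add: power_tendsto_0_iff)
    moreover have "(LINT z|Q. (inner (\<phi> z) (g n) - u z) * inner (\<phi> z) h)
        = inner (C (g n)) h - (LINT z|Q. u z * inner (\<phi> z) h)" for n
      using square_integrable_mult[OF inner_phi_square_integrable inner_phi_square_integrable, of "g n" h]
        square_integrable_mult[OF uQ inner_phi_square_integrable, of h]
      by (simp add: left_diff_distrib cov_integral)
    ultimately have "(\<lambda>n. inner (C (g n)) h - (LINT z|Q. u z * inner (\<phi> z) h)) \<longlonglongrightarrow> 0" by simp
    moreover have "(\<lambda>n. inner (C (g n)) h - (LINT z|Q. u z * inner (\<phi> z) h))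
        \<longlonglongrightarrow> inner t h - (LINT z|Q. u z * inner (\<phi> z) h)"
      by (intro tendsto_intros t)
    ultimately show ?thesis using LIMSEQ_unique by fastforce
  qed
  then show ?thesis by blast
qed

lemma fourth_closure:
  assumes u: "in_closure u"
  shows "integrable Q (\<lambda>z. (norm (\<phi> z))\<^sup>2 * (u z)\<^sup>2)"
    and "(LINT z|Q. (norm (\<phi> z))\<^sup>2 * (u z)\<^sup>2) \<le> R\<^sup>2 * (LINT z|Q. (u z)\<^sup>2)"
proof -
  note uQ = in_closure_square_integrable[OF u]
  obtain g where g: "(\<lambda>n::nat. LINT z|Q. (inner (\<phi> z) (g n) - u z)\<^sup>2) \<longlonglongrightarrow> 0"
    using in_closure_sequence[OF u] .
  have sq: "(\<lambda>z. inner (\<phi> z) (g n) - u z) \<in> square_integrable Q" for n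
    by (rule square_integrable_diff[OF inner_phi_square_integrable uQ])
  obtain s where s: "strict_mono s" "AE z in Q. (\<lambda>n. (inner (\<phi> z) (g (s n)) - u z)\<^sup>2) \<longlonglongrightarrow> 0"
    using tendsto_L1_AE_subseq[of Q "\<lambda>n z. (inner (\<phi> z) (g n) - u z)\<^sup>2"] sq g
    by (auto dest: square_integrableD)
  define U where "U = (LINT z|Q. (u z)\<^sup>2)"
  define D where "D n = (LINT z|Q. (inner (\<phi> z) (g (s n)) - u z)\<^sup>2)" for n
  have D0: "D \<longlonglongrightarrow> 0" using LIMSEQ_subseq_LIMSEQ[OF g s(1)] by (simp add: D_def[abs_def] o_def)
  have cov_lim: "(\<lambda>n. inner (C (g (s n))) (g (s n))) \<longlonglongrightarrow> U"
  proof -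
    have cs: "(\<lambda>n. (LINT z|Q. (inner (\<phi> z) (g (s n)) - u z) * u z)) \<longlonglongrightarrow> 0"
    proof -
      have "(\<lambda>n. (LINT z|Q. (inner (\<phi> z) (g (s n)) - u z) * u z)\<^sup>2) \<longlonglongrightarrow> 0"
      proof (rule tendsto_sandwich[OF _ _ tendsto_const])
        show "(\<lambda>n. D n * U) \<longlonglongrightarrow> 0" using tendsto_mult_right[OF D0, of U] by simp
        show "\<forall>\<^sub>F n in sequentially. (LINT z|Q. (inner (\<phi> z) (g (s n)) - u z) * u z)\<^sup>2 \<le> D n * U"
          using square_integrable_Cauchy_Schwarz[OF sq uQ]
          by (intro always_eventually) (auto simp: D_def U_def)
      qed simp
      then show ?thesis by (simp add: power_tendsto_0_iff)
    qed
    have "inner (C (g (s n))) (g (s n))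
        = D n + 2 * (LINT z|Q. (inner (\<phi> z) (g (s n)) - u z) * u z) + U" for n
      using square_integrable_add(2)[OF sq[of "s n"] uQ] by (simp add: cov_diag D_def U_def)
    moreover have "(\<lambda>n. D n + 2 * (LINT z|Q. (inner (\<phi> z) (g (s n)) - u z) * u z) + U) \<longlonglongrightarrow> 0 + 2 * 0 + U"
      by (intro tendsto_intros D0 cs)
    ultimately show ?thesis by simp
  qed
  have norm_meas [measurable]: "(\<lambda>z. (norm (\<phi> z))\<^sup>2) \<in> borel_measurable Q"
    by (rule borel_measurable_norm2[OF phi_measurable])
  have [measurable]: "u \<in> borel_measurable Q" "(\<lambda>z. inner (\<phi> z) h) \<in> borel_measurable Q" for h
    using uQ phi_measurable by (auto dest: square_integrableD weakly_measurableD)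
  have "(\<integral>\<^sup>+z. ennreal ((norm (\<phi> z))\<^sup>2 * (u z)\<^sup>2) \<partial>Q)
      \<le> (\<integral>\<^sup>+z. liminf (\<lambda>n. ennreal ((norm (\<phi> z))\<^sup>2 * (inner (\<phi> z) (g (s n)))\<^sup>2)) \<partial>Q)"
  proof (rule nn_integral_mono_AE)
    show "AE z in Q. ennreal ((norm (\<phi> z))\<^sup>2 * (u z)\<^sup>2)
        \<le> liminf (\<lambda>n. ennreal ((norm (\<phi> z))\<^sup>2 * (inner (\<phi> z) (g (s n)))\<^sup>2))"
      using s(2)
    proof eventually_elim
      case (elim z)
      then have "(\<lambda>n. inner (\<phi> z) (g (s n)) - u z) \<longlonglongrightarrow> 0" by (simp add: power_tendsto_0_iff)
      then have "(\<lambda>n. inner (\<phi> z) (g (s n))) \<longlonglongrightarrow> u z" by (simp add: LIM_zero_cancel)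
      then have "(\<lambda>n. ennreal ((norm (\<phi> z))\<^sup>2 * (inner (\<phi> z) (g (s n)))\<^sup>2)) \<longlonglongrightarrow> ennreal ((norm (\<phi> z))\<^sup>2 * (u z)\<^sup>2)"
        by (intro tendsto_intros tendsto_ennrealI)
      then show ?case using lim_imp_Liminf[OF trivial_limit_sequentially] by (metis order_refl)
    qed
  qed
  also have "\<dots> \<le> liminf (\<lambda>n. \<integral>\<^sup>+z. ennreal ((norm (\<phi> z))\<^sup>2 * (inner (\<phi> z) (g (s n)))\<^sup>2) \<partial>Q)"
    by (intro nn_integral_liminf) simp
  also have "\<dots> \<le> liminf (\<lambda>n. ennreal (R\<^sup>2 * inner (C (g (s n))) (g (s n))))"
    using fourth_le fourth_integrable
    by (intro Liminf_mono always_eventually allI) (auto simp: nn_integral_eq_integral intro!: ennreal_leI)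
  also have "\<dots> = ennreal (R\<^sup>2 * U)"
    by (intro lim_imp_Liminf tendsto_ennrealI tendsto_mult_left cov_lim) simp
  finally have *: "(\<integral>\<^sup>+z. ennreal ((norm (\<phi> z))\<^sup>2 * (u z)\<^sup>2) \<partial>Q) \<le> ennreal (R\<^sup>2 * U)" .
  show "integrable Q (\<lambda>z. (norm (\<phi> z))\<^sup>2 * (u z)\<^sup>2)"
    and "(LINT z|Q. (norm (\<phi> z))\<^sup>2 * (u z)\<^sup>2) \<le> R\<^sup>2 * (LINT z|Q. (u z)\<^sup>2)"
    using integrable_nn_integral_le[OF _ _ *] by (auto simp: U_def)
qed

lemma parseval_closure:
  assumes u: "in_closure u"
  shows "(\<lambda>i. (LINT z|Q. u z * inner (\<phi> z) (e i))\<^sup>2 / \<mu> i) sums (LINT z|Q. (u z)\<^sup>2)"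
proof -
  note uQ = in_closure_square_integrable[OF u]
  obtain t where t: "\<And>h. (LINT z|Q. u z * inner (\<phi> z) h) = inner t h" using representer_exists[OF u] by auto
  define U where "U = (LINT z|Q. (u z)\<^sup>2)"
  define \<alpha> where "\<alpha> i = inner t (e i)" for i
  define err where "err h = (LINT z|Q. (u z - inner (\<phi> z) h)\<^sup>2)" for h
  have err_eq: "err h = U - 2 * inner t h + inner (C h) h" for h
    unfolding err_def U_def square_integrable_diff(2)[OF uQ inner_phi_square_integrable] t cov_diag ..
  have err_nonneg: "0 \<le> err h" for h by (simp add: err_def)
  define best where "best n = (\<Sum>i<n. (\<alpha> i / \<mu> i) *\<^sub>R e i)" for n
  have inner_best: "inner t (best n) = (\<Sum>i<n. (\<alpha> i)\<^sup>2 / \<mu> i)" for n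
    by (simp add: best_def inner_sum_right \<alpha>_def power2_eq_square)
  have cov_sum: "inner (C (\<Sum>i<n. a i *\<^sub>R e i)) (\<Sum>i<n. b i *\<^sub>R e i) = (\<Sum>i<n. \<mu> i * a i * b i * inner (e i) (e i))"
    for n and a b :: "nat \<Rightarrow> real"
  proof -
    have "inner (a i *\<^sub>R \<mu> i *\<^sub>R e i) (\<Sum>j<n. b j *\<^sub>R e j) = \<mu> i * a i * b i * inner (e i) (e i)"
      if "i < n" for i
    proof -
      have "inner (a i *\<^sub>R \<mu> i *\<^sub>R e i) (\<Sum>j<n. b j *\<^sub>R e j)
          = (\<Sum>j<n. if j = i then \<mu> i * a i * b i * inner (e i) (e i) else 0)"
        unfolding inner_sum_right by (intro sum.cong refl) (auto simp: orthonormal)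
      then show ?thesis using that by simp
    qed
    then show ?thesis
      unfolding blinfun.sum_right blinfun.scaleR_right eigen inner_sum_left by (intro sum.cong) auto
  qed
  have alpha_e: "\<alpha> i * inner (e i) (e i) = \<alpha> i" for i
    by (cases "i \<in> I") (auto simp: orthonormal \<alpha>_def basis_eq_0)
  have err_best: "err (best n) = U - (\<Sum>i<n. (\<alpha> i)\<^sup>2 / \<mu> i)" for n
  proof -
    have "inner (C (best n)) (best n) = (\<Sum>i<n. (\<alpha> i)\<^sup>2 / \<mu> i)"
      unfolding best_def cov_sum using mu_pos alpha_e
      by (intro sum.cong refl) (simp add: power2_eq_square mult.assoc less_imp_neq[symmetric])
    then show ?thesis by (simp add: err_eq inner_best)
  qed
  have best_le: "err (best n) \<le> err (proj n g)" for n g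
  proof -
    have "inner (C (proj n g)) (proj n g) - 2 * inner t (proj n g) + (\<Sum>i<n. (\<alpha> i)\<^sup>2 / \<mu> i)
       = (\<Sum>i<n. \<mu> i * (inner g (e i))\<^sup>2 * inner (e i) (e i) - 2 * (inner g (e i) * \<alpha> i) + (\<alpha> i)\<^sup>2 / \<mu> i)"
      unfolding proj_def cov_sum
      by (simp add: inner_sum_right \<alpha>_def sum.distrib sum_subtractf sum_distrib_left power2_eq_square mult.assoc)
    also have "\<dots> \<ge> 0"
    proof (intro sum_nonneg)
      fix i
      show "0 \<le> \<mu> i * (inner g (e i))\<^sup>2 * inner (e i) (e i) - 2 * (inner g (e i) * \<alpha> i) + (\<alpha> i)\<^sup>2 / \<mu> i"
      proof (cases "i \<in> I")
        case True
        have "\<mu> i * (inner g (e i))\<^sup>2 - 2 * (inner g (e i) * \<alpha> i) + (\<alpha> i)\<^sup>2 / \<mu> i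
            = \<mu> i * (inner g (e i) - \<alpha> i / \<mu> i)\<^sup>2"
          using mu_pos[of i] by (simp add: power2_eq_square field_simps)
        also have "\<dots> \<ge> 0" using mu_pos[of i] by simp
        finally show ?thesis using True by (simp add: orthonormal)
      qed (simp add: \<alpha>_def basis_eq_0)
    qed
    finally show ?thesis unfolding err_best[of n] err_eq[of "proj n g"] by linarith
  qed
  have "(\<lambda>n. err (best n)) \<longlonglongrightarrow> 0"
  proof (rule order_tendstoI)
    fix \<epsilon> :: real assume "\<epsilon> > 0"
    then obtain g where "(LINT z|Q. (inner (\<phi> z) g - u z)\<^sup>2) < \<epsilon>" using u by (auto simp: in_closure_def)
    then have g: "err g < \<epsilon>" by (simp add: err_def power2_commute)
    have "(\<lambda>n. err (proj n g)) \<longlonglongrightarrow> err g"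
      unfolding err_eq by (intro tendsto_intros proj_tendsto)
    then have "\<forall>\<^sub>F n in sequentially. err (proj n g) < \<epsilon>" using g by (rule order_tendstoD)
    then show "\<forall>\<^sub>F n in sequentially. err (best n) < \<epsilon>"
      by eventually_elim (use best_le le_less_trans in blast)
  next
    fix a :: real assume "a < 0"
    then show "\<forall>\<^sub>F n in sequentially. a < err (best n)"
      by (intro always_eventually allI less_le_trans[OF _ err_nonneg])
  qed
  then have "(\<lambda>n. U - err (best n)) \<longlonglongrightarrow> U - 0" by (intro tendsto_intros)
  then show ?thesis by (simp add: sums_def err_best t \<alpha>_def U_def)
qed

end

section \<open>Independent products\<close>

lemma pair_integral_eq_0:
  fixes f :: "'p \<times> 'z \<Rightarrow> real"
  assumes "prob_space P" "prob_space Q" and f: "integrable (P \<Otimes>\<^sub>M Q) f"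
    and 0: "\<And>z. z \<in> space Q \<Longrightarrow> (LINT p|P. f (p, z)) = 0"
  shows "(LINT x|(P \<Otimes>\<^sub>M Q). f x) = 0"
proof -
  interpret P: prob_space P by fact
  interpret Q: prob_space Q by fact
  interpret pair_sigma_finite P Q ..
  have "(LINT x|(P \<Otimes>\<^sub>M Q). f x) = (LINT z|Q. LINT p|P. f (p, z))"
    using integral_snd[of "\<lambda>p z. f (p, z)"] f by simp
  also have "\<dots> = (LINT z|Q. 0)" by (intro Bochner_Integration.integral_cong refl 0)
  finally show ?thesis by simp
qed

lemma pair_integral_eq_0':
  fixes f :: "'p \<times> 'z \<Rightarrow> real"
  assumes "prob_space P" "prob_space Q" and f: "integrable (P \<Otimes>\<^sub>M Q) f"
    and 0: "\<And>p. p \<in> space P \<Longrightarrow> (LINT z|Q. f (p, z)) = 0"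
  shows "(LINT x|(P \<Otimes>\<^sub>M Q). f x) = 0"
proof -
  interpret P: prob_space P by fact
  interpret Q: prob_space Q by fact
  interpret pair_sigma_finite P Q ..
  have "(LINT x|(P \<Otimes>\<^sub>M Q). f x) = (LINT p|P. LINT z|Q. f (p, z))"
    using integral_fst'[OF f] by simp
  also have "\<dots> = (LINT p|P. 0)" by (intro Bochner_Integration.integral_cong refl 0)
  finally show ?thesis by simp
qed

lemma distr_pair_snd:
  assumes "prob_space P" "prob_space Q"
  shows "distr (P \<Otimes>\<^sub>M Q) Q snd = Q"
proof (rule measure_eqI)
  interpret P: prob_space P by fact
  interpret Q: prob_space Q by fact
  fix A assume "A \<in> sets (distr (P \<Otimes>\<^sub>M Q) Q snd)"
  then have A: "A \<in> sets Q" by simp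
  have "snd -` A \<inter> space (P \<Otimes>\<^sub>M Q) = space P \<times> A"
    using sets.sets_into_space[OF A] by (auto simp: space_pair_measure)
  then show "emeasure (distr (P \<Otimes>\<^sub>M Q) Q snd) A = emeasure Q A"
    using A by (simp add: emeasure_distr Q.emeasure_pair_measure_Times P.emeasure_space_1)
qed simp

lemma pair_integral_snd_only:
  fixes f :: "'z \<Rightarrow> real"
  assumes "prob_space P" "prob_space Q" and f: "integrable Q f"
  shows "integrable (P \<Otimes>\<^sub>M Q) (\<lambda>x. f (snd x))" "(LINT x|(P \<Otimes>\<^sub>M Q). f (snd x)) = (LINT z|Q. f z)"
proof -
  interpret P: prob_space P by fact
  interpret Q: prob_space Q by fact
  have d: "distr (P \<Otimes>\<^sub>M Q) Q snd = Q" by (rule distr_pair_snd) fact+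
  show "integrable (P \<Otimes>\<^sub>M Q) (\<lambda>x. f (snd x))"
    using integrable_distr[of snd "P \<Otimes>\<^sub>M Q" Q f] f by (simp add: d)
  show "(LINT x|(P \<Otimes>\<^sub>M Q). f (snd x)) = (LINT z|Q. f z)"
    using integral_distr[of snd "P \<Otimes>\<^sub>M Q" Q f] f by (simp add: d)
qed

lemma pair_integral_fst_only:
  fixes f :: "'p \<Rightarrow> real"
  assumes "prob_space P" "prob_space Q" and f: "integrable P f"
  shows "integrable (P \<Otimes>\<^sub>M Q) (\<lambda>x. f (fst x))" "(LINT x|(P \<Otimes>\<^sub>M Q). f (fst x)) = (LINT p|P. f p)"
proof -
  interpret P: prob_space P by fact
  interpret Q: prob_space Q by fact
  have d: "distr (P \<Otimes>\<^sub>M Q) P fst = P" by (rule Q.distr_pair_fst)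
  show "integrable (P \<Otimes>\<^sub>M Q) (\<lambda>x. f (fst x))"
    using integrable_distr[of fst "P \<Otimes>\<^sub>M Q" P f] f by (simp add: d)
  show "(LINT x|(P \<Otimes>\<^sub>M Q). f (fst x)) = (LINT p|P. f p)"
    using integral_distr[of fst "P \<Otimes>\<^sub>M Q" P f] f by (simp add: d)
qed

definition second_moment_le :: "'p measure \<Rightarrow> ('p \<Rightarrow> 'h::real_inner) \<Rightarrow> real \<Rightarrow> bool" where
  "second_moment_le P X A \<longleftrightarrow> weakly_measurable P X \<and> 0 \<le> A \<and>
     (\<forall>h. integrable P (\<lambda>p. (inner (X p) h)\<^sup>2) \<and> (LINT p|P. (inner (X p) h)\<^sup>2) \<le> A * (norm h)\<^sup>2)"

context orthonormal_basis
begin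

lemma pair_inner_square_integrable:
  fixes X :: "'p \<Rightarrow> 'h" and Y :: "'z \<Rightarrow> 'h"
  assumes "prob_space P" "prob_space Q"
    and X: "second_moment_le P X A"
    and Y: "weakly_measurable Q Y" "integrable Q (\<lambda>z. (norm (Y z))\<^sup>2)"
  shows "(\<lambda>x. inner (X (fst x)) (Y (snd x))) \<in> square_integrable (P \<Otimes>\<^sub>M Q)"
    and "(LINT x|(P \<Otimes>\<^sub>M Q). (inner (X (fst x)) (Y (snd x)))\<^sup>2) \<le> A * (LINT z|Q. (norm (Y z))\<^sup>2)"
proof -
  interpret P: prob_space P by fact
  interpret Q: prob_space Q by fact
  interpret pair_sigma_finite P Q ..
  have wX: "weakly_measurable (P \<Otimes>\<^sub>M Q) (\<lambda>x. X (fst x))"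
    using X by (intro weakly_measurable_compose[OF _ measurable_fst]) (auto simp: second_moment_le_def)
  have wY: "weakly_measurable (P \<Otimes>\<^sub>M Q) (\<lambda>x. Y (snd x))"
    using Y by (intro weakly_measurable_compose[OF _ measurable_snd])
  have m [measurable]: "(\<lambda>x. inner (X (fst x)) (Y (snd x))) \<in> borel_measurable (P \<Otimes>\<^sub>M Q)"
    by (rule borel_measurable_inner[OF wX wY])
  have A: "0 \<le> A" using X by (simp add: second_moment_le_def)
  have "(\<integral>\<^sup>+x. ennreal ((inner (X (fst x)) (Y (snd x)))\<^sup>2) \<partial>(P \<Otimes>\<^sub>M Q))
      = (\<integral>\<^sup>+z. \<integral>\<^sup>+p. ennreal ((inner (X p) (Y z))\<^sup>2) \<partial>P \<partial>Q)"
    by (subst nn_integral_snd[symmetric]) auto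
  also have "\<dots> \<le> (\<integral>\<^sup>+z. ennreal (A * (norm (Y z))\<^sup>2) \<partial>Q)"
    using X by (intro nn_integral_mono) (auto simp: second_moment_le_def nn_integral_eq_integral intro!: ennreal_leI)
  also have "\<dots> = ennreal (A * (LINT z|Q. (norm (Y z))\<^sup>2))"
    using Y(2) A by (subst nn_integral_eq_integral) auto
  finally have *: "(\<integral>\<^sup>+x. ennreal ((inner (X (fst x)) (Y (snd x)))\<^sup>2) \<partial>(P \<Otimes>\<^sub>M Q))
      \<le> ennreal (A * (LINT z|Q. (norm (Y z))\<^sup>2))" .
  note ** = integrable_nn_integral_le[OF _ _ *]
  show "(\<lambda>x. inner (X (fst x)) (Y (snd x))) \<in> square_integrable (P \<Otimes>\<^sub>M Q)"
    using m ** A by (intro square_integrableI) auto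
  show "(LINT x|(P \<Otimes>\<^sub>M Q). (inner (X (fst x)) (Y (snd x)))\<^sup>2) \<le> A * (LINT z|Q. (norm (Y z))\<^sup>2)"
    using ** A by auto
qed

lemma norm_add_integral:
  fixes F G :: "'p \<Rightarrow> 'h"
  assumes "weakly_measurable P F" "weakly_measurable P G"
    and F: "integrable P (\<lambda>p. (norm (F p))\<^sup>2)" and G: "integrable P (\<lambda>p. (norm (G p))\<^sup>2)"
  shows "integrable P (\<lambda>p. inner (F p) (G p))"
    and "integrable P (\<lambda>p. (norm (F p + G p))\<^sup>2)"
    and "(LINT p|P. (norm (F p + G p))\<^sup>2)
      = (LINT p|P. (norm (F p))\<^sup>2) + 2 * (LINT p|P. inner (F p) (G p)) + (LINT p|P. (norm (G p))\<^sup>2)"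
proof -
  show i: "integrable P (\<lambda>p. inner (F p) (G p))"
  proof (rule Bochner_Integration.integrable_bound)
    show "integrable P (\<lambda>p. (norm (F p))\<^sup>2 + (norm (G p))\<^sup>2)" using F G by simp
    show "(\<lambda>p. inner (F p) (G p)) \<in> borel_measurable P" using assms by (intro borel_measurable_inner)
    have "\<bar>inner a b\<bar> \<le> (norm a)\<^sup>2 + (norm b)\<^sup>2" for a b :: 'h
      using Cauchy_Schwarz_ineq2[of a b] sum_squares_bound[of "norm a" "norm b"]
        mult_nonneg_nonneg[of "norm a" "norm b"] by (simp add: mult.assoc)
    then show "AE p in P. norm (inner (F p) (G p)) \<le> norm ((norm (F p))\<^sup>2 + (norm (G p))\<^sup>2)" by simp
  qed
  have eq: "(norm (F p + G p))\<^sup>2 = (norm (F p))\<^sup>2 + 2 * inner (F p) (G p) + (norm (G p))\<^sup>2" for p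
    by (simp only: power2_norm_eq_inner) (simp add: inner_add_left inner_add_right inner_commute)
  show "integrable P (\<lambda>p. (norm (F p + G p))\<^sup>2)"
    "(LINT p|P. (norm (F p + G p))\<^sup>2)
      = (LINT p|P. (norm (F p))\<^sup>2) + 2 * (LINT p|P. inner (F p) (G p)) + (LINT p|P. (norm (G p))\<^sup>2)"
    unfolding eq using i F G by simp_all
qed

end

section \<open>Stochastic gradient recursions driven by centred noise\<close>

locale sgd_features = features Q e I \<phi> C \<mu> R
  for Q :: "'z measure" and e :: "nat \<Rightarrow> 'h::{real_inner, complete_space}" and I \<phi> C \<mu> R +
  fixes \<gamma> :: real and n :: nat
  assumes gamma_pos: "0 < \<gamma>" and gamma_le: "\<gamma> * R\<^sup>2 \<le> 1/2" and n_pos: "1 \<le> n"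
begin

definition q :: real where "q = 1 / real n"

lemma q_pos: "0 < q" and q_le: "q \<le> 1"
  using n_pos by (auto simp: q_def)

lemma q_half: "2 \<le> n \<Longrightarrow> q \<le> 1/2"
  unfolding q_def by (intro frac_le) auto

definition P :: "nat \<Rightarrow> (nat \<Rightarrow> 'z) measure" where
  "P k = (\<Pi>\<^sub>M i\<in>{1..k}. Q)"

lemma prob_space_P: "prob_space (P k)"
  unfolding P_def by (intro prob_space_PiM prob_space_axioms)

lemma prob_space_Q: "prob_space Q" by (rule prob_space_axioms)

lemma insert_Suc: "insert (Suc k) {1..k} = {1..Suc k}"
  by auto

lemma measurable_update: "(\<lambda>x. (fst x)(Suc k := snd x)) \<in> measurable (P k \<Otimes>\<^sub>M Q) (P (Suc k))"
  using measurable_add_dim[of "Suc k" "{1..k}" "\<lambda>_. Q"]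
  unfolding insert_Suc by (simp add: P_def case_prod_beta')

lemma distr_update: "distr (P k \<Otimes>\<^sub>M Q) (P (Suc k)) (\<lambda>x. (fst x)(Suc k := snd x)) = P (Suc k)"
proof (rule measure_eqI)
  interpret product_sigma_finite "\<lambda>_::nat. Q" by standard
  fix A assume "A \<in> sets (distr (P k \<Otimes>\<^sub>M Q) (P (Suc k)) (\<lambda>x. (fst x)(Suc k := snd x)))"
  then have A [measurable]: "A \<in> sets (P (Suc k))" by simp
  note [measurable] = measurable_update
  have "emeasure (distr (P k \<Otimes>\<^sub>M Q) (P (Suc k)) (\<lambda>x. (fst x)(Suc k := snd x))) A
      = (\<integral>\<^sup>+p. indicator A p \<partial>distr (P k \<Otimes>\<^sub>M Q) (P (Suc k)) (\<lambda>x. (fst x)(Suc k := snd x)))"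
    by simp
  also have "\<dots> = (\<integral>\<^sup>+x. indicator A ((fst x)(Suc k := snd x)) \<partial>(P k \<Otimes>\<^sub>M Q))"
    by (subst nn_integral_distr) auto
  also have "\<dots> = (\<integral>\<^sup>+p. \<integral>\<^sup>+z. indicator A (p(Suc k := z)) \<partial>Q \<partial>P k)"
    by (subst nn_integral_fst[symmetric]) auto
  also have "\<dots> = (\<integral>\<^sup>+p. indicator A p \<partial>P (Suc k))"
    using product_nn_integral_insert[of "{1..k}" "Suc k" "indicator A"] A
    unfolding insert_Suc by (simp add: P_def)
  also have "\<dots> = emeasure (P (Suc k)) A" by simp
  finally show "emeasure (distr (P k \<Otimes>\<^sub>M Q) (P (Suc k)) (\<lambda>x. (fst x)(Suc k := snd x))) A
      = emeasure (P (Suc k)) A" .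
qed simp

lemma integral_P_Suc:
  fixes f :: "_ \<Rightarrow> real"
  assumes "f \<in> borel_measurable (P (Suc k))"
  shows "integrable (P (Suc k)) f \<longleftrightarrow> integrable (P k \<Otimes>\<^sub>M Q) (\<lambda>x. f ((fst x)(Suc k := snd x)))"
    and "(LINT p|P (Suc k). f p) = (LINT x|(P k \<Otimes>\<^sub>M Q). f ((fst x)(Suc k := snd x)))"
  using integrable_distr_eq[OF measurable_update assms] integral_distr[OF measurable_update assms]
  by (simp_all add: distr_update)

lemma square_integrable_P_Suc:
  assumes "f \<in> borel_measurable (P (Suc k))"
  shows "f \<in> square_integrable (P (Suc k))
    \<longleftrightarrow> (\<lambda>x. f ((fst x)(Suc k := snd x))) \<in> square_integrable (P k \<Otimes>\<^sub>M Q)"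
  using assms integral_P_Suc(1)[of "\<lambda>p. (f p)\<^sup>2"] measurable_compose[OF measurable_update assms]
  by (auto simp: square_integrable_def)

definition step :: "'z \<Rightarrow> 'h \<Rightarrow> 'h" where
  "step z g = (1 - q) *\<^sub>R g - (\<gamma> * inner (\<phi> z) g) *\<^sub>R \<phi> z"

definition deviation :: "'z \<Rightarrow> 'h \<Rightarrow> 'h" where
  "deviation z g = C g - inner (\<phi> z) g *\<^sub>R \<phi> z"

lemma step_sym: "inner (step z g) h = inner g (step z h)"
  by (simp add: step_def inner_diff_left inner_diff_right inner_commute)

lemma deviation_sym: "inner (deviation z g) h = inner g (deviation z h)"
  using cov_sym[of g h] by (simp add: deviation_def inner_diff_left inner_diff_right inner_commute)

lemma weakly_measurable_inner_phi:
  assumes X: "weakly_measurable M X" and f: "f \<in> measurable M Q"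
  shows "weakly_measurable M (\<lambda>p. inner (\<phi> (f p)) (X p) *\<^sub>R \<phi> (f p))"
proof -
  have "weakly_measurable M (\<lambda>p. \<phi> (f p))" by (rule weakly_measurable_compose[OF phi_measurable f])
  then show ?thesis using X by (intro weakly_measurable_scaleR borel_measurable_inner)
qed

lemma weakly_measurable_step:
  assumes X: "weakly_measurable M X" and f: "f \<in> measurable M Q"
  shows "weakly_measurable M (\<lambda>p. step (f p) (X p))"
  unfolding step_def scaleR_scaleR[symmetric]
  by (rule weakly_measurable_diff; rule weakly_measurable_scaleR; rule borel_measurable_const X
      weakly_measurable_inner_phi[OF X f])

lemma weakly_measurable_deviation:
  assumes X: "weakly_measurable M X" and f: "f \<in> measurable M Q"
  shows "weakly_measurable M (\<lambda>p. deviation (f p) (X p))"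
  unfolding deviation_def
  by (rule weakly_measurable_diff[OF weakly_measurable_cov[OF X] weakly_measurable_inner_phi[OF X f]])

lemma deviation_integral:
  shows "integrable Q (\<lambda>z. (norm (deviation z g))\<^sup>2)"
    and "(LINT z|Q. (norm (deviation z g))\<^sup>2) \<le> R\<^sup>2 * inner (C g) g"
  using cov_deviation[of g] unfolding deviation_def by (auto intro: order_trans)

lemma deviation_mean: "(LINT z|Q. inner (deviation z g) h) = 0"
  and deviation_inner_integrable: "integrable Q (\<lambda>z. inner (deviation z g) h)"
  using cov[of g h] unfolding deviation_def
  by (simp_all add: inner_diff_left cov_integral has_bochner_integral_iff prob_space)

lemma step_integral:
  shows "integrable Q (\<lambda>z. (norm (step z g))\<^sup>2)"
    and "(LINT z|Q. (norm (step z g))\<^sup>2)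
      \<le> (1 - q)\<^sup>2 * (norm g)\<^sup>2 - \<gamma> * (2 * (1 - q) - \<gamma> * R\<^sup>2) * inner (C g) g"
proof -
  have eq: "(norm (step z g))\<^sup>2 = (1 - q)\<^sup>2 * (norm g)\<^sup>2 - 2 * (1 - q) * \<gamma> * (inner (\<phi> z) g)\<^sup>2
      + \<gamma>\<^sup>2 * ((norm (\<phi> z))\<^sup>2 * (inner (\<phi> z) g)\<^sup>2)" for z
    unfolding step_def
    by (simp only: power2_norm_eq_inner)
      (simp add: inner_diff_left inner_diff_right inner_commute power2_eq_square algebra_simps)
  note i = square_integrableD(2)[OF inner_phi_square_integrable[of g]] fourth_integrable[of g]
  show "integrable Q (\<lambda>z. (norm (step z g))\<^sup>2)" unfolding eq using i by simp
  have "(LINT z|Q. (norm (step z g))\<^sup>2) = (1 - q)\<^sup>2 * (norm g)\<^sup>2 - 2 * (1 - q) * \<gamma> * inner (C g) g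
      + \<gamma>\<^sup>2 * (LINT z|Q. (norm (\<phi> z))\<^sup>2 * (inner (\<phi> z) g)\<^sup>2)"
    unfolding eq using i by (simp add: cov_diag prob_space)
  also have "\<dots> \<le> (1 - q)\<^sup>2 * (norm g)\<^sup>2 - 2 * (1 - q) * \<gamma> * inner (C g) g
      + \<gamma>\<^sup>2 * (R\<^sup>2 * inner (C g) g)"
    using fourth_le[of g] by (intro add_left_mono mult_left_mono) auto
  also have "\<dots> = (1 - q)\<^sup>2 * (norm g)\<^sup>2 - \<gamma> * (2 * (1 - q) - \<gamma> * R\<^sup>2) * inner (C g) g"
    by (simp add: power2_eq_square algebra_simps)
  finally show "(LINT z|Q. (norm (step z g))\<^sup>2)
      \<le> (1 - q)\<^sup>2 * (norm g)\<^sup>2 - \<gamma> * (2 * (1 - q) - \<gamma> * R\<^sup>2) * inner (C g) g" .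
qed

lemma step_integral_crude: "(LINT z|Q. (norm (step z g))\<^sup>2) \<le> (1 + \<gamma>\<^sup>2 * R\<^sup>2 * R\<^sup>2) * (norm g)\<^sup>2"
proof -
  have "(1 - q)\<^sup>2 * (norm g)\<^sup>2 \<le> 1 * (norm g)\<^sup>2"
    using q_pos q_le by (intro mult_right_mono) (auto simp: power_le_one)
  moreover have "0 \<le> \<gamma> * (2 * (1 - q)) * inner (C g) g"
    using gamma_pos q_le cov_nonneg[of g] by simp
  moreover have "\<gamma>\<^sup>2 * R\<^sup>2 * inner (C g) g \<le> \<gamma>\<^sup>2 * R\<^sup>2 * (R\<^sup>2 * (norm g)\<^sup>2)"
    using cov_le[of g] by (intro mult_left_mono) auto
  moreover have "(1 - q)\<^sup>2 * (norm g)\<^sup>2 - \<gamma> * (2 * (1 - q) - \<gamma> * R\<^sup>2) * inner (C g) g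
     = (1 - q)\<^sup>2 * (norm g)\<^sup>2 - \<gamma> * (2 * (1 - q)) * inner (C g) g + \<gamma>\<^sup>2 * R\<^sup>2 * inner (C g) g"
    by (simp add: power2_eq_square algebra_simps)
  ultimately have "(LINT z|Q. (norm (step z g))\<^sup>2) \<le> 1 * (norm g)\<^sup>2 + \<gamma>\<^sup>2 * R\<^sup>2 * (R\<^sup>2 * (norm g)\<^sup>2)"
    using step_integral(2)[of g] by linarith
  then show ?thesis by (simp only: distrib_right mult.assoc)
qed

primrec process :: "(nat \<Rightarrow> 'z \<Rightarrow> 'h) \<Rightarrow> nat \<Rightarrow> (nat \<Rightarrow> 'z) \<Rightarrow> 'h" where
  "process v 0 p = 0"
| "process v (Suc k) p = step (p (Suc k)) (process v k p) + \<gamma> *\<^sub>R v k (p (Suc k))"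

lemma process_cong: "(\<And>i. i \<in> {1..k} \<Longrightarrow> p i = p' i) \<Longrightarrow> process v k p = process v k p'"
proof (induction k)
  case (Suc k)
  then have "process v k p = process v k p'" by auto
  moreover have "p (Suc k) = p' (Suc k)" using Suc.prems by auto
  ultimately show ?case by simp
qed simp

lemma process_update: "k < j \<Longrightarrow> process v k (p(j := z)) = process v k p"
  by (rule process_cong) auto

lemma process_Suc_update:
  "process v (Suc k) (p(Suc k := z)) = step z (process v k p) + \<gamma> *\<^sub>R v k z"
  by (simp add: process_update)

lemma process_later_measurable:
  assumes "weakly_measurable (P k) (process v k)" "k \<le> m"
  shows "weakly_measurable (P m) (process v k)"
proof -
  have "(\<lambda>p. restrict p {1..k}) \<in> measurable (P m) (P k)"
    unfolding P_def using assms(2) by (intro measurable_restrict_subset) auto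
  from weakly_measurable_compose[OF assms(1) this]
  have "weakly_measurable (P m) (\<lambda>p. process v k (restrict p {1..k}))" .
  moreover have "process v k (restrict p {1..k}) = process v k p" for p
    by (rule process_cong) auto
  ultimately show ?thesis by simp
qed

lemma measurable_last: "(\<lambda>p. p (Suc k)) \<in> measurable (P (Suc k)) Q"
  unfolding P_def by (rule measurable_component_singleton) auto

end

locale noise_process = sgd_features Q e I \<phi> C \<mu> R \<gamma> n
  for Q :: "'z measure" and e :: "nat \<Rightarrow> 'h::{real_inner, complete_space}" and I \<phi> C \<mu> R \<gamma> n +
  fixes v :: "nat \<Rightarrow> 'z \<Rightarrow> 'h"
  assumes v_mean: "\<And>k h. (LINT z|Q. inner (v k z) h) = 0"
    and v_second_moment: "\<And>k. \<exists>B. second_moment_le Q (v k) B"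
begin

lemma v_measurable: "weakly_measurable Q (v k)"
  using v_second_moment[of k] by (auto simp: second_moment_le_def)

lemma v_square_integrable: "(\<lambda>z. inner (v k z) h) \<in> square_integrable Q"
  using v_second_moment[of k] v_measurable[of k]
  by (auto simp: second_moment_le_def intro!: square_integrableI dest: weakly_measurableD)

lemma process_measurable: "weakly_measurable (P k) (process v k)"
proof (induction k)
  case (Suc k)
  have "weakly_measurable (P (Suc k)) (process v k)" using Suc by (rule process_later_measurable) simp
  then show ?case
    by (auto intro!: weakly_measurable_add weakly_measurable_step weakly_measurable_scaleR measurable_last
        weakly_measurable_compose[OF v_measurable])
qed simp

lemma process_second_moment_step:
  assumes A: "second_moment_le (P k) (process v k) A"
    and mean: "\<And>h. (LINT p|P k. inner (process v k p) h) = 0"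
  shows "(\<lambda>p. inner (process v (Suc k) p) h) \<in> square_integrable (P (Suc k))"
    and "(LINT p|P (Suc k). (inner (process v (Suc k) p) h)\<^sup>2)
      \<le> A * (LINT z|Q. (norm (step z h))\<^sup>2) + \<gamma>\<^sup>2 * (LINT z|Q. (inner (v k z) h)\<^sup>2)"
    and "(LINT p|P (Suc k). inner (process v (Suc k) p) h) = 0"
proof -
  interpret pair: prob_space "P k \<Otimes>\<^sub>M Q" by (intro prob_space_pair prob_space_P prob_space_Q)
  let ?F = "\<lambda>x. inner (process v (Suc k) ((fst x)(Suc k := snd x))) h"
  let ?f = "\<lambda>x. inner (process v k (fst x)) (step (snd x) h)" and ?g = "\<lambda>x. \<gamma> * inner (v k (snd x)) h"
  have F: "?F x = ?f x + ?g x" for x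
    by (simp only: process_Suc_update) (simp add: inner_add_left step_sym)
  have Fm: "(\<lambda>p. inner (process v (Suc k) p) h) \<in> borel_measurable (P (Suc k))"
    using process_measurable by (rule weakly_measurableD)
  have wstep: "weakly_measurable Q (\<lambda>z. step z h)"
    by (rule weakly_measurable_step) simp_all
  note f = pair_inner_square_integrable[OF prob_space_P prob_space_Q A wstep step_integral(1)]
  have vg: "(\<lambda>x. inner (v k (snd x)) h) \<in> square_integrable (P k \<Otimes>\<^sub>M Q)"
    using pair_integral_snd_only(1)[OF prob_space_P prob_space_Q square_integrableD(2)[OF v_square_integrable]]
      measurable_compose[OF measurable_snd square_integrableD(1)[OF v_square_integrable]]
    by (intro square_integrableI) auto
  then have g: "?g \<in> square_integrable (P k \<Otimes>\<^sub>M Q)" by (rule square_integrable_scale)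
  have sq: "?F \<in> square_integrable (P k \<Otimes>\<^sub>M Q)"
    unfolding F by (rule square_integrable_add[OF f(1) g])
  then show sq': "(\<lambda>p. inner (process v (Suc k) p) h) \<in> square_integrable (P (Suc k))"
    using square_integrable_P_Suc[OF Fm] by simp
  have cross: "(LINT x|(P k \<Otimes>\<^sub>M Q). ?f x * ?g x) = 0"
  proof (rule pair_integral_eq_0[OF prob_space_P prob_space_Q square_integrable_mult[OF f(1) g]])
    show "(LINT p|P k. ?f (p, z) * ?g (p, z)) = 0" for z by (simp add: mean)
  qed
  have "(LINT p|P (Suc k). (inner (process v (Suc k) p) h)\<^sup>2) = (LINT x|(P k \<Otimes>\<^sub>M Q). (?F x)\<^sup>2)"
    using Fm by (intro integral_P_Suc(2)) simp
  also have "\<dots> = (LINT x|(P k \<Otimes>\<^sub>M Q). (?f x)\<^sup>2) + (LINT x|(P k \<Otimes>\<^sub>M Q). (?g x)\<^sup>2)"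
    unfolding F square_integrable_add(2)[OF f(1) g] cross by simp
  also have "(LINT x|(P k \<Otimes>\<^sub>M Q). (?g x)\<^sup>2) = \<gamma>\<^sup>2 * (LINT z|Q. (inner (v k z) h)\<^sup>2)"
    using pair_integral_snd_only(2)[OF prob_space_P prob_space_Q square_integrableD(2)[OF v_square_integrable]]
    by (simp add: power_mult_distrib)
  finally show "(LINT p|P (Suc k). (inner (process v (Suc k) p) h)\<^sup>2)
      \<le> A * (LINT z|Q. (norm (step z h))\<^sup>2) + \<gamma>\<^sup>2 * (LINT z|Q. (inner (v k z) h)\<^sup>2)"
    using f(2) by simp
  have one: "(\<lambda>x. 1) \<in> square_integrable (P k \<Otimes>\<^sub>M Q)" by (rule square_integrableI) auto
  have "(LINT p|P (Suc k). inner (process v (Suc k) p) h) = (LINT x|(P k \<Otimes>\<^sub>M Q). ?f x + ?g x)"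
    using integral_P_Suc(2)[OF Fm] by (simp only: F)
  also have "\<dots> = (LINT x|(P k \<Otimes>\<^sub>M Q). ?f x) + (LINT x|(P k \<Otimes>\<^sub>M Q). ?g x)"
    using square_integrable_mult[OF f(1) one] square_integrable_mult[OF g one] by simp
  also have "(LINT x|(P k \<Otimes>\<^sub>M Q). ?f x) = 0"
    using square_integrable_mult[OF f(1) one]
    by (intro pair_integral_eq_0[OF prob_space_P prob_space_Q]) (auto simp: mean)
  also have "(LINT x|(P k \<Otimes>\<^sub>M Q). ?g x) = 0"
    using square_integrable_mult[OF g one]
    by (intro pair_integral_eq_0'[OF prob_space_P prob_space_Q]) (auto simp: v_mean)
  finally show "(LINT p|P (Suc k). inner (process v (Suc k) p) h) = 0" by simp
qed

lemma process_moments: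
  "(\<exists>A. second_moment_le (P k) (process v k) A) \<and> (\<forall>h. (LINT p|P k. inner (process v k p) h) = 0)"
proof (induction k)
  case 0
  show ?case by (auto simp: second_moment_le_def intro!: exI[of _ 0])
next
  case (Suc k)
  then obtain A where A: "second_moment_le (P k) (process v k) A" by blast
  obtain B where B: "second_moment_le Q (v k) B" using v_second_moment by blast
  have mean: "(LINT p|P k. inner (process v k p) h) = 0" for h using Suc by blast
  note st = process_second_moment_step[OF A mean]
  define A' where "A' = A * (1 + \<gamma>\<^sup>2 * R\<^sup>2 * R\<^sup>2) + \<gamma>\<^sup>2 * B"
  have "(LINT p|P (Suc k). (inner (process v (Suc k) p) h)\<^sup>2) \<le> A' * (norm h)\<^sup>2" for h
  proof -
    have "(LINT p|P (Suc k). (inner (process v (Suc k) p) h)\<^sup>2)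
        \<le> A * ((1 + \<gamma>\<^sup>2 * R\<^sup>2 * R\<^sup>2) * (norm h)\<^sup>2) + \<gamma>\<^sup>2 * (B * (norm h)\<^sup>2)"
      using A B step_integral_crude[of h]
      by (intro order_trans[OF st(2)] add_mono mult_left_mono) (auto simp: second_moment_le_def)
    then show ?thesis by (simp add: A'_def algebra_simps)
  qed
  moreover have "0 \<le> A'" using A B by (auto simp: A'_def second_moment_le_def)
  ultimately have "second_moment_le (P (Suc k)) (process v (Suc k)) A'"
    using process_measurable[of "Suc k"] square_integrableD(2)[OF st(1)]
    unfolding second_moment_le_def by blast
  then show ?case using st(3) by blast
qed

lemma process_mean: "(LINT p|P k. inner (process v k p) h) = 0"
  using process_moments by blast

lemma process_second_moment: "\<exists>A. second_moment_le (P k) (process v k) A"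
  using process_moments by blast

text \<open>The martingale increment of the recursion \<open>\<zeta>\<^sub>k\<^sub>+\<^sub>1 = (I - \<gamma>(C + \<lambda>)) \<zeta>\<^sub>k + \<gamma> w\<^sub>k\<close> with the averaged operator.\<close>

definition increment :: "nat \<Rightarrow> (nat \<Rightarrow> 'z) \<times> 'z \<Rightarrow> 'h" where
  "increment k x = deviation (snd x) (process v k (fst x)) + v k (snd x)"

end

lemma pair_integral_le:
  fixes F :: "'p \<times> 'z \<Rightarrow> real"
  assumes "prob_space P" "prob_space Q" and F [measurable]: "F \<in> borel_measurable (P \<Otimes>\<^sub>M Q)"
    and pos: "\<And>x. 0 \<le> F x" and int: "\<And>p. integrable Q (\<lambda>z. F (p, z))"
    and le: "\<And>p. (LINT z|Q. F (p, z)) \<le> B p" and B: "integrable P B"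
  shows "integrable (P \<Otimes>\<^sub>M Q) F" "(LINT x|(P \<Otimes>\<^sub>M Q). F x) \<le> (LINT p|P. B p)"
proof -
  interpret P: prob_space P by fact
  interpret Q: prob_space Q by fact
  have B0: "0 \<le> B p" for p
    using le[of p] pos by (intro order_trans[OF Bochner_Integration.integral_nonneg le]) auto
  have "(\<integral>\<^sup>+x. ennreal (F x) \<partial>(P \<Otimes>\<^sub>M Q)) = (\<integral>\<^sup>+p. \<integral>\<^sup>+z. ennreal (F (p, z)) \<partial>Q \<partial>P)"
    by (subst Q.nn_integral_fst[symmetric]) auto
  also have "\<dots> \<le> (\<integral>\<^sup>+p. ennreal (B p) \<partial>P)"
    using int pos le by (intro nn_integral_mono) (auto simp: nn_integral_eq_integral intro!: ennreal_leI)
  also have "\<dots> = ennreal (LINT p|P. B p)"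
    using B B0 by (intro nn_integral_eq_integral) auto
  finally have *: "(\<integral>\<^sup>+x. ennreal (F x) \<partial>(P \<Otimes>\<^sub>M Q)) \<le> ennreal (LINT p|P. B p)" .
  show "integrable (P \<Otimes>\<^sub>M Q) F" "(LINT x|(P \<Otimes>\<^sub>M Q). F x) \<le> (LINT p|P. B p)"
    using integrable_nn_integral_le[OF F pos *] B0 by auto
qed

context features
begin

lemma inner_cov_eigen: "inner (C g) (e i) = \<mu> i * inner g (e i)"
  by (subst cov_sym) (simp add: eigen inner_commute)

lemma cov_form_sums: "(\<lambda>i. \<mu> i * (inner g (e i))\<^sup>2) sums inner (C g) g"
  using parseval_inner[of "C g" g] by (simp add: inner_cov_eigen power2_eq_square mult.assoc)

end

context sgd_features
begin

definition lam :: real where "lam = 1 / (\<gamma> * real n)"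

lemma lam_pos: "0 < lam"
  using gamma_pos n_pos by (simp add: lam_def)

lemma gamma_mu: "0 \<le> \<gamma> * \<mu> i" "\<gamma> * \<mu> i \<le> 1/2"
proof -
  show "0 \<le> \<gamma> * \<mu> i" using gamma_pos mu_pos[of i] by simp
  have "\<gamma> * \<mu> i \<le> \<gamma> * R\<^sup>2" using gamma_pos mu_le[of i] by (intro mult_left_mono) auto
  then show "\<gamma> * \<mu> i \<le> 1/2" using gamma_le by simp
qed

lemma gamma_shift: "q + \<gamma> * \<mu> i = \<gamma> * (\<mu> i + lam)"
  using gamma_pos by (simp add: q_def lam_def algebra_simps)

end

context noise_process
begin

abbreviation law :: "nat \<Rightarrow> ((nat \<Rightarrow> 'z) \<times> 'z) measure" where
  "law k \<equiv> P k \<Otimes>\<^sub>M Q"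

lemma increment_inner:
  "inner (increment k x) h = inner (process v k (fst x)) (deviation (snd x) h) + inner (v k (snd x)) h"
  by (simp add: increment_def inner_add_left deviation_sym)

lemma v_pair_square_integrable: "(\<lambda>x. inner (v k (snd x)) h) \<in> square_integrable (law j)"
  using pair_integral_snd_only(1)[OF prob_space_P prob_space_Q square_integrableD(2)[OF v_square_integrable]]
    measurable_compose[OF measurable_snd square_integrableD(1)[OF v_square_integrable]]
  by (intro square_integrableI) auto

lemma increment_coordinate:
  assumes A: "second_moment_le (P k) (process v k) A"
  shows "(\<lambda>x. inner (increment k x) h) \<in> square_integrable (law k)"
    and "(LINT x|(law k). (inner (increment k x) h)\<^sup>2)
      \<le> A * (R\<^sup>2 * inner (C h) h) + (LINT z|Q. (inner (v k z) h)\<^sup>2)"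
proof -
  have wd: "weakly_measurable Q (\<lambda>z. deviation z h)"
    by (rule weakly_measurable_deviation) simp_all
  let ?f = "\<lambda>x. inner (process v k (fst x)) (deviation (snd x) h)" and ?g = "\<lambda>x. inner (v k (snd x)) h"
  note f = pair_inner_square_integrable[OF prob_space_P prob_space_Q A wd deviation_integral(1)]
  note g = v_pair_square_integrable[of k h k]
  show "(\<lambda>x. inner (increment k x) h) \<in> square_integrable (law k)"
    unfolding increment_inner by (rule square_integrable_add[OF f(1) g])
  have cross: "(LINT x|(law k). ?f x * ?g x) = 0"
    by (rule pair_integral_eq_0[OF prob_space_P prob_space_Q square_integrable_mult[OF f(1) g]])
      (simp add: process_mean)
  have "(LINT x|(law k). (inner (increment k x) h)\<^sup>2) = (LINT x|(law k). (?f x)\<^sup>2) + (LINT x|(law k). (?g x)\<^sup>2)"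
    unfolding increment_inner square_integrable_add(2)[OF f(1) g] cross by simp
  also have "(LINT x|(law k). (?g x)\<^sup>2) = (LINT z|Q. (inner (v k z) h)\<^sup>2)"
    by (rule pair_integral_snd_only(2)[OF prob_space_P prob_space_Q square_integrableD(2)[OF v_square_integrable]])
  also have "(LINT x|(law k). (?f x)\<^sup>2) \<le> A * (R\<^sup>2 * inner (C h) h)"
    using A deviation_integral(2)[of h]
    by (intro order_trans[OF f(2)] mult_left_mono) (auto simp: second_moment_le_def)
  finally show "(LINT x|(law k). (inner (increment k x) h)\<^sup>2)
      \<le> A * (R\<^sup>2 * inner (C h) h) + (LINT z|Q. (inner (v k z) h)\<^sup>2)" by simp
qed

lemma increment_square_integrable: "(\<lambda>x. inner (increment k x) h) \<in> square_integrable (law k)"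
  using process_second_moment increment_coordinate(1) by blast

lemma increment_mean: "(LINT z|Q. inner (increment k (p, z)) h) = 0"
proof -
  have "integrable Q (\<lambda>z. inner (v k z) h)"
    using square_integrable_mult[OF v_square_integrable, of "\<lambda>_. 1"] by (auto simp: square_integrable_def)
  then show ?thesis
    using deviation_mean[of "process v k p" h] deviation_inner_integrable[of "process v k p" h]
    by (simp add: increment_def inner_add_left v_mean)
qed

lemma process_Suc_coordinate:
  "inner (process v (Suc k) (p(Suc k := z))) (e i)
    = (1 - q - \<gamma> * \<mu> i) * inner (process v k p) (e i) + \<gamma> * inner (increment k (p, z)) (e i)"
  unfolding process_Suc_update
  by (simp add: step_def increment_def deviation_def inner_add_left inner_diff_left inner_cov_eigen algebra_simps)

definition increment_variance :: "nat \<Rightarrow> nat \<Rightarrow> real" where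
  "increment_variance k i = (LINT x|(law k). (inner (increment k x) (e i))\<^sup>2)"

text \<open>The conditional expectation of the \<open>i\<close>-th coordinate of \<open>\<Sum>\<^sub>k\<^sub>\<le>\<^sub>n \<zeta>\<^sub>k\<close> given the first \<open>m\<close> samples.\<close>

definition forecast :: "nat \<Rightarrow> nat \<Rightarrow> (nat \<Rightarrow> 'z) \<Rightarrow> real" where
  "forecast i m p = (\<Sum>k\<le>m. inner (process v k p) (e i))
    + (1 - q - \<gamma> * \<mu> i) * (\<Sum>l<n - m. (1 - q - \<gamma> * \<mu> i) ^ l) * inner (process v m p) (e i)"

lemma forecast_Suc:
  assumes "m < n"
  shows "forecast i (Suc m) (p(Suc m := z)) = forecast i m p
    + \<gamma> * (\<Sum>l<n - m. (1 - q - \<gamma> * \<mu> i) ^ l) * inner (increment m (p, z)) (e i)"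
proof -
  define \<rho> where "\<rho> = 1 - q - \<gamma> * \<mu> i"
  define G where "G l = (\<Sum>j<l. \<rho> ^ j)" for l
  have G: "G (n - m) = 1 + \<rho> * G (n - Suc m)"
  proof -
    have "n - m = Suc (n - Suc m)" using assms by simp
    then show ?thesis by (simp add: G_def sum.lessThan_Suc_shift sum_distrib_left del: sum.lessThan_Suc)
  qed
  have s: "(\<Sum>k\<le>m. inner (process v k (p(Suc m := z))) (e i)) = (\<Sum>k\<le>m. inner (process v k p) (e i))"
    by (intro sum.cong refl) (simp add: process_update)
  have "forecast i (Suc m) (p(Suc m := z)) = (\<Sum>k\<le>m. inner (process v k p) (e i))
      + (1 + \<rho> * G (n - Suc m)) * (\<rho> * inner (process v m p) (e i) + \<gamma> * inner (increment m (p, z)) (e i))"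
    unfolding forecast_def sum.atMost_Suc s process_Suc_coordinate
    by (simp only: \<rho>_def[symmetric] G_def[symmetric]) (simp add: algebra_simps)
  then show ?thesis unfolding G[symmetric] forecast_def
    by (simp only: \<rho>_def[symmetric] G_def[symmetric]) (simp add: algebra_simps)
qed

lemma forecast_measurable: "forecast i m \<in> borel_measurable (P m)"
  unfolding forecast_def[abs_def]
  using weakly_measurableD[OF process_later_measurable[OF process_measurable]]
  by (intro borel_measurable_add borel_measurable_sum borel_measurable_times borel_measurable_const) auto

lemma forecast_variance:
  "m \<le> n \<Longrightarrow> forecast i m \<in> square_integrable (P m) \<and>
    (LINT p|P m. (forecast i m p)\<^sup>2)
      = (\<Sum>j<m. (\<gamma> * (\<Sum>l<n - j. (1 - q - \<gamma> * \<mu> i) ^ l))\<^sup>2 * increment_variance j i)"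
proof (induction m)
  case 0
  have "forecast i 0 = (\<lambda>p. 0)" by (rule ext) (simp add: forecast_def)
  then show ?case by (simp add: square_integrable_def)
next
  case (Suc m)
  then have IH: "forecast i m \<in> square_integrable (P m)"
    "(LINT p|P m. (forecast i m p)\<^sup>2)
      = (\<Sum>j<m. (\<gamma> * (\<Sum>l<n - j. (1 - q - \<gamma> * \<mu> i) ^ l))\<^sup>2 * increment_variance j i)" by auto
  define c where "c = \<gamma> * (\<Sum>l<n - m. (1 - q - \<gamma> * \<mu> i) ^ l)"
  let ?f = "\<lambda>x. forecast i m (fst x)" and ?g = "\<lambda>x. c * inner (increment m x) (e i)"
  have eq: "forecast i (Suc m) ((fst x)(Suc m := snd x)) = ?f x + ?g x" for x
    using forecast_Suc[of m i "fst x" "snd x"] Suc.prems by (simp add: c_def)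
  have f: "?f \<in> square_integrable (law m)"
    using pair_integral_fst_only(1)[OF prob_space_P prob_space_Q square_integrableD(2)[OF IH(1)]]
      measurable_compose[OF measurable_fst square_integrableD(1)[OF IH(1)]]
    by (intro square_integrableI) auto
  have g: "?g \<in> square_integrable (law m)"
    by (rule square_integrable_scale[OF increment_square_integrable])
  have "(\<lambda>x. forecast i (Suc m) ((fst x)(Suc m := snd x))) \<in> square_integrable (law m)"
    unfolding eq by (rule square_integrable_add[OF f g])
  then have 1: "forecast i (Suc m) \<in> square_integrable (P (Suc m))"
    using square_integrable_P_Suc[OF forecast_measurable] by simp
  have cross: "(LINT x|(law m). ?f x * ?g x) = 0"
    by (rule pair_integral_eq_0'[OF prob_space_P prob_space_Q square_integrable_mult[OF f g]])
      (simp add: increment_mean)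
  have "(LINT p|P (Suc m). (forecast i (Suc m) p)\<^sup>2)
      = (LINT x|(law m). (forecast i (Suc m) ((fst x)(Suc m := snd x)))\<^sup>2)"
    using forecast_measurable by (intro integral_P_Suc(2)) simp
  also have "\<dots> = (LINT x|(law m). (?f x)\<^sup>2) + (LINT x|(law m). (?g x)\<^sup>2)"
    unfolding eq square_integrable_add(2)[OF f g] cross by simp
  also have "(LINT x|(law m). (?f x)\<^sup>2) = (LINT p|P m. (forecast i m p)\<^sup>2)"
    by (rule pair_integral_fst_only(2)[OF prob_space_P prob_space_Q square_integrableD(2)[OF IH(1)]])
  also have "(LINT x|(law m). (?g x)\<^sup>2) = c\<^sup>2 * increment_variance m i"
    by (simp add: power_mult_distrib increment_variance_def)
  finally show ?case using 1 IH(2) by (simp add: c_def)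
qed

definition average :: "(nat \<Rightarrow> 'z) \<Rightarrow> 'h" where
  "average p = (1 / (real n + 1)) *\<^sub>R (\<Sum>k\<le>n. process v k p)"

lemma average_measurable: "weakly_measurable (P n) average"
  unfolding average_def[abs_def]
  by (intro weakly_measurable_scaleR weakly_measurable_sum borel_measurable_const
      process_later_measurable[OF process_measurable]) auto

lemma average_coordinate:
  "(\<lambda>p. inner (average p) (e i)) \<in> square_integrable (P n)"
  "(LINT p|P n. (inner (average p) (e i))\<^sup>2)
    \<le> (1 / (real n * (\<mu> i + lam)))\<^sup>2 * (\<Sum>k<n. increment_variance k i)"
proof -
  have eq: "inner (average p) (e i) = 1 / (real n + 1) * forecast i n p" for p
    by (simp add: average_def forecast_def inner_sum_left)
  have f: "forecast i n \<in> square_integrable (P n)" using forecast_variance[of n i] by simp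
  show "(\<lambda>p. inner (average p) (e i)) \<in> square_integrable (P n)"
    unfolding eq by (rule square_integrable_scale[OF f])
  have W: "0 \<le> increment_variance k i" for k by (simp add: increment_variance_def)
  have c: "(1 / (real n + 1))\<^sup>2 * (\<gamma> * (\<Sum>l<n - j. (1 - q - \<gamma> * \<mu> i) ^ l))\<^sup>2
      \<le> (1 / (real n * (\<mu> i + lam)))\<^sup>2" for j
  proof -
    have "((\<Sum>l<n - j. (1 - q - \<gamma> * \<mu> i) ^ l) / (real n + 1))\<^sup>2 \<le> (1 / (real n * (q + \<gamma> * \<mu> i)))\<^sup>2"
      using averaged_power_sum_bound[OF n_pos q_def gamma_mu] by simp
    then have "\<gamma>\<^sup>2 * ((\<Sum>l<n - j. (1 - q - \<gamma> * \<mu> i) ^ l) / (real n + 1))\<^sup>2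
        \<le> \<gamma>\<^sup>2 * (1 / (real n * (q + \<gamma> * \<mu> i)))\<^sup>2"
      by (rule mult_left_mono) simp
    moreover have "\<gamma>\<^sup>2 * (1 / (real n * (q + \<gamma> * \<mu> i)))\<^sup>2 = (1 / (real n * (\<mu> i + lam)))\<^sup>2"
      unfolding gamma_shift using gamma_pos by (simp add: power_mult_distrib[symmetric] mult.left_commute)
    ultimately show ?thesis by (simp add: power_mult_distrib power_divide mult.commute)
  qed
  have "(LINT p|P n. (inner (average p) (e i))\<^sup>2) = (1 / (real n + 1))\<^sup>2 * (LINT p|P n. (forecast i n p)\<^sup>2)"
    unfolding eq by (simp add: power_mult_distrib power_divide)
  also have "\<dots> = (\<Sum>j<n. (1 / (real n + 1))\<^sup>2 * (\<gamma> * (\<Sum>l<n - j. (1 - q - \<gamma> * \<mu> i) ^ l))\<^sup>2 * increment_variance j i)"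
    using forecast_variance[of n i] by (simp add: sum_distrib_left mult.assoc)
  also have "\<dots> \<le> (\<Sum>j<n. (1 / (real n * (\<mu> i + lam)))\<^sup>2 * increment_variance j i)"
    by (intro sum_mono mult_right_mono c W)
  finally show "(LINT p|P n. (inner (average p) (e i))\<^sup>2)
      \<le> (1 / (real n * (\<mu> i + lam)))\<^sup>2 * (\<Sum>k<n. increment_variance k i)" by (simp add: sum_distrib_left)
qed

lemma average_form:
  "(\<integral>\<^sup>+p. ennreal (inner (C (average p)) (average p)) \<partial>P n)
    \<le> (\<Sum>i. ennreal (\<mu> i / (\<mu> i + lam)\<^sup>2 / (real n)\<^sup>2 * (\<Sum>k<n. increment_variance k i)))"
proof -
  have "(\<integral>\<^sup>+p. ennreal (inner (C (average p)) (average p)) \<partial>P n)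
      = (\<integral>\<^sup>+p. (\<Sum>i. ennreal (\<mu> i * (inner (average p) (e i))\<^sup>2)) \<partial>P n)"
    using cov_form_sums mu_pos
    by (intro nn_integral_cong suminf_ennreal_eq[symmetric]) (auto intro!: mult_nonneg_nonneg[OF less_imp_le[OF mu_pos]])
  also have "\<dots> = (\<Sum>i. (\<integral>\<^sup>+p. ennreal (\<mu> i * (inner (average p) (e i))\<^sup>2) \<partial>P n))"
    using average_coordinate(1)[THEN square_integrableD(1)] by (intro nn_integral_suminf) auto
  also have "\<dots> \<le> (\<Sum>i. ennreal (\<mu> i / (\<mu> i + lam)\<^sup>2 / (real n)\<^sup>2 * (\<Sum>k<n. increment_variance k i)))"
  proof (rule suminf_le)
    fix i
    have "(\<integral>\<^sup>+p. ennreal (\<mu> i * (inner (average p) (e i))\<^sup>2) \<partial>P n)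
        = ennreal (\<mu> i * (LINT p|P n. (inner (average p) (e i))\<^sup>2))"
      using average_coordinate(1)[THEN square_integrableD(2)] mu_pos[of i]
      by (subst nn_integral_eq_integral) auto
    also have "\<dots> \<le> ennreal (\<mu> i * ((1 / (real n * (\<mu> i + lam)))\<^sup>2 * (\<Sum>k<n. increment_variance k i)))"
      using average_coordinate(2)[of i] mu_pos[of i] by (intro ennreal_leI mult_left_mono) auto
    also have "\<mu> i * ((1 / (real n * (\<mu> i + lam)))\<^sup>2 * (\<Sum>k<n. increment_variance k i))
        = \<mu> i / (\<mu> i + lam)\<^sup>2 / (real n)\<^sup>2 * (\<Sum>k<n. increment_variance k i)"
      by (simp add: power_mult_distrib power_divide mult.commute)
    finally show "(\<integral>\<^sup>+p. ennreal (\<mu> i * (inner (average p) (e i))\<^sup>2) \<partial>P n)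
      \<le> ennreal (\<mu> i / (\<mu> i + lam)\<^sup>2 / (real n)\<^sup>2 * (\<Sum>k<n. increment_variance k i))" .
  qed auto
  finally show ?thesis .
qed

lemma average_form_structured_noise:
  assumes V: "\<And>k h. (LINT z|Q. (inner (v k z) h)\<^sup>2) \<le> \<sigma>\<^sup>2 * inner (C h) h"
  shows "(\<integral>\<^sup>+p. ennreal (inner (C (average p)) (average p)) \<partial>P n)
    \<le> (\<Sum>i. ennreal (2 * \<sigma>\<^sup>2 / real n * (\<mu> i / (\<mu> i + lam)\<^sup>2 * inner (C (e i)) (e i))))"
proof -
  have sm: "k < n \<Longrightarrow> second_moment_le (P k) (process v k) (2 * \<gamma> * \<sigma>\<^sup>2)" for k
  proof (induction k)
    case 0 then show ?case using gamma_pos by (simp add: second_moment_le_def)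
  next
    case (Suc k)
    then have sm: "second_moment_le (P k) (process v k) (2 * \<gamma> * \<sigma>\<^sup>2)" by simp
    have q: "q \<le> 1/2" using Suc.prems by (intro q_half) simp
    have "(LINT p|P (Suc k). (inner (process v (Suc k) p) h)\<^sup>2) \<le> 2 * \<gamma> * \<sigma>\<^sup>2 * (norm h)\<^sup>2" for h
    proof -
      let ?s = "inner (C h) h"
      have "(LINT p|P (Suc k). (inner (process v (Suc k) p) h)\<^sup>2)
          \<le> 2 * \<gamma> * \<sigma>\<^sup>2 * (LINT z|Q. (norm (step z h))\<^sup>2) + \<gamma>\<^sup>2 * (LINT z|Q. (inner (v k z) h)\<^sup>2)"
        by (rule process_second_moment_step(2)[OF sm process_mean])
      also have "\<dots> \<le> 2 * \<gamma> * \<sigma>\<^sup>2 * ((1 - q)\<^sup>2 * (norm h)\<^sup>2 - \<gamma> * (2 * (1 - q) - \<gamma> * R\<^sup>2) * ?s)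
          + \<gamma>\<^sup>2 * (\<sigma>\<^sup>2 * ?s)"
        using step_integral(2)[of h] V[of k h] gamma_pos by (intro add_mono mult_left_mono) auto
      also have "\<dots> = 2 * \<gamma> * \<sigma>\<^sup>2 * ((1 - q)\<^sup>2 * (norm h)\<^sup>2)
          - \<gamma>\<^sup>2 * \<sigma>\<^sup>2 * ?s * (2 * (2 * (1 - q) - \<gamma> * R\<^sup>2) - 1)"
        by (simp add: power2_eq_square algebra_simps)
      also have "\<dots> \<le> 2 * \<gamma> * \<sigma>\<^sup>2 * (1 * (norm h)\<^sup>2) - 0"
      proof (rule diff_mono)
        show "2 * \<gamma> * \<sigma>\<^sup>2 * ((1 - q)\<^sup>2 * (norm h)\<^sup>2) \<le> 2 * \<gamma> * \<sigma>\<^sup>2 * (1 * (norm h)\<^sup>2)"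
          using gamma_pos q_pos q_le by (intro mult_left_mono mult_right_mono) (auto simp: power_le_one)
        show "0 \<le> \<gamma>\<^sup>2 * \<sigma>\<^sup>2 * ?s * (2 * (2 * (1 - q) - \<gamma> * R\<^sup>2) - 1)"
          using gamma_le q cov_nonneg[of h] by (intro mult_nonneg_nonneg) auto
      qed
      finally show ?thesis by simp
    qed
    then show ?case
      using process_measurable[of "Suc k"] gamma_pos
        square_integrableD(2)[OF process_second_moment_step(1)[OF sm process_mean]]
      unfolding second_moment_le_def by auto
  qed
  have W: "increment_variance k i \<le> 2 * \<sigma>\<^sup>2 * inner (C (e i)) (e i)" if "k < n" for k i
  proof -
    have "increment_variance k i \<le> 2 * \<gamma> * \<sigma>\<^sup>2 * (R\<^sup>2 * inner (C (e i)) (e i)) + \<sigma>\<^sup>2 * inner (C (e i)) (e i)"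
      unfolding increment_variance_def
      using increment_coordinate(2)[OF sm[OF that], of "e i"] V[of k "e i"] by linarith
    also have "2 * \<gamma> * \<sigma>\<^sup>2 * (R\<^sup>2 * inner (C (e i)) (e i)) = (2 * (\<gamma> * R\<^sup>2)) * (\<sigma>\<^sup>2 * inner (C (e i)) (e i))"
      by simp
    also have "\<dots> \<le> 1 * (\<sigma>\<^sup>2 * inner (C (e i)) (e i))"
      using gamma_le cov_nonneg[of "e i"] by (intro mult_right_mono) auto
    finally show ?thesis by simp
  qed
  have "(\<Sum>k<n. increment_variance k i) \<le> real n * (2 * \<sigma>\<^sup>2 * inner (C (e i)) (e i))" for i
    using sum_bounded_above[of "{..<n}" "\<lambda>k. increment_variance k i"] W by auto
  then have "\<mu> i / (\<mu> i + lam)\<^sup>2 / (real n)\<^sup>2 * (\<Sum>k<n. increment_variance k i)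
      \<le> \<mu> i / (\<mu> i + lam)\<^sup>2 / (real n)\<^sup>2 * (real n * (2 * \<sigma>\<^sup>2 * inner (C (e i)) (e i)))" for i
    using mu_pos[of i] by (intro mult_left_mono) auto
  also have "\<mu> i / (\<mu> i + lam)\<^sup>2 / (real n)\<^sup>2 * (real n * (2 * \<sigma>\<^sup>2 * inner (C (e i)) (e i)))
      = 2 * \<sigma>\<^sup>2 / real n * (\<mu> i / (\<mu> i + lam)\<^sup>2 * inner (C (e i)) (e i))" for i
    using n_pos by (simp add: power2_eq_square mult_ac)
  finally show ?thesis
    by (intro order_trans[OF average_form] suminf_le ennreal_leI) auto
qed

end

locale bounded_noise_process = noise_process Q e I \<phi> C \<mu> R \<gamma> n v
  for Q :: "'z measure" and e :: "nat \<Rightarrow> 'h::{real_inner, complete_space}" and I \<phi> C \<mu> R \<gamma> n v +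
  fixes U :: "nat \<Rightarrow> real"
  assumes v_norm: "\<And>k. integrable Q (\<lambda>z. (norm (v k z))\<^sup>2)"
    and v_norm_le: "\<And>k. (LINT z|Q. (norm (v k z))\<^sup>2) \<le> R\<^sup>2 * U k"
    and U_nonneg: "\<And>k. 0 \<le> U k"
begin

definition energy :: "nat \<Rightarrow> real" where
  "energy k = (LINT p|P k. inner (C (process v k p)) (process v k p))"

lemma form_integrable:
  assumes "integrable (P k) (\<lambda>p. (norm (process v k p))\<^sup>2)"
  shows "integrable (P k) (\<lambda>p. inner (C (process v k p)) (process v k p))"
proof (rule Bochner_Integration.integrable_bound)
  show "integrable (P k) (\<lambda>p. R\<^sup>2 * (norm (process v k p))\<^sup>2)" using assms by simp
  show "(\<lambda>p. inner (C (process v k p)) (process v k p)) \<in> borel_measurable (P k)"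
    by (intro borel_measurable_inner weakly_measurable_cov process_measurable)
  show "AE p in P k. norm (inner (C (process v k p)) (process v k p)) \<le> norm (R\<^sup>2 * (norm (process v k p))\<^sup>2)"
    using cov_le cov_nonneg by simp
qed

lemma process_pair_measurable: "weakly_measurable (law k) (\<lambda>x. process v k (fst x))"
  by (rule weakly_measurable_compose[OF process_measurable measurable_fst])

lemma v_pair_measurable: "weakly_measurable (law k) (\<lambda>x. v k (snd x))"
  by (rule weakly_measurable_compose[OF v_measurable measurable_snd])

lemma process_norm_step:
  assumes N: "integrable (P k) (\<lambda>p. (norm (process v k p))\<^sup>2)"
  shows "integrable (P (Suc k)) (\<lambda>p. (norm (process v (Suc k) p))\<^sup>2)"
    and "(LINT p|P (Suc k). (norm (process v (Suc k) p))\<^sup>2) \<le> (LINT p|P k. (norm (process v k p))\<^sup>2)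
      - \<gamma> * (2 * (1 - q) - \<gamma> * R\<^sup>2) * energy k + \<gamma>\<^sup>2 * (R\<^sup>2 * U k)"
proof -
  let ?F = "\<lambda>x. step (snd x) (process v k (fst x))" and ?G = "\<lambda>x. \<gamma> *\<^sub>R v k (snd x)"
  have eq: "process v (Suc k) ((fst x)(Suc k := snd x)) = ?F x + ?G x" for x
    by (rule process_Suc_update)
  have wF: "weakly_measurable (law k) ?F"
    by (rule weakly_measurable_step[OF process_pair_measurable measurable_snd])
  have wG: "weakly_measurable (law k) ?G"
    by (intro weakly_measurable_scaleR borel_measurable_const v_pair_measurable)
  let ?B = "\<lambda>p. (1 - q)\<^sup>2 * (norm (process v k p))\<^sup>2
      - \<gamma> * (2 * (1 - q) - \<gamma> * R\<^sup>2) * inner (C (process v k p)) (process v k p)"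
  have B: "integrable (P k) ?B" using N form_integrable[OF N] by simp
  have F: "integrable (law k) (\<lambda>x. (norm (?F x))\<^sup>2)" "(LINT x|(law k). (norm (?F x))\<^sup>2) \<le> (LINT p|P k. ?B p)"
    using pair_integral_le[OF prob_space_P prob_space_Q borel_measurable_norm2[OF wF], of ?B] B step_integral
    by auto
  have G: "integrable (law k) (\<lambda>x. (norm (?G x))\<^sup>2)"
      "(LINT x|(law k). (norm (?G x))\<^sup>2) = \<gamma>\<^sup>2 * (LINT z|Q. (norm (v k z))\<^sup>2)"
    using pair_integral_snd_only[OF prob_space_P prob_space_Q v_norm] by (simp_all add: power_mult_distrib)
  note FG = norm_add_integral[OF wF wG F(1) G(1)]
  have cross: "(LINT x|(law k). inner (?F x) (?G x)) = 0"
    by (rule pair_integral_eq_0[OF prob_space_P prob_space_Q FG(1)]) (simp add: step_sym process_mean)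
  have m: "(\<lambda>p. (norm (process v (Suc k) p))\<^sup>2) \<in> borel_measurable (P (Suc k))"
    by (rule borel_measurable_norm2[OF process_measurable])
  show "integrable (P (Suc k)) (\<lambda>p. (norm (process v (Suc k) p))\<^sup>2)"
    unfolding integral_P_Suc(1)[OF m] eq by (rule FG(2))
  have "(LINT p|P (Suc k). (norm (process v (Suc k) p))\<^sup>2)
      = (LINT x|(law k). (norm (?F x))\<^sup>2) + \<gamma>\<^sup>2 * (LINT z|Q. (norm (v k z))\<^sup>2)"
    unfolding integral_P_Suc(2)[OF m] eq FG(3) cross G(2) by simp
  also have "\<dots> \<le> (LINT p|P k. ?B p) + \<gamma>\<^sup>2 * (R\<^sup>2 * U k)"
    using F(2) v_norm_le[of k] by (intro add_mono mult_left_mono) auto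
  also have "(LINT p|P k. ?B p) = (1 - q)\<^sup>2 * (LINT p|P k. (norm (process v k p))\<^sup>2)
      - \<gamma> * (2 * (1 - q) - \<gamma> * R\<^sup>2) * energy k"
    using N form_integrable[OF N] by (simp add: energy_def)
  also have "\<dots> \<le> 1 * (LINT p|P k. (norm (process v k p))\<^sup>2) - \<gamma> * (2 * (1 - q) - \<gamma> * R\<^sup>2) * energy k"
    using q_pos q_le by (intro diff_right_mono mult_right_mono) (auto simp: power_le_one)
  finally show "(LINT p|P (Suc k). (norm (process v (Suc k) p))\<^sup>2) \<le> (LINT p|P k. (norm (process v k p))\<^sup>2)
      - \<gamma> * (2 * (1 - q) - \<gamma> * R\<^sup>2) * energy k + \<gamma>\<^sup>2 * (R\<^sup>2 * U k)" by simp
qed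

lemma process_norm_integrable: "integrable (P k) (\<lambda>p. (norm (process v k p))\<^sup>2)"
  by (induction k) (simp, rule process_norm_step(1))

lemma energy_nonneg: "0 \<le> energy k"
  unfolding energy_def by (intro Bochner_Integration.integral_nonneg cov_nonneg)

lemma energy_sum_le: "(\<Sum>k<n. energy k) \<le> (\<Sum>k<n. U k)"
proof (cases "n = 1")
  case True
  have "energy 0 = 0" by (simp add: energy_def)
  then show ?thesis using True U_nonneg[of 0] by simp
next
  case False
  then have q: "q \<le> 1/2" using n_pos by (intro q_half) simp
  have "(LINT p|P m. (norm (process v m p))\<^sup>2) + \<gamma> / 2 * (\<Sum>k<m. energy k) \<le> \<gamma> / 2 * (\<Sum>k<m. U k)" for m
  proof (induction m)
    case (Suc m)
    have "\<gamma> * (1/2) * energy m \<le> \<gamma> * (2 * (1 - q) - \<gamma> * R\<^sup>2) * energy m"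
      using q gamma_le gamma_pos energy_nonneg[of m] by (intro mult_right_mono mult_left_mono) auto
    moreover have "\<gamma> * (\<gamma> * R\<^sup>2 * U m) \<le> \<gamma> * (1/2 * U m)"
      using gamma_le gamma_pos U_nonneg[of m] by (intro mult_left_mono mult_right_mono) auto
    ultimately show ?case
      using process_norm_step(2)[OF process_norm_integrable, of m] Suc
      by (simp add: power2_eq_square algebra_simps)
  qed simp
  from this[of n] have "\<gamma> / 2 * (\<Sum>k<n. energy k) \<le> \<gamma> / 2 * (\<Sum>k<n. U k)"
    using Bochner_Integration.integral_nonneg[of "P n" "\<lambda>p. (norm (process v n p))\<^sup>2", OF zero_le_power2]
    by linarith
  then show ?thesis using gamma_pos by simp
qed

lemma increment_norm:
  shows "integrable (law k) (\<lambda>x. (norm (increment k x))\<^sup>2)"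
    and "(LINT x|(law k). (norm (increment k x))\<^sup>2) \<le> R\<^sup>2 * (energy k + U k)"
proof -
  let ?F = "\<lambda>x. deviation (snd x) (process v k (fst x))" and ?G = "\<lambda>x. v k (snd x)"
  have wF: "weakly_measurable (law k) ?F"
    by (rule weakly_measurable_deviation[OF process_pair_measurable measurable_snd])
  let ?B = "\<lambda>p. R\<^sup>2 * inner (C (process v k p)) (process v k p)"
  have F: "integrable (law k) (\<lambda>x. (norm (?F x))\<^sup>2)" "(LINT x|(law k). (norm (?F x))\<^sup>2) \<le> (LINT p|P k. ?B p)"
    using pair_integral_le[OF prob_space_P prob_space_Q borel_measurable_norm2[OF wF], of ?B]
      form_integrable[OF process_norm_integrable] deviation_integral by auto
  note G = pair_integral_snd_only[OF prob_space_P[of k] prob_space_Q v_norm]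
  note FG = norm_add_integral[OF wF v_pair_measurable F(1) G(1)]
  show "integrable (law k) (\<lambda>x. (norm (increment k x))\<^sup>2)"
    unfolding increment_def by (rule FG(2))
  have cross: "(LINT x|(law k). inner (?F x) (?G x)) = 0"
    by (rule pair_integral_eq_0[OF prob_space_P prob_space_Q FG(1)]) (simp add: deviation_sym process_mean)
  have "(LINT x|(law k). (norm (increment k x))\<^sup>2)
      = (LINT x|(law k). (norm (?F x))\<^sup>2) + (LINT z|Q. (norm (v k z))\<^sup>2)"
    unfolding increment_def FG(3) cross G(2) by simp
  also have "\<dots> \<le> R\<^sup>2 * energy k + R\<^sup>2 * U k"
    using F(2) v_norm_le[of k] by (intro add_mono) (auto simp: energy_def)
  finally show "(LINT x|(law k). (norm (increment k x))\<^sup>2) \<le> R\<^sup>2 * (energy k + U k)"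
    by (simp add: distrib_left)
qed

lemma average_form_bounded_noise:
  assumes \<kappa>: "\<And>i. \<mu> i / (\<mu> i + lam)\<^sup>2 \<le> \<kappa>"
  shows "(\<integral>\<^sup>+p. ennreal (inner (C (average p)) (average p)) \<partial>P n)
    \<le> ennreal (\<kappa> / (real n)\<^sup>2 * (2 * R\<^sup>2 * (\<Sum>k<n. U k)))"
proof -
  have \<kappa>0: "0 \<le> \<kappa>" using \<kappa>[of 0] mu_pos[of 0] lam_pos
    by (elim order_trans[rotated]) auto
  have W: "0 \<le> increment_variance k i" for k i by (simp add: increment_variance_def)
  have Wsum: "(\<Sum>i. ennreal (increment_variance k i)) = ennreal (LINT x|(law k). (norm (increment k x))\<^sup>2)" for k
  proof -
    have "(\<Sum>i. ennreal (increment_variance k i)) = (\<Sum>i. (\<integral>\<^sup>+x. ennreal ((inner (increment k x) (e i))\<^sup>2) \<partial>law k))"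
      unfolding increment_variance_def
      using increment_square_integrable[THEN square_integrableD(2)]
      by (intro suminf_cong nn_integral_eq_integral[symmetric]) auto
    also have "\<dots> = (\<integral>\<^sup>+x. (\<Sum>i. ennreal ((inner (increment k x) (e i))\<^sup>2)) \<partial>law k)"
      using increment_square_integrable[THEN square_integrableD(1)]
      by (intro nn_integral_suminf[symmetric]) auto
    also have "\<dots> = (\<integral>\<^sup>+x. ennreal ((norm (increment k x))\<^sup>2) \<partial>law k)"
      by (intro nn_integral_cong suminf_ennreal_eq parseval) auto
    also have "\<dots> = ennreal (LINT x|(law k). (norm (increment k x))\<^sup>2)"
      by (intro nn_integral_eq_integral increment_norm) auto
    finally show ?thesis .
  qed
  have "(\<integral>\<^sup>+p. ennreal (inner (C (average p)) (average p)) \<partial>P n)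
      \<le> (\<Sum>i. ennreal (\<mu> i / (\<mu> i + lam)\<^sup>2 / (real n)\<^sup>2 * (\<Sum>k<n. increment_variance k i)))"
    by (rule average_form)
  also have "\<dots> \<le> (\<Sum>i. ennreal (\<kappa> / (real n)\<^sup>2) * (\<Sum>k<n. ennreal (increment_variance k i)))"
  proof (rule suminf_le)
    fix i
    have "\<mu> i / (\<mu> i + lam)\<^sup>2 / (real n)\<^sup>2 * (\<Sum>k<n. increment_variance k i)
        \<le> \<kappa> / (real n)\<^sup>2 * (\<Sum>k<n. increment_variance k i)"
      using \<kappa>[of i] W by (intro mult_right_mono divide_right_mono sum_nonneg) auto
    then show "ennreal (\<mu> i / (\<mu> i + lam)\<^sup>2 / (real n)\<^sup>2 * (\<Sum>k<n. increment_variance k i))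
        \<le> ennreal (\<kappa> / (real n)\<^sup>2) * (\<Sum>k<n. ennreal (increment_variance k i))"
      using \<kappa>0 W by (simp add: ennreal_mult[symmetric] sum_nonneg ennreal_leI)
  qed auto
  also have "\<dots> = ennreal (\<kappa> / (real n)\<^sup>2) * (\<Sum>k<n. ennreal (LINT x|(law k). (norm (increment k x))\<^sup>2))"
    by (simp add: suminf_sum Wsum)
  also have "\<dots> = ennreal (\<kappa> / (real n)\<^sup>2 * (\<Sum>k<n. (LINT x|(law k). (norm (increment k x))\<^sup>2)))"
    using \<kappa>0 by (simp add: ennreal_mult[symmetric] sum_nonneg)
  also have "\<dots> \<le> ennreal (\<kappa> / (real n)\<^sup>2 * (2 * R\<^sup>2 * (\<Sum>k<n. U k)))"
  proof (intro ennreal_leI mult_left_mono)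
    have "(\<Sum>k<n. (LINT x|(law k). (norm (increment k x))\<^sup>2)) \<le> (\<Sum>k<n. R\<^sup>2 * (energy k + U k))"
      by (intro sum_mono increment_norm)
    also have "\<dots> = R\<^sup>2 * ((\<Sum>k<n. energy k) + (\<Sum>k<n. U k))"
      by (simp add: distrib_left sum_distrib_left sum.distrib)
    also have "\<dots> \<le> R\<^sup>2 * ((\<Sum>k<n. U k) + (\<Sum>k<n. U k))"
      using energy_sum_le by (intro mult_left_mono add_mono) auto
    finally show "(\<Sum>k<n. (LINT x|(law k). (norm (increment k x))\<^sup>2)) \<le> 2 * R\<^sup>2 * (\<Sum>k<n. U k)" by simp
  qed (use \<kappa>0 in auto)
  finally show ?thesis .
qed

end

lemma powr_mult_powr_le:
  fixes x y :: real
  assumes "0 < x" "0 < y" "0 \<le> s" "0 \<le> t"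
  shows "x powr s * y powr t \<le> (x + y) powr (s + t)"
proof -
  have "x powr s \<le> (x + y) powr s" "y powr t \<le> (x + y) powr t"
    using assms by (auto intro!: powr_mono2)
  then have "x powr s * y powr t \<le> (x + y) powr s * (x + y) powr t" by (intro mult_mono) auto
  then show ?thesis by (simp add: powr_add)
qed

lemma three_ennreal: "0 \<le> a \<Longrightarrow> 0 \<le> b \<Longrightarrow> ennreal (3 * a + 3 * b) = 3 * ennreal a + 3 * ennreal b"
  by (simp add: ennreal_plus ennreal_mult)

section \<open>Averaged regularized stochastic gradient descent\<close>

text \<open>The error \<open>\<theta>\<^sub>0 - \<theta>\<^sub>*\<close> is the function \<open>\<eta>\<close>, and \<open>\<epsilon>\<close> is the noise. With \<open>q = \<gamma>\<lambda>\<close>, the iterate is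
  \<open>\<theta>\<^sub>0\<close> plus the sum of its noiseless mean drift, a centred process driven by the sampling of the bias and
  a centred process driven by \<open>\<epsilon>\<close>. All three take values in the Hilbert space, although \<open>\<eta>\<close> does not.\<close>

locale regression = sgd_features Q e I \<phi> C \<mu> R \<gamma> n
  for Q :: "'z measure" and e :: "nat \<Rightarrow> 'h::{real_inner, complete_space}" and I \<phi> C \<mu> R \<gamma> n +
  fixes \<eta> \<epsilon> :: "'z \<Rightarrow> real" and \<sigma> :: real
  assumes eta: "in_closure \<eta>"
    and eps_measurable: "\<epsilon> \<in> borel_measurable Q"
    and eps_mean: "\<And>h. (LINT z|Q. \<epsilon> z * inner (\<phi> z) h) = 0"
    and eps_integrable: "\<And>h. integrable Q (\<lambda>z. (\<epsilon> z)\<^sup>2 * (inner (\<phi> z) h)\<^sup>2)"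
    and eps_le: "\<And>h. (LINT z|Q. (\<epsilon> z)\<^sup>2 * (inner (\<phi> z) h)\<^sup>2) \<le> \<sigma>\<^sup>2 * inner (C h) h"
begin

definition target :: 'h where
  "target = (SOME t. \<forall>h. (LINT z|Q. \<eta> z * inner (\<phi> z) h) = inner t h)"

lemma target: "(LINT z|Q. \<eta> z * inner (\<phi> z) h) = inner target h"
  using someI_ex[OF representer_exists[OF eta]] unfolding target_def by blast

primrec drift :: "nat \<Rightarrow> 'h" where
  "drift 0 = 0"
| "drift (Suc k) = (1 - q) *\<^sub>R drift k - \<gamma> *\<^sub>R (C (drift k) + target)"

primrec coef :: "real \<Rightarrow> nat \<Rightarrow> real" where
  "coef x 0 = 1"
| "coef x (Suc k) = (1 - q - x) * coef x k + q"

lemma bias_recursion_coef: "bias_recursion n q (\<gamma> * \<mu> i) (coef (\<gamma> * \<mu> i))"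
  using n_pos gamma_mu by unfold_locales (simp_all add: q_def)

definition bias :: "nat \<Rightarrow> 'z \<Rightarrow> real" where
  "bias k z = \<eta> z + inner (\<phi> z) (drift k)"

lemma shifted_representer:
  "(LINT z|Q. (\<eta> z + inner (\<phi> z) d) * inner (\<phi> z) h) = inner (C d + target) h"
  using square_integrable_mult[OF in_closure_square_integrable[OF eta] inner_phi_square_integrable, of h]
    square_integrable_mult[OF inner_phi_square_integrable inner_phi_square_integrable, of d h]
  by (simp add: distrib_right target cov_integral inner_add_left)

lemma drift_coordinate: "inner (C (drift k) + target) (e i) = inner target (e i) * coef (\<gamma> * \<mu> i) k"
proof (induction k)
  case (Suc k)
  have "inner (C (drift (Suc k)) + target) (e i)
      = (1 - q - \<gamma> * \<mu> i) * inner (C (drift k) + target) (e i) + q * inner target (e i)"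
    by (simp add: inner_add_left inner_cov_eigen inner_diff_left algebra_simps)
  then show ?case unfolding Suc by (simp add: algebra_simps)
qed simp

definition bias_noise :: "nat \<Rightarrow> 'z \<Rightarrow> 'h" where
  "bias_noise k z = C (drift k) + target - bias k z *\<^sub>R \<phi> z"

lemma bias_in_closure: "in_closure (bias k)"
  unfolding bias_def[abs_def] by (rule in_closure_add[OF eta])

definition bias_risk :: "nat \<Rightarrow> real" where
  "bias_risk k = (LINT z|Q. (bias k z)\<^sup>2)"

lemma bias_noise_measurable: "weakly_measurable Q (bias_noise k)"
  unfolding bias_noise_def[abs_def]
  using square_integrableD(1)[OF in_closure_square_integrable[OF bias_in_closure]]
  by (intro weakly_measurable_diff weakly_measurable_const weakly_measurable_scaleR phi_measurable)

lemma bias_noise_norm: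
  shows "integrable Q (\<lambda>z. (norm (bias_noise k z))\<^sup>2)"
    and "(LINT z|Q. (norm (bias_noise k z))\<^sup>2) \<le> R\<^sup>2 * bias_risk k"
proof -
  note u = in_closure_square_integrable[OF bias_in_closure[of k]] fourth_closure[OF bias_in_closure[of k]]
  have s: "(LINT z|Q. bias k z * inner (\<phi> z) h) = inner (C (drift k) + target) h" for h
    unfolding bias_def by (rule shifted_representer)
  note dev = deviation_norm[OF u(1,2) s]
  show "integrable Q (\<lambda>z. (norm (bias_noise k z))\<^sup>2)"
    unfolding bias_noise_def by (rule dev(1))
  show "(LINT z|Q. (norm (bias_noise k z))\<^sup>2) \<le> R\<^sup>2 * bias_risk k"
    unfolding bias_noise_def dev(2) using u(3) by (simp add: bias_risk_def) (smt (verit) zero_le_power2)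
qed

sublocale noise: noise_process Q e I \<phi> C \<mu> R \<gamma> n "\<lambda>k z. \<epsilon> z *\<^sub>R \<phi> z"
proof
  have int: "integrable Q (\<lambda>z. (inner (\<epsilon> z *\<^sub>R \<phi> z) h)\<^sup>2)"
    "(LINT z|Q. (inner (\<epsilon> z *\<^sub>R \<phi> z) h)\<^sup>2) \<le> \<sigma>\<^sup>2 * inner (C h) h" for h
    using eps_integrable[of h] eps_le[of h] by (simp_all add: power_mult_distrib)
  show "(LINT z|Q. inner (\<epsilon> z *\<^sub>R \<phi> z) h) = 0" for h
    using eps_mean[of h] by simp
  have "(LINT z|Q. (inner (\<epsilon> z *\<^sub>R \<phi> z) h)\<^sup>2) \<le> \<sigma>\<^sup>2 * R\<^sup>2 * (norm h)\<^sup>2" for h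
    using int(2)[of h] mult_left_mono[OF cov_le[of h], of "\<sigma>\<^sup>2"] by (simp add: mult.assoc)
  then have "second_moment_le Q (\<lambda>z. \<epsilon> z *\<^sub>R \<phi> z) (\<sigma>\<^sup>2 * R\<^sup>2)"
    unfolding second_moment_le_def using int(1) phi_measurable eps_measurable
    by (auto intro: weakly_measurable_scaleR)
  then show "\<exists>B. second_moment_le Q (\<lambda>z. \<epsilon> z *\<^sub>R \<phi> z) B" by blast
qed

sublocale bias: bounded_noise_process Q e I \<phi> C \<mu> R \<gamma> n bias_noise bias_risk
proof
  fix k h
  have i: "integrable Q (\<lambda>z. bias k z * inner (\<phi> z) h)"
    by (rule square_integrable_mult[OF in_closure_square_integrable[OF bias_in_closure] inner_phi_square_integrable])
  have s: "(LINT z|Q. bias k z * inner (\<phi> z) h) = inner (C (drift k) + target) h"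
    unfolding bias_def by (rule shifted_representer)
  show "(LINT z|Q. inner (bias_noise k z) h) = 0"
    using i by (simp add: bias_noise_def inner_diff_left s prob_space)
next
  fix k
  have "second_moment_le Q (bias_noise k) (LINT z|Q. (norm (bias_noise k z))\<^sup>2)"
    unfolding second_moment_le_def
  proof (intro conjI allI)
    fix h
    have le: "(inner (bias_noise k z) h)\<^sup>2 \<le> (norm (bias_noise k z))\<^sup>2 * (norm h)\<^sup>2" for z
      using Cauchy_Schwarz_ineq[of "bias_noise k z" h] by (simp add: power2_norm_eq_inner)
    have b: "integrable Q (\<lambda>z. (norm (bias_noise k z))\<^sup>2 * (norm h)\<^sup>2)"
      using bias_noise_norm(1) by simp
    show i: "integrable Q (\<lambda>z. (inner (bias_noise k z) h)\<^sup>2)"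
      using le weakly_measurableD[OF bias_noise_measurable]
      by (intro Bochner_Integration.integrable_bound[OF b]) auto
    show "(LINT z|Q. (inner (bias_noise k z) h)\<^sup>2) \<le> (LINT z|Q. (norm (bias_noise k z))\<^sup>2) * (norm h)\<^sup>2"
      using integral_mono[OF i b le] by simp
  qed (auto simp: bias_noise_measurable)
  then show "\<exists>B. second_moment_le Q (bias_noise k) B" by blast
  show "integrable Q (\<lambda>z. (norm (bias_noise k z))\<^sup>2)" by (rule bias_noise_norm)
  show "(LINT z|Q. (norm (bias_noise k z))\<^sup>2) \<le> R\<^sup>2 * bias_risk k" by (rule bias_noise_norm)
  show "0 \<le> bias_risk k" by (simp add: bias_risk_def)
qed

text \<open>\<open>weight i = \<mu>\<^sub>i a\<^sub>i\<^sup>2\<close> is the squared \<open>L\<^sup>2\<close> norm of the \<open>i\<close>-th component of \<open>\<eta>\<close>.\<close>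

definition weight :: "nat \<Rightarrow> real" where
  "weight i = (inner target (e i))\<^sup>2 / \<mu> i"

lemma weight_nonneg: "0 \<le> weight i"
  using mu_pos[of i] by (simp add: weight_def)

lemma q_ratio: "q / (q + \<gamma> * \<mu> i) = lam / (\<mu> i + lam)"
proof -
  have "q = \<gamma> * lam" using gamma_pos by (simp add: q_def lam_def)
  then show ?thesis unfolding gamma_shift using gamma_pos by simp
qed

definition mean_drift :: 'h where
  "mean_drift = (1 / (real n + 1)) *\<^sub>R (\<Sum>k\<le>n. drift k)"

lemma mean_bias_le:
  "ennreal (LINT z|Q. (\<eta> z + inner (\<phi> z) mean_drift)\<^sup>2)
    \<le> (\<Sum>i. ennreal (25/4 * (lam / (\<mu> i + lam))\<^sup>2 * weight i))"
proof -
  have coord: "inner (C mean_drift + target) (e i)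
      = inner target (e i) * ((\<Sum>k\<le>n. coef (\<gamma> * \<mu> i) k) / (real n + 1))" for i
  proof -
    have "C mean_drift + target = (1 / (real n + 1)) *\<^sub>R (\<Sum>k\<le>n. C (drift k) + target)"
      by (simp add: mean_drift_def blinfun.scaleR_right blinfun.sum_right sum.distrib scaleR_add_right
          scaleR_sum_right sum_constant_scaleR add.commute[of 1 "real n"])
    then show ?thesis
      by (simp add: inner_sum_left drift_coordinate sum_distrib_left sum_divide_distrib)
  qed
  have "(\<lambda>i. (LINT z|Q. (\<eta> z + inner (\<phi> z) mean_drift) * inner (\<phi> z) (e i))\<^sup>2 / \<mu> i)
      sums (LINT z|Q. (\<eta> z + inner (\<phi> z) mean_drift)\<^sup>2)"
    by (rule parseval_closure[OF in_closure_add[OF eta]])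
  then have s: "(\<lambda>i. weight i * ((\<Sum>k\<le>n. coef (\<gamma> * \<mu> i) k) / (real n + 1))\<^sup>2)
      sums (LINT z|Q. (\<eta> z + inner (\<phi> z) mean_drift)\<^sup>2)"
    unfolding shifted_representer coord by (simp add: weight_def power_mult_distrib power_divide mult.commute)
  have "ennreal (LINT z|Q. (\<eta> z + inner (\<phi> z) mean_drift)\<^sup>2)
      = (\<Sum>i. ennreal (weight i * ((\<Sum>k\<le>n. coef (\<gamma> * \<mu> i) k) / (real n + 1))\<^sup>2))"
    by (rule suminf_ennreal_eq[OF _ s, symmetric]) (simp add: weight_nonneg)
  also have "\<dots> \<le> (\<Sum>i. ennreal (25/4 * (lam / (\<mu> i + lam))\<^sup>2 * weight i))"
  proof (intro suminf_le ennreal_leI)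
    fix i
    have "weight i * ((\<Sum>k\<le>n. coef (\<gamma> * \<mu> i) k) / (real n + 1))\<^sup>2
        \<le> weight i * (25/4 * (q / (q + \<gamma> * \<mu> i))\<^sup>2)"
      by (intro mult_left_mono bias_recursion.average_bound[OF bias_recursion_coef] weight_nonneg)
    then show "weight i * ((\<Sum>k\<le>n. coef (\<gamma> * \<mu> i) k) / (real n + 1))\<^sup>2
        \<le> 25/4 * (lam / (\<mu> i + lam))\<^sup>2 * weight i"
      by (simp add: q_ratio mult_ac)
  qed auto
  finally show ?thesis .
qed

lemma bias_risk_sum_le:
  "ennreal (\<Sum>k<n. bias_risk k) \<le> (\<Sum>i. ennreal (2 * real n * (lam / (\<mu> i + lam)) * weight i))"
proof -
  have s: "(\<lambda>i. weight i * (coef (\<gamma> * \<mu> i) k)\<^sup>2) sums bias_risk k" for k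
  proof -
    have "(\<lambda>i. (LINT z|Q. (\<eta> z + inner (\<phi> z) (drift k)) * inner (\<phi> z) (e i))\<^sup>2 / \<mu> i)
        sums (LINT z|Q. (\<eta> z + inner (\<phi> z) (drift k))\<^sup>2)"
      by (rule parseval_closure[OF in_closure_add[OF eta]])
    then show ?thesis
      unfolding shifted_representer drift_coordinate by (simp add: weight_def power_mult_distrib bias_risk_def bias_def)
  qed
  have "(\<lambda>i. \<Sum>k<n. weight i * (coef (\<gamma> * \<mu> i) k)\<^sup>2) sums (\<Sum>k<n. bias_risk k)"
    by (intro sums_sum s)
  then have "ennreal (\<Sum>k<n. bias_risk k) = (\<Sum>i. ennreal (\<Sum>k<n. weight i * (coef (\<gamma> * \<mu> i) k)\<^sup>2))"
    by (intro suminf_ennreal_eq[symmetric]) (auto intro!: sum_nonneg simp: weight_nonneg)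
  also have "\<dots> \<le> (\<Sum>i. ennreal (2 * real n * (lam / (\<mu> i + lam)) * weight i))"
  proof (intro suminf_le ennreal_leI)
    fix i
    have "(\<Sum>k<n. (coef (\<gamma> * \<mu> i) k)\<^sup>2) \<le> 2 / (q + \<gamma> * \<mu> i)"
      by (rule bias_recursion.sum_squares_bound[OF bias_recursion_coef])
    also have "\<dots> = 2 * real n * (q / (q + \<gamma> * \<mu> i))" using n_pos by (simp add: q_def)
    finally have "weight i * (\<Sum>k<n. (coef (\<gamma> * \<mu> i) k)\<^sup>2) \<le> weight i * (2 * real n * (lam / (\<mu> i + lam)))"
      unfolding q_ratio by (intro mult_left_mono weight_nonneg)
    then show "(\<Sum>k<n. weight i * (coef (\<gamma> * \<mu> i) k)\<^sup>2) \<le> 2 * real n * (lam / (\<mu> i + lam)) * weight i"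
      by (simp add: sum_distrib_left mult_ac)
  qed auto
  finally show ?thesis .
qed

definition total :: "(nat \<Rightarrow> 'z) \<Rightarrow> 'h" where
  "total p = mean_drift + bias.average p + noise.average p"

definition excess :: "(nat \<Rightarrow> 'z) \<Rightarrow> real" where
  "excess p = (LINT z|Q. (\<eta> z + inner (\<phi> z) (total p))\<^sup>2)"

lemma shifted_risk:
  "(LINT z|Q. (\<eta> z + inner (\<phi> z) d)\<^sup>2) = (LINT z|Q. (\<eta> z)\<^sup>2) + 2 * inner target d + inner (C d) d"
  using square_integrable_add(2)[OF in_closure_square_integrable[OF eta] inner_phi_square_integrable]
  by (simp add: target cov_diag)

lemma total_cong: "(\<And>i. i \<in> {1..n} \<Longrightarrow> p i = p' i) \<Longrightarrow> total p = total p'"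
  unfolding total_def bias.average_def noise.average_def
  by (intro arg_cong2[where f = "(+)"] arg_cong2[where f = scaleR] sum.cong refl process_cong) auto

lemma excess_measurable: "excess \<in> borel_measurable (P n)"
proof -
  have w: "weakly_measurable (P n) total"
    unfolding total_def[abs_def]
    by (intro weakly_measurable_add weakly_measurable_const bias.average_measurable noise.average_measurable)
  show ?thesis
    unfolding excess_def[abs_def] shifted_risk
    using borel_measurable_inner[OF weakly_measurable_const[of _ target] w]
      borel_measurable_inner[OF weakly_measurable_cov[OF w] w]
    by simp
qed

lemma excess_le:
  "excess p \<le> 3 * ((LINT z|Q. (\<eta> z + inner (\<phi> z) mean_drift)\<^sup>2)
    + inner (C (bias.average p)) (bias.average p) + inner (C (noise.average p)) (noise.average p))"
proof -
  let ?a = "\<lambda>z. \<eta> z + inner (\<phi> z) mean_drift"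
  let ?b = "\<lambda>z. inner (\<phi> z) (bias.average p)" and ?c = "\<lambda>z. inner (\<phi> z) (noise.average p)"
  have a: "?a \<in> square_integrable Q"
    by (rule in_closure_square_integrable[OF in_closure_add[OF eta]])
  note abc = square_integrableD(2)[OF a] square_integrableD(2)[OF inner_phi_square_integrable[of "bias.average p"]]
    square_integrableD(2)[OF inner_phi_square_integrable[of "noise.average p"]]
  have "excess p \<le> (LINT z|Q. 3 * ((?a z)\<^sup>2 + (?b z)\<^sup>2 + (?c z)\<^sup>2))"
    unfolding excess_def
  proof (rule integral_mono)
    show "integrable Q (\<lambda>z. (\<eta> z + inner (\<phi> z) (total p))\<^sup>2)"
      by (rule square_integrableD(2)[OF in_closure_square_integrable[OF in_closure_add[OF eta]]])
    show "integrable Q (\<lambda>z. 3 * ((?a z)\<^sup>2 + (?b z)\<^sup>2 + (?c z)\<^sup>2))" using abc by simp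
    fix z
    have "(x + y + w)\<^sup>2 \<le> 3 * (x\<^sup>2 + y\<^sup>2 + w\<^sup>2)" for x y w :: real
    proof -
      have "3 * (x\<^sup>2 + y\<^sup>2 + w\<^sup>2) - (x + y + w)\<^sup>2 = (x - y)\<^sup>2 + (y - w)\<^sup>2 + (x - w)\<^sup>2"
        by (simp add: power2_eq_square algebra_simps)
      moreover have "0 \<le> (x - y)\<^sup>2 + (y - w)\<^sup>2 + (x - w)\<^sup>2" by simp
      ultimately show ?thesis by linarith
    qed
    from this[of "?a z" "?b z" "?c z"]
    show "(\<eta> z + inner (\<phi> z) (total p))\<^sup>2 \<le> 3 * ((?a z)\<^sup>2 + (?b z)\<^sup>2 + (?c z)\<^sup>2)"
      by (simp add: total_def inner_add_right add.assoc)
  qed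
  then show ?thesis using abc by (simp add: cov_diag)
qed

lemma noise_average_form:
  "(\<integral>\<^sup>+p. ennreal (inner (C (noise.average p)) (noise.average p)) \<partial>P n)
    \<le> (\<Sum>i. ennreal (2 * \<sigma>\<^sup>2 / real n * (\<mu> i / (\<mu> i + lam)\<^sup>2 * inner (C (e i)) (e i))))"
  using eps_le by (intro noise.average_form_structured_noise) (simp add: power_mult_distrib)

lemma excess_nn_integral:
  assumes \<kappa>: "\<And>i. \<mu> i / (\<mu> i + lam)\<^sup>2 \<le> \<kappa>"
  shows "(\<integral>\<^sup>+p. ennreal (excess p) \<partial>P n)
    \<le> ennreal (3 * (LINT z|Q. (\<eta> z + inner (\<phi> z) mean_drift)\<^sup>2)
        + 3 * (\<kappa> / (real n)\<^sup>2 * (2 * R\<^sup>2 * (\<Sum>k<n. bias_risk k))))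
      + 3 * (\<Sum>i. ennreal (2 * \<sigma>\<^sup>2 / real n * (\<mu> i / (\<mu> i + lam)\<^sup>2 * inner (C (e i)) (e i))))"
proof -
  interpret Pn: prob_space "P n" by (rule prob_space_P)
  let ?B = "LINT z|Q. (\<eta> z + inner (\<phi> z) mean_drift)\<^sup>2"
  have \<kappa>0: "0 \<le> \<kappa>" using \<kappa>[of 0] mu_pos[of 0] lam_pos
    by (elim order_trans[rotated]) auto
  have pos: "0 \<le> \<kappa> / (real n)\<^sup>2 * (2 * R\<^sup>2 * (\<Sum>k<n. bias_risk k))"
    using \<kappa>0 by (intro mult_nonneg_nonneg sum_nonneg) (auto simp: bias_risk_def)
  have m: "(\<lambda>p. inner (C (bias.average p)) (bias.average p)) \<in> borel_measurable (P n)"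
    "(\<lambda>p. inner (C (noise.average p)) (noise.average p)) \<in> borel_measurable (P n)"
    by (intro borel_measurable_inner weakly_measurable_cov bias.average_measurable noise.average_measurable)+
  have "(\<integral>\<^sup>+p. ennreal (excess p) \<partial>P n) \<le> (\<integral>\<^sup>+p. 3 * (ennreal ?B
      + ennreal (inner (C (bias.average p)) (bias.average p))
      + ennreal (inner (C (noise.average p)) (noise.average p))) \<partial>P n)"
  proof (rule nn_integral_mono)
    fix p
    have "ennreal (excess p) \<le> ennreal (3 * (?B + inner (C (bias.average p)) (bias.average p)
        + inner (C (noise.average p)) (noise.average p)))"
      by (intro ennreal_leI excess_le)
    also have "\<dots> = 3 * (ennreal ?B + ennreal (inner (C (bias.average p)) (bias.average p))
      + ennreal (inner (C (noise.average p)) (noise.average p)))"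
      by (simp add: ennreal_mult cov_nonneg)
    finally show "ennreal (excess p) \<le> 3 * (ennreal ?B + ennreal (inner (C (bias.average p)) (bias.average p))
      + ennreal (inner (C (noise.average p)) (noise.average p)))" .
  qed
  also have "\<dots> = 3 * (ennreal ?B + (\<integral>\<^sup>+p. ennreal (inner (C (bias.average p)) (bias.average p)) \<partial>P n)
      + (\<integral>\<^sup>+p. ennreal (inner (C (noise.average p)) (noise.average p)) \<partial>P n))"
    using m by (simp add: nn_integral_cmult nn_integral_add Pn.emeasure_space_1)
  also have "\<dots> \<le> 3 * (ennreal ?B + ennreal (\<kappa> / (real n)\<^sup>2 * (2 * R\<^sup>2 * (\<Sum>k<n. bias_risk k)))
      + (\<Sum>i. ennreal (2 * \<sigma>\<^sup>2 / real n * (\<mu> i / (\<mu> i + lam)\<^sup>2 * inner (C (e i)) (e i)))))"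
    by (intro mult_left_mono add_mono order_refl noise_average_form bias.average_form_bounded_noise \<kappa>) auto
  also have "\<dots> = ennreal (3 * ?B + 3 * (\<kappa> / (real n)\<^sup>2 * (2 * R\<^sup>2 * (\<Sum>k<n. bias_risk k))))
      + 3 * (\<Sum>i. ennreal (2 * \<sigma>\<^sup>2 / real n * (\<mu> i / (\<mu> i + lam)\<^sup>2 * inner (C (e i)) (e i))))"
    unfolding three_ennreal[OF Bochner_Integration.integral_nonneg[OF zero_le_power2] pos]
    by (simp only: distrib_left)
  finally show ?thesis .
qed

text \<open>The rates \<open>\<lambda>\<^bsup>1-r\<^esup>\<close> and \<open>\<lambda>\<^bsup>-b\<^esup>/n\<close> come from \<open>\<mu>\<^sup>s\<lambda>\<^sup>t \<le> (\<mu> + \<lambda>)\<^bsup>s+t\<^esup>\<close>. The hypothesis on \<open>\<kappa>\<close> says that the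
  contribution of the sampling noise of the bias is at most \<open>8.25 + \<delta>\<close> times the squared bias.\<close>

theorem excess_bound:
  assumes r: "- 1 \<le> r" "r \<le> 1" and b: "0 \<le> b" "b \<le> 1"
    and \<kappa>: "\<And>i. \<mu> i / (\<mu> i + lam)\<^sup>2 \<le> \<kappa>"
    and \<delta>: "0 \<le> \<delta>" "\<And>i. 12 * \<kappa> * R\<^sup>2 / real n * (lam / (\<mu> i + lam)) * \<mu> i
      \<le> (33/4 + \<delta>) * (lam powr (1 - r) * \<mu> i powr r)"
    and cap: "(\<Sum>i. ennreal (\<mu> i powr b * inner (e i) (e i))) < \<infinity>"
  shows "integrable (P n) excess"
    and "ennreal (LINT p|P n. excess p)
      \<le> ennreal ((27 + \<delta>) * lam powr (1 - r)) * (\<Sum>i. ennreal (\<mu> i powr r * (inner target (e i) / \<mu> i)\<^sup>2))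
        + ennreal (6 * \<sigma>\<^sup>2 / real n * lam powr (- b)) * (\<Sum>i. ennreal (\<mu> i powr b * inner (e i) (e i)))"
proof -
  let ?B = "LINT z|Q. (\<eta> z + inner (\<phi> z) mean_drift)\<^sup>2"
  let ?X = "\<kappa> / (real n)\<^sup>2 * (2 * R\<^sup>2 * (\<Sum>k<n. bias_risk k))"
  let ?V = "\<Sum>i. ennreal (2 * \<sigma>\<^sup>2 / real n * (\<mu> i / (\<mu> i + lam)\<^sup>2 * inner (C (e i)) (e i)))"
  let ?S = "\<lambda>i. \<mu> i powr r * (inner target (e i) / \<mu> i)\<^sup>2"
  let ?T = "\<Sum>i. ennreal (\<mu> i powr b * inner (e i) (e i))"
  have \<kappa>0: "0 \<le> \<kappa>" using \<kappa>[of 0] mu_pos[of 0] lam_pos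
    by (elim order_trans[rotated]) auto
  have pos: "0 \<le> ?X"
    using \<kappa>0 by (intro mult_nonneg_nonneg sum_nonneg) (auto simp: bias_risk_def)
  have weight: "weight i = \<mu> i * (inner target (e i) / \<mu> i)\<^sup>2" for i
    using mu_pos[of i] by (simp add: weight_def power2_eq_square)
  have lam_mu: "\<mu> i + lam > 0" for i using mu_pos[of i] lam_pos by simp
  have V: "3 * ?V \<le> ennreal (6 * \<sigma>\<^sup>2 / real n * lam powr (- b)) * ?T"
  proof -
    have "2 * \<sigma>\<^sup>2 / real n * (\<mu> i / (\<mu> i + lam)\<^sup>2 * inner (C (e i)) (e i))
        \<le> 2 * \<sigma>\<^sup>2 / real n * (lam powr (- b) * (\<mu> i powr b * inner (e i) (e i)))" for i
    proof -
      have "\<mu> i powr (2 - b) * lam powr b \<le> (\<mu> i + lam) powr (2 - b + b)"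
        using mu_pos[of i] lam_pos b by (intro powr_mult_powr_le) auto
      then have "\<mu> i powr (2 - b) * lam powr b \<le> (\<mu> i + lam)\<^sup>2" using lam_mu[of i] by simp
      moreover have "\<mu> i powr (2 - b) = (\<mu> i)\<^sup>2 / \<mu> i powr b"
        using mu_pos[of i] by (simp add: powr_diff)
      ultimately have "(\<mu> i)\<^sup>2 / (\<mu> i + lam)\<^sup>2 \<le> \<mu> i powr b / lam powr b"
        using lam_pos mu_pos[of i] lam_mu[of i] by (simp add: field_simps)
      then have "(\<mu> i)\<^sup>2 / (\<mu> i + lam)\<^sup>2 \<le> lam powr (- b) * \<mu> i powr b"
        by (simp add: powr_minus_divide)
      then have "(\<mu> i)\<^sup>2 / (\<mu> i + lam)\<^sup>2 * inner (e i) (e i) \<le> lam powr (- b) * \<mu> i powr b * inner (e i) (e i)"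
        by (rule mult_right_mono) simp
      then show ?thesis
        by (intro mult_left_mono) (simp_all add: eigen power2_eq_square mult_ac)
    qed
    then have "?V \<le> (\<Sum>i. ennreal (2 * \<sigma>\<^sup>2 / real n * lam powr (- b)) * ennreal (\<mu> i powr b * inner (e i) (e i)))"
      by (intro suminf_le) (auto simp: ennreal_mult[symmetric] mult.assoc intro!: ennreal_leI)
    then have "3 * ?V \<le> 3 * (ennreal (2 * \<sigma>\<^sup>2 / real n * lam powr (- b)) * ?T)"
      by (intro mult_left_mono) auto
    also have "\<dots> = (3 * ennreal (2 * \<sigma>\<^sup>2 / real n * lam powr (- b))) * ?T"
      by (simp only: mult.assoc)
    also have "3 * ennreal (2 * \<sigma>\<^sup>2 / real n * lam powr (- b)) = ennreal (6 * \<sigma>\<^sup>2 / real n * lam powr (- b))"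
      using three_ennreal[of "2 * \<sigma>\<^sup>2 / real n * lam powr (- b)" 0] by (simp add: mult.assoc)
    finally show ?thesis .
  qed
  have BX: "ennreal (3 * ?B + 3 * ?X) \<le> ennreal ((27 + \<delta>) * lam powr (1 - r)) * (\<Sum>i. ennreal (?S i))"
  proof -
    have B: "3 * ennreal ?B \<le> (\<Sum>i. ennreal (75/4 * lam powr (1 - r)) * ennreal (?S i))"
    proof -
      have "3 * ennreal ?B \<le> 3 * (\<Sum>i. ennreal (25/4 * (lam / (\<mu> i + lam))\<^sup>2 * weight i))"
        by (intro mult_left_mono mean_bias_le) auto
      also have "\<dots> = (\<Sum>i. 3 * ennreal (25/4 * (lam / (\<mu> i + lam))\<^sup>2 * weight i))" by simp
      also have "\<dots> \<le> (\<Sum>i. ennreal (75/4 * lam powr (1 - r)) * ennreal (?S i))"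
      proof (rule suminf_le)
        fix i
        have "\<mu> i powr (1 - r) * lam powr (1 + r) \<le> (\<mu> i + lam) powr (1 - r + (1 + r))"
          using mu_pos[of i] lam_pos r by (intro powr_mult_powr_le) auto
        then have "\<mu> i powr (1 - r) * lam powr (1 + r) \<le> (\<mu> i + lam)\<^sup>2" using lam_mu[of i] by simp
        moreover have "\<mu> i powr (1 - r) = \<mu> i / \<mu> i powr r" "lam powr (1 + r) = lam\<^sup>2 / lam powr (1 - r)"
          using mu_pos[of i] lam_pos powr_add[of lam "1 + r" "1 - r"]
          by (simp_all add: powr_diff)
        ultimately have "(lam / (\<mu> i + lam))\<^sup>2 * \<mu> i \<le> lam powr (1 - r) * \<mu> i powr r"
          using lam_pos mu_pos[of i] lam_mu[of i] by (simp add: field_simps)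
        then have "(lam / (\<mu> i + lam))\<^sup>2 * \<mu> i * (inner target (e i) / \<mu> i)\<^sup>2
            \<le> lam powr (1 - r) * \<mu> i powr r * (inner target (e i) / \<mu> i)\<^sup>2"
          by (rule mult_right_mono) simp
        then have "3 * (25/4 * (lam / (\<mu> i + lam))\<^sup>2 * weight i) \<le> 75/4 * lam powr (1 - r) * ?S i"
          unfolding weight by (simp add: mult.assoc mult.left_commute)
        then have "ennreal (3 * (25/4 * (lam / (\<mu> i + lam))\<^sup>2 * weight i)) \<le> ennreal (75/4 * lam powr (1 - r) * ?S i)"
          by (rule ennreal_leI)
        then show "3 * ennreal (25/4 * (lam / (\<mu> i + lam))\<^sup>2 * weight i)
            \<le> ennreal (75/4 * lam powr (1 - r)) * ennreal (?S i)"
          by (subst (asm) ennreal_mult, simp, simp add: weight_nonneg)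
            (simp add: ennreal_mult[symmetric])
      qed auto
      finally show ?thesis .
    qed
    have X: "3 * ennreal ?X \<le> (\<Sum>i. ennreal ((33/4 + \<delta>) * lam powr (1 - r)) * ennreal (?S i))"
    proof -
      define c where "c = 6 * \<kappa> * R\<^sup>2 / (real n)\<^sup>2"
      have c: "0 \<le> c" using \<kappa>0 by (simp add: c_def)
      have "3 * ?X = c * (\<Sum>k<n. bias_risk k)" by (simp add: c_def)
      then have "3 * ennreal ?X = ennreal (c * (\<Sum>k<n. bias_risk k))"
        using ennreal_mult[of 3 ?X] pos by simp
      also have "\<dots> = ennreal c * ennreal (\<Sum>k<n. bias_risk k)"
        using c by (intro ennreal_mult sum_nonneg) (auto simp: bias_risk_def)
      also have "\<dots> \<le> ennreal c * (\<Sum>i. ennreal (2 * real n * (lam / (\<mu> i + lam)) * weight i))"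
        by (intro mult_left_mono bias_risk_sum_le) auto
      also have "\<dots> = (\<Sum>i. ennreal c * ennreal (2 * real n * (lam / (\<mu> i + lam)) * weight i))" by simp
      also have "\<dots> \<le> (\<Sum>i. ennreal ((33/4 + \<delta>) * lam powr (1 - r)) * ennreal (?S i))"
      proof (rule suminf_le)
        fix i
        have "12 * \<kappa> * R\<^sup>2 / real n * (lam / (\<mu> i + lam)) * \<mu> i * (inner target (e i) / \<mu> i)\<^sup>2
            \<le> (33/4 + \<delta>) * (lam powr (1 - r) * \<mu> i powr r) * (inner target (e i) / \<mu> i)\<^sup>2"
          by (intro mult_right_mono \<delta>) auto
        moreover have "c * (2 * real n * (lam / (\<mu> i + lam)) * weight i)
            = 12 * \<kappa> * R\<^sup>2 / real n * (lam / (\<mu> i + lam)) * \<mu> i * (inner target (e i) / \<mu> i)\<^sup>2"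
          unfolding weight c_def using n_pos by (simp add: power2_eq_square)
        ultimately have "c * (2 * real n * (lam / (\<mu> i + lam)) * weight i)
            \<le> (33/4 + \<delta>) * lam powr (1 - r) * ?S i" by (simp add: mult.assoc)
        then show "ennreal c * ennreal (2 * real n * (lam / (\<mu> i + lam)) * weight i)
            \<le> ennreal ((33/4 + \<delta>) * lam powr (1 - r)) * ennreal (?S i)"
          using c \<delta>(1) weight_nonneg[of i] lam_pos lam_mu[of i]
          by (simp add: ennreal_mult[symmetric] ennreal_leI)
      qed auto
      finally show ?thesis .
    qed
    have "ennreal (3 * ?B + 3 * ?X) = 3 * ennreal ?B + 3 * ennreal ?X"
      by (rule three_ennreal[OF Bochner_Integration.integral_nonneg[OF zero_le_power2] pos])
    also have "\<dots> \<le> ennreal (75/4 * lam powr (1 - r)) * (\<Sum>i. ennreal (?S i))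
        + ennreal ((33/4 + \<delta>) * lam powr (1 - r)) * (\<Sum>i. ennreal (?S i))"
      using add_mono[OF B X] by simp
    also have "\<dots> = ennreal (75/4 * lam powr (1 - r) + (33/4 + \<delta>) * lam powr (1 - r)) * (\<Sum>i. ennreal (?S i))"
      using \<delta>(1) by (subst ennreal_plus) (auto simp: distrib_right)
    also have "75/4 * lam powr (1 - r) + (33/4 + \<delta>) * lam powr (1 - r) = (27 + \<delta>) * lam powr (1 - r)"
      by (simp add: algebra_simps)
    finally show ?thesis .
  qed
  have fin: "(\<integral>\<^sup>+p. ennreal (excess p) \<partial>P n) < \<infinity>"
  proof -
    have "ennreal (6 * \<sigma>\<^sup>2 / real n * lam powr (- b)) * ?T < \<infinity>"
      using cap by (simp add: ennreal_mult_less_top)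
    then have "3 * ?V < \<infinity>" by (rule le_less_trans[OF V])
    then have "ennreal (3 * ?B + 3 * ?X) + 3 * ?V < \<infinity>" by simp
    then show ?thesis using excess_nn_integral[OF \<kappa>] by (rule le_less_trans[rotated])
  qed
  have nn: "0 \<le> excess p" for p by (simp add: excess_def)
  show int: "integrable (P n) excess"
    using fin nn excess_measurable by (intro integrableI_bounded) auto
  have "ennreal (LINT p|P n. excess p) = (\<integral>\<^sup>+p. ennreal (excess p) \<partial>P n)"
    using nn by (intro nn_integral_eq_integral[symmetric] int) auto
  also have "\<dots> \<le> ennreal (3 * ?B + 3 * ?X) + 3 * ?V" by (rule excess_nn_integral[OF \<kappa>])
  also have "\<dots> \<le> ennreal ((27 + \<delta>) * lam powr (1 - r)) * (\<Sum>i. ennreal (?S i))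
      + ennreal (6 * \<sigma>\<^sup>2 / real n * lam powr (- b)) * ?T"
    by (rule add_mono[OF BX V])
  finally show "ennreal (LINT p|P n. excess p)
      \<le> ennreal ((27 + \<delta>) * lam powr (1 - r)) * (\<Sum>i. ennreal (\<mu> i powr r * (inner target (e i) / \<mu> i)\<^sup>2))
        + ennreal (6 * \<sigma>\<^sup>2 / real n * lam powr (- b)) * (\<Sum>i. ennreal (\<mu> i powr b * inner (e i) (e i)))" .
qed

lemma sgd_decomposition:
  assumes 0: "\<theta> 0 = \<theta>0"
    and Suc: "\<And>k. \<theta> (Suc k) = (1 - q) *\<^sub>R \<theta> k + q *\<^sub>R \<theta>0
      - (\<gamma> * inner (\<phi> (p (Suc k))) (\<theta> k)) *\<^sub>R \<phi> (p (Suc k)) + (\<gamma> * Y (p (Suc k))) *\<^sub>R \<phi> (p (Suc k))"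
    and Y: "\<And>z. Y z - inner (\<phi> z) \<theta>0 = \<epsilon> z - \<eta> z"
  shows "(1 / (real n + 1)) *\<^sub>R (\<Sum>k\<le>n. \<theta> k) = \<theta>0 + total p"
proof -
  let ?\<nu> = "\<lambda>k. process (\<lambda>k z. \<epsilon> z *\<^sub>R \<phi> z) k p" and ?\<xi> = "\<lambda>k. process bias_noise k p"
  have th: "\<theta> k = \<theta>0 + drift k + ?\<xi> k + ?\<nu> k" for k
  proof (induction k)
    case (Suc k)
    have Y': "Y z = inner (\<phi> z) \<theta>0 + \<epsilon> z - \<eta> z" for z using Y[of z] by simp
    show ?case
      unfolding assms(2) Suc
      by (simp add: step_def bias_noise_def[of k "p (Suc k)"] bias_def[of k "p (Suc k)"] Y' inner_add_right
          algebra_simps)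
  qed (simp add: 0)
  have "(1 / (real n + 1)) *\<^sub>R (\<Sum>k\<le>n. \<theta> k) = (1 / (real n + 1)) *\<^sub>R ((real n + 1) *\<^sub>R \<theta>0) + total p"
    unfolding th by (simp add: sum.distrib total_def mean_drift_def bias.average_def noise.average_def
        scaleR_add_right sum_constant_scaleR algebra_simps)
  then show ?thesis by simp
qed

end

section \<open>The step size and the remainder\<close>

context
  fixes c b r R :: real
  assumes c: "0 < c" and b: "0 \<le> b" and r: "- 1 \<le> r" "r \<le> 1" and rb: "r \<le> b" and R: "0 < R"
begin

private definition D :: real where "D = b + 1 - r"

lemma D_pos: "1 \<le> D"
  using rb by (simp add: D_def)

lemma step_size_pos: "1 \<le> n \<Longrightarrow> 0 < step_size c b r n"
  using c by (simp add: step_size_def)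

lemma reg_eq:
  assumes "1 \<le> n"
  shows "1 / (step_size c b r n * real n) = 1 / c * real n powr (- (1 / D))"
proof -
  have "(- b + r) / D + 1 = 1 / D" using D_pos by (simp add: field_simps D_def)
  then have "real n powr ((- b + r) / D) * real n = real n powr (1 / D)"
    using assms powr_add[of "real n" "(- b + r) / D" 1] by simp
  then show ?thesis by (simp add: step_size_def D_def powr_minus_divide mult.assoc)
qed

lemma reg_powr:
  assumes "1 \<le> n"
  shows "(1 / (step_size c b r n * real n)) powr s = c powr (- s) * real n powr (- s / D)"
  unfolding reg_eq[OF assms] using c by (simp add: powr_mult powr_powr powr_divide powr_minus_divide)

lemma bias_rate:
  "1 \<le> n \<Longrightarrow> (1 / (step_size c b r n * real n)) powr (1 - r)
    = c powr (r - 1) * real n powr (- (1 - r) / (b + 1 - r))"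
  by (simp only: reg_powr) (simp add: D_def)

lemma variance_rate:
  assumes "1 \<le> n"
  shows "(1 / (step_size c b r n * real n)) powr (- b) / real n
    = c powr b * real n powr (- (1 - r) / (b + 1 - r))"
proof -
  have "b / D - 1 = - (1 - r) / D" using D_pos by (simp add: field_simps D_def)
  then have "real n powr (b / D) / real n = real n powr (- (1 - r) / D)"
    using assms powr_diff[of "real n" "b / D" 1] by simp
  then show ?thesis using reg_powr[OF assms, of "- b"] by (simp add: D_def flip: times_divide_eq_right)
qed

lemma remainder_tendsto:
  fixes A p :: real
  assumes "0 \<le> A" "0 < p"
  defines "\<delta> \<equiv> \<lambda>n. A * real (max 1 n) powr (- p)"
  shows "decseq \<delta>" "\<delta> \<longlonglongrightarrow> 0" "0 \<le> \<delta> n"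
proof -
  show "decseq \<delta>"
    unfolding \<delta>_def decseq_def using assms
    by (intro allI impI mult_left_mono powr_mono2') auto
  have "(\<lambda>n. A * real n powr (- p)) \<longlonglongrightarrow> A * 0"
    using assms by (intro tendsto_mult_left tendsto_neg_powr filterlim_real_sequentially) auto
  moreover have "\<forall>\<^sub>F n in sequentially. A * real n powr (- p) = \<delta> n"
    using eventually_ge_at_top[of 1] by eventually_elim (simp add: \<delta>_def max_def)
  ultimately show "\<delta> \<longlonglongrightarrow> 0" using Lim_transform_eventually by fastforce
  show "0 \<le> \<delta> n" using assms by (simp add: \<delta>_def)
qed

text \<open>For \<open>r \<ge> 0\<close> the sampling noise of the bias is dominated by the bias for every \<open>n\<close>. For \<open>r < 0\<close> it is of
  lower order because the step size tends to \<open>0\<close>, with an additional argument when \<open>b = 0\<close>: the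
  dimension is then finite and the eigenvalues are bounded below.\<close>

lemma remainder_exists:
  fixes \<mu> :: "nat \<Rightarrow> real"
  assumes mu: "\<And>i. 0 < \<mu> i" "\<And>i. \<mu> i \<le> R\<^sup>2"
    and gap: "b = 0 \<Longrightarrow> \<exists>m>0. \<forall>i. m \<le> \<mu> i"
  obtains \<delta> :: "nat \<Rightarrow> real" where "decseq \<delta>" "\<delta> \<longlonglongrightarrow> 0" "\<And>n. 0 \<le> \<delta> n"
    "\<And>n \<Lambda>. 1 \<le> n \<Longrightarrow> step_size c b r n * R\<^sup>2 \<le> 1/2 \<Longrightarrow> \<Lambda> = 1 / (step_size c b r n * real n) \<Longrightarrow>
      \<exists>\<kappa>. (\<forall>i. \<mu> i / (\<mu> i + \<Lambda>)\<^sup>2 \<le> \<kappa>) \<and>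
        (\<forall>i. 12 * \<kappa> * R\<^sup>2 / real n * (\<Lambda> / (\<mu> i + \<Lambda>)) * \<mu> i \<le> (33/4 + \<delta> n) * (\<Lambda> powr (1 - r) * \<mu> i powr r))"
proof -
  have lam_pos: "0 < \<Lambda>" if "1 \<le> n" "\<Lambda> = 1 / (step_size c b r n * real n)" for n \<Lambda>
    using step_size_pos[OF that(1)] that by simp
  have kappa: "\<mu> i / (\<mu> i + \<Lambda>)\<^sup>2 \<le> 1 / \<Lambda>" "\<mu> i / (\<mu> i + \<Lambda>)\<^sup>2 \<le> 1 / \<mu> i" if "0 < \<Lambda>" for i \<Lambda>
  proof -
    have "(\<mu> i + \<Lambda>)\<^sup>2 = \<mu> i * \<mu> i + 2 * (\<mu> i * \<Lambda>) + \<Lambda> * \<Lambda>" by (simp add: power2_eq_square algebra_simps)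
    moreover have "0 \<le> \<mu> i * \<Lambda>" "0 \<le> \<mu> i * \<mu> i" "0 \<le> \<Lambda> * \<Lambda>" using mu(1)[of i] that by auto
    ultimately have "\<mu> i * \<Lambda> \<le> (\<mu> i + \<Lambda>)\<^sup>2" "\<mu> i * \<mu> i \<le> (\<mu> i + \<Lambda>)\<^sup>2" by linarith+
    moreover have "0 < (\<mu> i + \<Lambda>)\<^sup>2" using mu(1)[of i] that by simp
    ultimately show "\<mu> i / (\<mu> i + \<Lambda>)\<^sup>2 \<le> 1 / \<Lambda>" "\<mu> i / (\<mu> i + \<Lambda>)\<^sup>2 \<le> 1 / \<mu> i"
      using mu(1)[of i] that by (simp_all add: pos_divide_le_eq pos_le_divide_eq mult.commute)
  qed
  have ratio: "\<mu> i / (\<mu> i + \<Lambda>) \<le> 1" if "0 < \<Lambda>" for i \<Lambda> using mu(1)[of i] that by simp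
  have mu_r: "(R\<^sup>2) powr r \<le> \<mu> i powr r" if "r < 0" for i
    using mu[of i] that by (intro powr_mono2') auto
  have R2: "0 < (R\<^sup>2) powr r" using R by simp
  have swap: "12 * \<kappa> * R\<^sup>2 / real n * (\<Lambda> / (\<mu> i + \<Lambda>)) * \<mu> i = 12 * R\<^sup>2 / real n * (\<kappa> * \<Lambda>) * (\<mu> i / (\<mu> i + \<Lambda>))"
    for \<kappa> \<Lambda> n i by simp
  consider "0 \<le> r" | "r < 0" "0 < b" | "r < 0" "b = 0" using b by linarith
  then show ?thesis
  proof cases
    case 1
    show ?thesis
    proof (rule that[of "\<lambda>_. 0"])
      fix n and \<Lambda> :: real
      assume n: "1 \<le> n" and g: "step_size c b r n * R\<^sup>2 \<le> 1/2" and l: "\<Lambda> = 1 / (step_size c b r n * real n)"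
      note l0 = lam_pos[OF n l]
      have "12 * (1 / \<Lambda>) * R\<^sup>2 / real n * (\<Lambda> / (\<mu> i + \<Lambda>)) * \<mu> i \<le> (33/4 + 0) * (\<Lambda> powr (1 - r) * \<mu> i powr r)" for i
      proof -
        have "R\<^sup>2 / real n = step_size c b r n * R\<^sup>2 * \<Lambda>"
          unfolding l using n step_size_pos[OF n] by simp
        also have "\<dots> \<le> 1/2 * \<Lambda>" using g l0 by (intro mult_right_mono) auto
        finally have "12 * (R\<^sup>2 / real n) * (\<mu> i / (\<mu> i + \<Lambda>)) \<le> 12 * (1/2 * \<Lambda>) * (\<mu> i / (\<mu> i + \<Lambda>))"
          using mu(1)[of i] l0 by (intro mult_right_mono mult_left_mono) auto
        moreover have "\<mu> i * \<Lambda> / (\<mu> i + \<Lambda>) \<le> \<Lambda> powr (1 - r) * \<mu> i powr r"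
        proof -
          have "\<mu> i powr (1 - r) * \<Lambda> powr r \<le> (\<mu> i + \<Lambda>) powr (1 - r + r)"
            using mu(1)[of i] l0 1 r by (intro powr_mult_powr_le) auto
          then have "\<mu> i / \<mu> i powr r * \<Lambda> powr r \<le> \<mu> i + \<Lambda>"
            using mu(1)[of i] l0 by (simp add: powr_diff)
          then have "\<mu> i * \<Lambda> powr r \<le> (\<mu> i + \<Lambda>) * \<mu> i powr r"
            using mu(1)[of i] by (simp add: field_simps)
          then have "\<mu> i * \<Lambda> powr r * \<Lambda> powr (1 - r) \<le> (\<mu> i + \<Lambda>) * \<mu> i powr r * \<Lambda> powr (1 - r)"
            by (rule mult_right_mono) simp
          moreover have "\<Lambda> powr r * \<Lambda> powr (1 - r) = \<Lambda>" using l0 by (simp flip: powr_add)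
          ultimately have "\<mu> i * \<Lambda> \<le> (\<mu> i + \<Lambda>) * (\<mu> i powr r * \<Lambda> powr (1 - r))" by (simp add: mult.assoc)
          then show ?thesis using mu(1)[of i] l0 by (simp add: pos_divide_le_eq mult_ac)
        qed
        moreover have "12 * (1 / \<Lambda>) * R\<^sup>2 / real n * (\<Lambda> / (\<mu> i + \<Lambda>)) * \<mu> i = 12 * (R\<^sup>2 / real n) * (\<mu> i / (\<mu> i + \<Lambda>))"
          unfolding swap using l0 by simp
        moreover have "0 \<le> \<Lambda> powr (1 - r) * \<mu> i powr r" by simp
        moreover have "12 * (1/2 * \<Lambda>) * (\<mu> i / (\<mu> i + \<Lambda>)) = 6 * (\<mu> i * \<Lambda> / (\<mu> i + \<Lambda>))" by simp
        moreover have "u \<le> (33/4 + 0) * z" if "v \<le> w" "t \<le> z" "u = v" "0 \<le> z" "w = 6 * t" for t u v w z :: real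
        proof -
          have "u \<le> 33/4 * z" using that by linarith
          then show ?thesis by simp
        qed
        ultimately show ?thesis by blast
      qed
      then show "\<exists>\<kappa>. (\<forall>i. \<mu> i / (\<mu> i + \<Lambda>)\<^sup>2 \<le> \<kappa>) \<and>
        (\<forall>i. 12 * \<kappa> * R\<^sup>2 / real n * (\<Lambda> / (\<mu> i + \<Lambda>)) * \<mu> i \<le> (33/4 + 0) * (\<Lambda> powr (1 - r) * \<mu> i powr r))"
        using kappa(1)[OF l0] by blast
    qed (auto simp: decseq_def)
  next
    case 2
    define A where "A = 12 * R\<^sup>2 * c powr (1 - r) / (R\<^sup>2) powr r"
    define p where "p = b / D"
    have Ap: "0 \<le> A" "0 < p" using c R 2 D_pos by (auto simp: A_def p_def)
    show ?thesis
    proof (rule that[of "\<lambda>n. A * real (max 1 n) powr (- p)"])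
      fix n and \<Lambda> :: real
      assume n: "1 \<le> n" and l: "\<Lambda> = 1 / (step_size c b r n * real n)"
      note l0 = lam_pos[OF n l]
      have "12 * (1 / \<Lambda>) * R\<^sup>2 / real n * (\<Lambda> / (\<mu> i + \<Lambda>)) * \<mu> i
          \<le> (33/4 + A * real (max 1 n) powr (- p)) * (\<Lambda> powr (1 - r) * \<mu> i powr r)" for i
      proof -
        have "12 * (1 / \<Lambda>) * R\<^sup>2 / real n * (\<Lambda> / (\<mu> i + \<Lambda>)) * \<mu> i = 12 * R\<^sup>2 / real n * (\<mu> i / (\<mu> i + \<Lambda>))"
          unfolding swap using l0 by simp
        also have "\<dots> \<le> 12 * R\<^sup>2 / real n * 1"
          using ratio[OF l0, of i] by (intro mult_left_mono) auto
        also have "12 * R\<^sup>2 / real n * 1 = A * real n powr (- p) * (\<Lambda> powr (1 - r) * (R\<^sup>2) powr r)"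
        proof -
          have "- p + - (1 - r) / D = (- b + - (1 - r)) / D" by (simp only: p_def add_divide_distrib minus_divide_left)
          also have "- b + - (1 - r) = - D" by (simp add: D_def)
          also have "- D / D = - 1" using D_pos by simp
          finally have eq: "- p + - (1 - r) / D = - 1" .
          have "real n powr (- p) * real n powr (- (1 - r) / D) = 1 / real n"
            unfolding powr_add[symmetric] eq using n by (simp add: powr_minus_divide)
          moreover have "c powr (1 - r) * c powr (r - 1) = 1" using c by (simp flip: powr_add)
          moreover have "A * real n powr (- p) * (\<Lambda> powr (1 - r) * (R\<^sup>2) powr r)
             = 12 * R\<^sup>2 * (c powr (1 - r) * c powr (r - 1)) * (real n powr (- p) * real n powr (- (1 - r) / D))"
            unfolding l bias_rate[OF n] A_def D_def[symmetric] using R2 by simp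
          ultimately show ?thesis by simp
        qed
        also have "\<dots> \<le> A * real n powr (- p) * (\<Lambda> powr (1 - r) * \<mu> i powr r)"
          using Ap(1) mu_r[OF 2(1)] by (intro mult_left_mono) auto
        also have "\<dots> \<le> (33/4 + A * real n powr (- p)) * (\<Lambda> powr (1 - r) * \<mu> i powr r)"
          by (intro mult_right_mono) auto
        finally show ?thesis using n by (simp add: max_def)
      qed
      then show "\<exists>\<kappa>. (\<forall>i. \<mu> i / (\<mu> i + \<Lambda>)\<^sup>2 \<le> \<kappa>) \<and>
        (\<forall>i. 12 * \<kappa> * R\<^sup>2 / real n * (\<Lambda> / (\<mu> i + \<Lambda>)) * \<mu> i
          \<le> (33/4 + A * real (max 1 n) powr (- p)) * (\<Lambda> powr (1 - r) * \<mu> i powr r))"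
        using kappa(1)[OF l0] by blast
    qed (use remainder_tendsto[OF Ap] in auto)
  next
    case 3
    obtain m where m: "0 < m" "\<And>i. m \<le> \<mu> i" using gap[OF 3(2)] by blast
    define A where "A = 12 * R\<^sup>2 / m * (1 / c) * c powr (1 - r) / (R\<^sup>2) powr r"
    define p where "p = 1 / D"
    have Ap: "0 \<le> A" "0 < p" using c R m D_pos by (auto simp: A_def p_def)
    show ?thesis
    proof (rule that[of "\<lambda>n. A * real (max 1 n) powr (- p)"])
      fix n and \<Lambda> :: real
      assume n: "1 \<le> n" and l: "\<Lambda> = 1 / (step_size c b r n * real n)"
      note l0 = lam_pos[OF n l]
      have "12 * (1 / m) * R\<^sup>2 / real n * (\<Lambda> / (\<mu> i + \<Lambda>)) * \<mu> i
          \<le> (33/4 + A * real (max 1 n) powr (- p)) * (\<Lambda> powr (1 - r) * \<mu> i powr r)" for i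
      proof -
        have "12 * (1 / m) * R\<^sup>2 / real n * (\<Lambda> / (\<mu> i + \<Lambda>)) * \<mu> i \<le> 12 * R\<^sup>2 / real n * (1 / m * \<Lambda>) * 1"
          unfolding swap using ratio[OF l0, of i] l0 m(1) by (intro mult_left_mono) auto
        also have "12 * R\<^sup>2 / real n * (1 / m * \<Lambda>) * 1 = A * real n powr (- p) * (\<Lambda> powr (1 - r) * (R\<^sup>2) powr r)"
        proof -
          have "1 - r = D" unfolding D_def using 3(2) by simp
          then have "- (1 - r) / D = - 1" using D_pos by simp
          then have "real n powr (- (1 - r) / D) = 1 / real n" using n by (simp add: powr_minus_divide)
          moreover have "\<Lambda> = 1 / c * real n powr (- p)" unfolding l reg_eq[OF n] p_def ..
          moreover have "c powr (1 - r) * c powr (r - 1) = 1" using c by (simp flip: powr_add)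
          moreover have "A * real n powr (- p) * (\<Lambda> powr (1 - r) * (R\<^sup>2) powr r)
             = 12 * R\<^sup>2 / m * (1 / c * real n powr (- p)) * (c powr (1 - r) * c powr (r - 1))
               * real n powr (- (1 - r) / D)"
            unfolding l bias_rate[OF n] A_def D_def[symmetric] using R2 by simp
          ultimately show ?thesis by simp
        qed
        also have "\<dots> \<le> A * real n powr (- p) * (\<Lambda> powr (1 - r) * \<mu> i powr r)"
          using Ap(1) mu_r[OF 3(1)] by (intro mult_left_mono) auto
        also have "\<dots> \<le> (33/4 + A * real n powr (- p)) * (\<Lambda> powr (1 - r) * \<mu> i powr r)"
          by (intro mult_right_mono) auto
        finally show ?thesis using n by (simp add: max_def)
      qed
      moreover have "\<mu> i / (\<mu> i + \<Lambda>)\<^sup>2 \<le> 1 / m" for i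
        using kappa(2)[OF l0, of i] m(1) m(2)[of i] by (elim order_trans) (intro frac_le, auto)
      ultimately show "\<exists>\<kappa>. (\<forall>i. \<mu> i / (\<mu> i + \<Lambda>)\<^sup>2 \<le> \<kappa>) \<and>
        (\<forall>i. 12 * \<kappa> * R\<^sup>2 / real n * (\<Lambda> / (\<mu> i + \<Lambda>)) * \<mu> i
          \<le> (33/4 + A * real (max 1 n) powr (- p)) * (\<Lambda> powr (1 - r) * \<mu> i powr r))"
        by blast
    qed (use remainder_tendsto[OF Ap] in auto)
  qed
qed

end

section \<open>Reproducing kernel Hilbert spaces\<close>

lemma infsum_eq_suminf:
  fixes f :: "nat \<Rightarrow> ennreal"
  shows "infsum f I = (\<Sum>i. if i \<in> I then f i else 0)"
proof -
  have "infsum f I = infsum (\<lambda>i. if i \<in> I then f i else 0) UNIV"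
    by (rule infsum_cong_neutral) auto
  moreover have "((\<lambda>i. if i \<in> I then f i else 0) has_sum infsum (\<lambda>i. if i \<in> I then f i else 0) UNIV) UNIV"
    by (intro has_sum_infsum nonneg_summable_on_complete) simp
  ultimately show ?thesis using has_sum_imp_sums sums_unique by metis
qed

lemma quadratic_min_at_0:
  fixes B D :: real
  assumes D: "0 \<le> D" and le: "\<And>t. 0 \<le> t\<^sup>2 * D - 2 * t * B"
  shows "B = 0"
proof (rule ccontr)
  assume B: "B \<noteq> 0"
  have "(B / (D + 1))\<^sup>2 * D - 2 * (B / (D + 1)) * B = - (B\<^sup>2 * (D + 2) / (D + 1)\<^sup>2)"
    using D by (simp add: divide_simps power2_eq_square) (simp add: algebra_simps)
  moreover have "0 < B\<^sup>2 * (D + 2) / (D + 1)\<^sup>2" using B D by (intro divide_pos_pos mult_pos_pos) auto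
  ultimately show False using le[of "B / (D + 1)"] by linarith
qed

locale kernel_regression =
  fixes N :: "'x measure" and \<rho> :: "('x \<times> real) measure" and \<rho>X :: "'x measure"
    and K :: "'x \<Rightarrow> 'x \<Rightarrow> real" and fn :: "'h::{real_inner, complete_space} \<Rightarrow> 'x \<Rightarrow> real"
    and Kx :: "'x \<Rightarrow> 'h" and cov :: "'h \<Rightarrow>\<^sub>L 'h"
    and I :: "nat set" and \<mu> :: "nat \<Rightarrow> real" and e :: "nat \<Rightarrow> 'h"
    and \<theta>s :: "'x \<Rightarrow> real" and R \<sigma> :: real
  assumes prob_rho: "prob_space \<rho>"
    and sets_rho: "sets \<rho> = sets (N \<Otimes>\<^sub>M borel)"
    and rhoX: "\<rho>X = distr \<rho> N fst"
    and y_sq: "integrable \<rho> (\<lambda>z. (snd z)\<^sup>2)"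
    and rkhs: "rkhs (space N) K fn Kx"
    and H_L2: "range fn \<subseteq> square_integrable \<rho>X"
    and cov: "has_op_expectation \<rho>X (\<lambda>u. rank_one (Kx u) (Kx u)) cov"
    and cov_inj: "inj (blinfun_apply cov)"
    and eigen: "eigenbasis cov I \<mu> e"
    and minimizer: "is_arg_min (risk \<rho>) (\<lambda>u. u \<in> L2_closure \<rho>X fn) \<theta>s"
    and R: "R > 0"
      "\<exists>A. has_op_expectation \<rho>X (\<lambda>u. K u u *\<^sub>R rank_one (Kx u) (Kx u)) A \<and> A \<preceq>\<^sub>L R\<^sup>2 *\<^sub>R cov"
    and \<sigma>: "\<exists>A. has_op_expectation \<rho>
             (\<lambda>z. (snd z - \<theta>s (fst z))\<^sup>2 *\<^sub>R rank_one (Kx (fst z)) (Kx (fst z))) A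
           \<and> A \<preceq>\<^sub>L \<sigma>\<^sup>2 *\<^sub>R cov"
begin

lemma space_rho: "z \<in> space \<rho> \<Longrightarrow> fst z \<in> space N"
  using sets_eq_imp_space_eq[OF sets_rho] by (auto simp: space_pair_measure)

lemma measurable_fst_rho: "fst \<in> measurable \<rho> N"
  using measurable_cong_sets[OF sets_rho refl] measurable_fst by blast

lemma measurable_snd_rho: "snd \<in> borel_measurable \<rho>"
  using measurable_cong_sets[OF sets_rho refl] measurable_snd by blast

lemma sets_rhoX: "sets \<rho>X = sets N" "space \<rho>X = space N"
  by (simp_all add: rhoX)

lemma rhoX_integral:
  fixes f :: "'x \<Rightarrow> real"
  assumes "f \<in> borel_measurable \<rho>X"
  shows "integrable \<rho>X f \<longleftrightarrow> integrable \<rho> (\<lambda>z. f (fst z))"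
    and "(LINT u|\<rho>X. f u) = (LINT z|\<rho>. f (fst z))"
    and "(\<lambda>z. f (fst z)) \<in> borel_measurable \<rho>"
proof -
  have f: "f \<in> borel_measurable N" using assms measurable_cong_sets[OF sets_rhoX(1) refl] by blast
  show "integrable \<rho>X f \<longleftrightarrow> integrable \<rho> (\<lambda>z. f (fst z))" "(LINT u|\<rho>X. f u) = (LINT z|\<rho>. f (fst z))"
    unfolding rhoX by (rule integrable_distr_eq[OF measurable_fst_rho f] integral_distr[OF measurable_fst_rho f])+
  show "(\<lambda>z. f (fst z)) \<in> borel_measurable \<rho>" by (rule measurable_compose[OF measurable_fst_rho f])
qed

lemma rhoX_has_integral:
  fixes f :: "'x \<Rightarrow> real"
  assumes "has_bochner_integral \<rho>X f v"
  shows "has_bochner_integral \<rho> (\<lambda>z. f (fst z)) v"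
  using assms rhoX_integral[of f] by (auto simp: has_bochner_integral_iff)

lemma rhoX_square_integrable:
  assumes "u \<in> square_integrable \<rho>X"
  shows "(\<lambda>z. u (fst z)) \<in> square_integrable \<rho>"
  using assms rhoX_integral(3)[of u] rhoX_integral(1)[of "\<lambda>x. (u x)\<^sup>2"] by (auto simp: square_integrable_def)

definition feature :: "'x \<times> real \<Rightarrow> 'h" where
  "feature z = Kx (fst z)"

lemma fn_eq: "x \<in> space N \<Longrightarrow> fn g x = inner g (Kx x)"
  using rkhs by (simp add: rkhs_def)

lemma fn_feature: "z \<in> space \<rho> \<Longrightarrow> fn g (fst z) = inner (feature z) g"
  using fn_eq[OF space_rho] by (simp add: feature_def inner_commute)

lemma K_eq: "x \<in> space N \<Longrightarrow> K x x = (norm (Kx x))\<^sup>2"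
  using rkhs fn_eq[of x "Kx x"] unfolding rkhs_def by (metis power2_norm_eq_inner)

lemma fn_square_integrable: "fn g \<in> square_integrable \<rho>X"
  using H_L2 by auto

lemma inner_feature_measurable: "(\<lambda>z. inner (feature z) g) \<in> borel_measurable \<rho>"
  using rhoX_integral(3)[OF square_integrableD(1)[OF fn_square_integrable], of g]
  by (subst measurable_cong[of _ _ "\<lambda>z. fn g (fst z)"]) (auto simp: fn_feature)

lemma cov_rho: "has_bochner_integral \<rho> (\<lambda>z. inner (feature z) g * inner (feature z) h) (inner (cov g) h)"
proof -
  have "has_bochner_integral \<rho>X (\<lambda>u. inner g (Kx u) * inner (Kx u) h) (inner (cov g) h)"
    using cov by (simp add: has_op_expectation_def rank_one_apply)
  from rhoX_has_integral[OF this] show ?thesis by (simp add: feature_def inner_commute)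
qed

lemma loewner_form: "A \<preceq>\<^sub>L s *\<^sub>R cov \<Longrightarrow> inner (A g) g \<le> s * inner (cov g) g"
  unfolding loewner_le_def psd_def by (auto simp: blinfun.diff_left blinfun.scaleR_left inner_diff_left)

lemma fourth_rho:
  shows "integrable \<rho> (\<lambda>z. (norm (feature z))\<^sup>2 * (inner (feature z) g)\<^sup>2)"
    and "(LINT z|\<rho>. (norm (feature z))\<^sup>2 * (inner (feature z) g)\<^sup>2) \<le> R\<^sup>2 * inner (cov g) g"
proof -
  obtain A where A: "has_op_expectation \<rho>X (\<lambda>u. K u u *\<^sub>R rank_one (Kx u) (Kx u)) A" "A \<preceq>\<^sub>L R\<^sup>2 *\<^sub>R cov"
    using R(2) by blast
  have "has_bochner_integral \<rho>X (\<lambda>u. K u u * (inner g (Kx u) * inner (Kx u) g)) (inner (A g) g)"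
    using A(1)[unfolded has_op_expectation_def, rule_format, of g g]
    by (simp add: rank_one_apply blinfun.scaleR_left mult.assoc)
  from rhoX_has_integral[OF this]
  have "has_bochner_integral \<rho> (\<lambda>z. (norm (feature z))\<^sup>2 * (inner (feature z) g)\<^sup>2) (inner (A g) g)"
    by (rule has_bochner_integral_cong[THEN iffD1, rotated -1])
      (simp_all add: K_eq[OF space_rho] feature_def inner_commute power2_eq_square)
  then show "integrable \<rho> (\<lambda>z. (norm (feature z))\<^sup>2 * (inner (feature z) g)\<^sup>2)"
    "(LINT z|\<rho>. (norm (feature z))\<^sup>2 * (inner (feature z) g)\<^sup>2) \<le> R\<^sup>2 * inner (cov g) g"
    using loewner_form[OF A(2), of g] by (auto simp: has_bochner_integral_iff)
qed

definition basis :: "nat \<Rightarrow> 'h" where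
  "basis i = (if i \<in> I then e i else 0)"

definition eigenvalue :: "nat \<Rightarrow> real" where
  "eigenvalue i = (if i \<in> I then \<mu> i else R\<^sup>2)"

lemma eigenvalue_pos: "i \<in> I \<Longrightarrow> 0 < \<mu> i"
proof -
  assume i: "i \<in> I"
  then have e: "cov (e i) = \<mu> i *\<^sub>R e i" "inner (e i) (e i) = 1" using eigen by (auto simp: eigenbasis_def)
  have "inner (cov (e i)) (e i) = (LINT z|\<rho>. (inner (feature z) (e i))\<^sup>2)"
    using has_bochner_integral_integral_eq[OF cov_rho[of "e i" "e i"]] by (simp add: power2_eq_square)
  then have "0 \<le> inner (cov (e i)) (e i)" by simp
  then have "0 \<le> \<mu> i" using e by simp
  moreover have "\<mu> i \<noteq> 0"
  proof
    assume "\<mu> i = 0"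
    then have "cov (e i) = cov 0" using e by (simp add: blinfun.zero_right)
    then have "e i = 0" by (rule injD[OF cov_inj])
    then show False using e by simp
  qed
  ultimately show ?thesis by simp
qed

sublocale features \<rho> basis I feature cov eigenvalue R
proof -
  interpret prob_space \<rho> by (rule prob_rho)
  have orth: "inner (basis i) (basis j) = (if i = j \<and> i \<in> I then 1 else 0)" for i j
    using eigen by (auto simp: eigenbasis_def basis_def)
  have "closure (span (e ` I)) \<subseteq> closure (span (range basis))"
    by (intro closure_mono span_mono) (auto simp: basis_def image_iff intro!: exI)
  then have total: "closure (span (range basis)) = UNIV"
    using eigen by (auto simp: eigenbasis_def)
  have eig: "cov (basis i) = eigenvalue i *\<^sub>R basis i" for i
    using eigen by (auto simp: eigenbasis_def basis_def eigenvalue_def blinfun.zero_right)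
  show "features \<rho> basis I feature cov eigenvalue R"
    by unfold_locales
      (use orth total eig cov_rho fourth_rho inner_feature_measurable eigenvalue_pos R(1) in
        \<open>auto simp: weakly_measurable_def eigenvalue_def\<close>)
qed

definition noise :: "'x \<times> real \<Rightarrow> real" where
  "noise z = snd z - \<theta>s (fst z)"

lemma theta_closure: "\<theta>s \<in> L2_closure \<rho>X fn"
  using minimizer by (simp add: is_arg_min_def)

lemma theta_square_integrable: "(\<lambda>z. \<theta>s (fst z)) \<in> square_integrable \<rho>"
  using theta_closure by (intro rhoX_square_integrable) (simp add: L2_closure_def)

lemma noise_square_integrable: "noise \<in> square_integrable \<rho>"
proof -
  have "snd \<in> square_integrable \<rho>" using y_sq measurable_snd_rho by (intro square_integrableI)
  from square_integrable_diff(1)[OF this theta_square_integrable] show ?thesis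
    by (simp add: noise_def[abs_def])
qed

lemma fn_rho_square_integrable: "(\<lambda>z. fn g (fst z)) \<in> square_integrable \<rho>"
  by (rule rhoX_square_integrable[OF fn_square_integrable])

lemma L2_closure_segment: "(\<lambda>x. \<theta>s x + t * (fn g x - \<theta>s x)) \<in> L2_closure \<rho>X fn"
  unfolding L2_closure_def
proof (intro CollectI conjI allI impI)
  have th: "\<theta>s \<in> square_integrable \<rho>X" using theta_closure by (simp add: L2_closure_def)
  show "(\<lambda>x. \<theta>s x + t * (fn g x - \<theta>s x)) \<in> square_integrable \<rho>X"
    by (intro square_integrable_add(1) square_integrable_scale square_integrable_diff(1) th fn_square_integrable)
  fix \<epsilon> :: real assume "\<epsilon> > 0"
  define \<epsilon>' where "\<epsilon>' = \<epsilon> / ((1 - t)\<^sup>2 + 1)"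
  have den: "0 < (1 - t)\<^sup>2 + 1" by (simp add: add_nonneg_pos)
  then have "0 < \<epsilon>'" using \<open>\<epsilon> > 0\<close> by (simp add: \<epsilon>'_def)
  then obtain h where h: "(LINT x|\<rho>X. (fn h x - \<theta>s x)\<^sup>2) < \<epsilon>'"
    using theta_closure unfolding L2_closure_def by blast
  define k where "k = (1 - t) *\<^sub>R h + t *\<^sub>R g"
  have "fn k x - (\<theta>s x + t * (fn g x - \<theta>s x)) = (1 - t) * (fn h x - \<theta>s x)" if "x \<in> space N" for x
    using that by (simp add: fn_eq k_def inner_add_left inner_diff_left algebra_simps)
  then have "(LINT x|\<rho>X. (fn k x - (\<theta>s x + t * (fn g x - \<theta>s x)))\<^sup>2)
      = (LINT x|\<rho>X. (1 - t)\<^sup>2 * (fn h x - \<theta>s x)\<^sup>2)"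
    by (intro Bochner_Integration.integral_cong refl) (simp add: sets_rhoX power_mult_distrib)
  also have "\<dots> = (1 - t)\<^sup>2 * (LINT x|\<rho>X. (fn h x - \<theta>s x)\<^sup>2)" by simp
  also have "\<dots> \<le> (1 - t)\<^sup>2 * \<epsilon>'" using h by (intro mult_left_mono) auto
  also have "\<dots> < ((1 - t)\<^sup>2 + 1) * \<epsilon>'" using \<open>0 < \<epsilon>'\<close> by (simp add: distrib_right)
  also have "\<dots> = \<epsilon>" using den by (simp add: \<epsilon>'_def)
  finally show "\<exists>k. (LINT x|\<rho>X. (fn k x - (\<theta>s x + t * (fn g x - \<theta>s x)))\<^sup>2) < \<epsilon>" by blast
qed

lemma risk_theta: "risk \<rho> \<theta>s = (LINT z|\<rho>. (noise z)\<^sup>2)"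
  unfolding risk_def noise_def by (simp add: power2_commute)

lemma residual_square_integrable: "(\<lambda>z. fn g (fst z) - \<theta>s (fst z)) \<in> square_integrable \<rho>"
  by (rule square_integrable_diff(1)[OF fn_rho_square_integrable theta_square_integrable])

lemma risk_segment:
  "risk \<rho> (\<lambda>x. \<theta>s x + t * (fn g x - \<theta>s x)) = risk \<rho> \<theta>s
    - 2 * t * (LINT z|\<rho>. noise z * (fn g (fst z) - \<theta>s (fst z)))
    + t\<^sup>2 * (LINT z|\<rho>. (fn g (fst z) - \<theta>s (fst z))\<^sup>2)"
proof -
  have "risk \<rho> (\<lambda>x. \<theta>s x + t * (fn g x - \<theta>s x))
      = (LINT z|\<rho>. (noise z - t * (fn g (fst z) - \<theta>s (fst z)))\<^sup>2)"
    unfolding risk_def noise_def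
    by (intro Bochner_Integration.integral_cong refl) (simp add: power2_eq_square algebra_simps)
  also have "\<dots> = risk \<rho> \<theta>s - 2 * (LINT z|\<rho>. noise z * (t * (fn g (fst z) - \<theta>s (fst z))))
      + (LINT z|\<rho>. (t * (fn g (fst z) - \<theta>s (fst z)))\<^sup>2)"
    unfolding risk_theta
    by (rule square_integrable_diff(2)[OF noise_square_integrable
          square_integrable_scale[OF residual_square_integrable]])
  finally show ?thesis by (simp add: power_mult_distrib mult.left_commute[of "noise _" t])
qed

lemma noise_residual: "(LINT z|\<rho>. noise z * (fn g (fst z) - \<theta>s (fst z))) = 0"
proof (rule quadratic_min_at_0)
  show "0 \<le> (LINT z|\<rho>. (fn g (fst z) - \<theta>s (fst z))\<^sup>2)" by simp
  fix t
  have "risk \<rho> \<theta>s \<le> risk \<rho> (\<lambda>x. \<theta>s x + t * (fn g x - \<theta>s x))"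
    using minimizer L2_closure_segment[of t g] by (auto simp: is_arg_min_def not_less)
  then show "0 \<le> t\<^sup>2 * (LINT z|\<rho>. (fn g (fst z) - \<theta>s (fst z))\<^sup>2)
      - 2 * t * (LINT z|\<rho>. noise z * (fn g (fst z) - \<theta>s (fst z)))"
    unfolding risk_segment by simp
qed

lemma excess_risk_eq: "risk \<rho> (fn g) - risk \<rho> \<theta>s = (LINT z|\<rho>. (fn g (fst z) - \<theta>s (fst z))\<^sup>2)"
  using risk_segment[of 1 g] noise_residual[of g] by simp

lemma noise_orthogonal: "(LINT z|\<rho>. noise z * inner (feature z) h) = 0"
proof -
  have i: "integrable \<rho> (\<lambda>z. noise z * fn h (fst z))" "integrable \<rho> (\<lambda>z. noise z * \<theta>s (fst z))" for h
    by (intro square_integrable_mult noise_square_integrable fn_rho_square_integrable theta_square_integrable)+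
  have eq: "(LINT z|\<rho>. noise z * fn h (fst z)) = (LINT z|\<rho>. noise z * \<theta>s (fst z))" for h
    using noise_residual[of h] i by (simp add: right_diff_distrib)
  have "(LINT z|\<rho>. noise z * fn 0 (fst z)) = (LINT z|\<rho>. 0)"
    by (intro Bochner_Integration.integral_cong refl) (simp add: fn_feature)
  then have "(LINT z|\<rho>. noise z * fn h (fst z)) = 0" using eq[of 0] eq[of h] by simp
  moreover have "(LINT z|\<rho>. noise z * inner (feature z) h) = (LINT z|\<rho>. noise z * fn h (fst z))"
    by (intro Bochner_Integration.integral_cong refl) (simp add: fn_feature)
  ultimately show ?thesis by simp
qed

lemma noise_covariance:
  shows "integrable \<rho> (\<lambda>z. (noise z)\<^sup>2 * (inner (feature z) h)\<^sup>2)"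
    and "(LINT z|\<rho>. (noise z)\<^sup>2 * (inner (feature z) h)\<^sup>2) \<le> \<sigma>\<^sup>2 * inner (cov h) h"
proof -
  obtain A where A: "has_op_expectation \<rho>
       (\<lambda>z. (snd z - \<theta>s (fst z))\<^sup>2 *\<^sub>R rank_one (Kx (fst z)) (Kx (fst z))) A" "A \<preceq>\<^sub>L \<sigma>\<^sup>2 *\<^sub>R cov"
    using \<sigma> by blast
  have "has_bochner_integral \<rho> (\<lambda>z. (noise z)\<^sup>2 * (inner (feature z) h)\<^sup>2) (inner (A h) h)"
    using A(1)[unfolded has_op_expectation_def, rule_format, of h h]
    by (simp add: rank_one_apply blinfun.scaleR_left feature_def noise_def inner_commute[of h] power2_eq_square
        mult.assoc)
  then show "integrable \<rho> (\<lambda>z. (noise z)\<^sup>2 * (inner (feature z) h)\<^sup>2)"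
    "(LINT z|\<rho>. (noise z)\<^sup>2 * (inner (feature z) h)\<^sup>2) \<le> \<sigma>\<^sup>2 * inner (cov h) h"
    using loewner_form[OF A(2), of h] by (auto simp: has_bochner_integral_iff)
qed

definition error :: "'h \<Rightarrow> 'x \<times> real \<Rightarrow> real" where
  "error \<theta>0 z = - \<theta>s (fst z) + inner (feature z) \<theta>0"

lemma error_in_closure: "in_closure (error \<theta>0)"
proof -
  have "in_closure (\<lambda>z. - \<theta>s (fst z))"
    unfolding in_closure_def
  proof (intro conjI allI impI)
    show "(\<lambda>z. - \<theta>s (fst z)) \<in> square_integrable \<rho>"
      using square_integrable_scale[OF theta_square_integrable, of "- 1"] by simp
    fix \<epsilon> :: real assume "\<epsilon> > 0"
    then obtain g where g: "(LINT x|\<rho>X. (fn g x - \<theta>s x)\<^sup>2) < \<epsilon>"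
      using theta_closure unfolding L2_closure_def by blast
    have th: "\<theta>s \<in> square_integrable \<rho>X" using theta_closure by (simp add: L2_closure_def)
    have "(LINT x|\<rho>X. (fn g x - \<theta>s x)\<^sup>2) = (LINT z|\<rho>. (fn g (fst z) - \<theta>s (fst z))\<^sup>2)"
      using square_integrableD(1)[OF square_integrable_diff(1)[OF fn_square_integrable th]]
      by (intro rhoX_integral(2)) simp
    also have "\<dots> = (LINT z|\<rho>. (inner (feature z) (- g) - - \<theta>s (fst z))\<^sup>2)"
      by (intro Bochner_Integration.integral_cong refl) (simp add: fn_feature power2_commute)
    finally have "(LINT z|\<rho>. (inner (feature z) (- g) - - \<theta>s (fst z))\<^sup>2) < \<epsilon>" using g by simp
    then show "\<exists>g. (LINT z|\<rho>. (inner (feature z) g - - \<theta>s (fst z))\<^sup>2) < \<epsilon>" by (rule exI)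
  qed
  from in_closure_add[OF this, of \<theta>0] show ?thesis by (simp add: error_def[abs_def])
qed

lemma excess_risk_error:
  "risk \<rho> (fn (\<theta>0 + d)) - risk \<rho> \<theta>s = (LINT z|\<rho>. (error \<theta>0 z + inner (feature z) d)\<^sup>2)"
  unfolding excess_risk_eq
  by (intro Bochner_Integration.integral_cong refl) (simp add: fn_feature error_def inner_add_right algebra_simps)

lemma regression:
  assumes "0 < \<gamma>" "\<gamma> * R\<^sup>2 \<le> 1/2" "1 \<le> n"
  shows "regression \<rho> basis I feature cov eigenvalue R \<gamma> n (error \<theta>0) noise \<sigma>"
  by unfold_locales
    (use assms error_in_closure noise_orthogonal noise_covariance
      square_integrableD(1)[OF noise_square_integrable] in auto)

lemma eigen_coeff_error:
  assumes t: "\<And>h. (LINT z|\<rho>. error \<theta>0 z * inner (feature z) h) = inner t h" and i: "i \<in> I"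
  shows "eigen_coeff \<rho>X fn \<mu> e (\<lambda>u. fn \<theta>0 u - \<theta>s u) i = inner t (basis i) / eigenvalue i"
proof -
  have th: "\<theta>s \<in> square_integrable \<rho>X" using theta_closure by (simp add: L2_closure_def)
  have "(\<lambda>u. (fn \<theta>0 u - \<theta>s u) * fn (e i) u) \<in> borel_measurable \<rho>X"
    by (intro borel_measurable_times square_integrableD(1) square_integrable_diff(1) fn_square_integrable th)
  then have "(LINT u|\<rho>X. (fn \<theta>0 u - \<theta>s u) * fn (e i) u)
      = (LINT z|\<rho>. (fn \<theta>0 (fst z) - \<theta>s (fst z)) * fn (e i) (fst z))"
    by (rule rhoX_integral(2))
  also have "\<dots> = (LINT z|\<rho>. error \<theta>0 z * inner (feature z) (e i))"
    by (intro Bochner_Integration.integral_cong refl) (simp add: fn_feature error_def)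
  finally show ?thesis using i by (simp add: eigen_coeff_def t basis_def eigenvalue_def)
qed

lemma power_norm_sq_error:
  assumes t: "\<And>h. (LINT z|\<rho>. error \<theta>0 z * inner (feature z) h) = inner t h"
  shows "power_norm_sq \<rho>X fn I \<mu> e r (\<lambda>u. fn \<theta>0 u - \<theta>s u)
    = (\<Sum>i. ennreal (eigenvalue i powr r * (inner t (basis i) / eigenvalue i)\<^sup>2))"
  unfolding power_norm_sq_def infsum_eq_suminf
  by (intro suminf_cong) (auto simp: eigen_coeff_error[OF t] eigenvalue_def basis_def)

lemma trace_power_eq: "trace_power I \<mu> b = (\<Sum>i. ennreal (eigenvalue i powr b * inner (basis i) (basis i)))"
  unfolding trace_power_def infsum_eq_suminf
  by (intro suminf_cong) (auto simp: orthonormal eigenvalue_def basis_eq_0)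

lemma eigenvalue_gap:
  assumes "trace_power I \<mu> 0 < \<infinity>"
  shows "\<exists>m>0. \<forall>i. m \<le> eigenvalue i"
proof -
  have "finite I"
  proof (rule ccontr)
    assume "infinite I"
    moreover have "1 \<le> ennreal (\<mu> i powr 0)" if "i \<in> I" for i using eigenvalue_pos[OF that] by simp
    ultimately have "trace_power I \<mu> 0 = \<infinity>"
      unfolding trace_power_def by (intro infsum_superconst_infinite_ennreal[of _ 1]) auto
    then show False using assms by simp
  qed
  define m where "m = Min (insert (R\<^sup>2) (\<mu> ` I))"
  have "0 < m" using \<open>finite I\<close> eigenvalue_pos R(1) by (simp add: m_def)
  moreover have "m \<le> eigenvalue i" for i
    using \<open>finite I\<close> by (auto simp: m_def eigenvalue_def intro!: Min_le)
  ultimately show ?thesis by blast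
qed

end

theorem theorem4:
  fixes M :: "'w measure"
    and N :: "'x measure"
    and \<rho> :: "('x \<times> real) measure"
    and \<rho>X :: "'x measure"
    and x :: "nat \<Rightarrow> 'w \<Rightarrow> 'x"
    and y :: "nat \<Rightarrow> 'w \<Rightarrow> real"
    and K :: "'x \<Rightarrow> 'x \<Rightarrow> real"
    and fn :: "'h::{real_inner, complete_space} \<Rightarrow> 'x \<Rightarrow> real"
    and Kx :: "'x \<Rightarrow> 'h"
    and cov :: "'h \<Rightarrow>\<^sub>L 'h"
    and I :: "nat set"
    and \<mu> :: "nat \<Rightarrow> real"
    and e :: "nat \<Rightarrow> 'h"
    and \<theta>s :: "'x \<Rightarrow> real"
    and \<theta>0 :: 'h
    and r b R \<sigma> c :: real
  assumes "prob_space M"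
    and sets_rho: "sets \<rho> = sets (N \<Otimes>\<^sub>M borel)"
    and rhoX: "\<rho>X = distr \<rho> N fst"
    and indep: "prob_space.indep_vars M (\<lambda>_. N \<Otimes>\<^sub>M borel) (\<lambda>n \<omega>. (x n \<omega>, y n \<omega>)) {1..}"
    and law: "\<And>n. n \<ge> 1 \<Longrightarrow> distr M (N \<Otimes>\<^sub>M borel) (\<lambda>\<omega>. (x n \<omega>, y n \<omega>)) = \<rho>"
    and y_sq: "integrable \<rho> (\<lambda>z. (snd z)\<^sup>2)"
    and rkhs: "rkhs (space N) K fn Kx"
    and K_int: "integrable \<rho>X (\<lambda>u. K u u)"
    and H_L2: "range fn \<subseteq> square_integrable \<rho>X"
    and cov: "has_op_expectation \<rho>X (\<lambda>u. rank_one (Kx u) (Kx u)) cov"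
    and cov_inj: "inj (blinfun_apply cov)"
    and eigen: "eigenbasis cov I \<mu> e"
    and minimizer: "is_arg_min (risk \<rho>) (\<lambda>u. u \<in> L2_closure \<rho>X fn) \<theta>s"
    and r: "- 1 \<le> r" "r \<le> 1"
    and b: "0 \<le> b" "b \<le> 1"
    and rb: "r \<le> b"
    and R: "R > 0"
      "\<exists>A. has_op_expectation \<rho>X (\<lambda>u. K u u *\<^sub>R rank_one (Kx u) (Kx u)) A \<and> A \<preceq>\<^sub>L R\<^sup>2 *\<^sub>R cov"
    and \<sigma>: "\<sigma> > 0"
      "\<exists>A. has_op_expectation \<rho>
             (\<lambda>z. (snd z - \<theta>s (fst z))\<^sup>2 *\<^sub>R rank_one (Kx (fst z)) (Kx (fst z))) A
           \<and> A \<preceq>\<^sub>L \<sigma>\<^sup>2 *\<^sub>R cov"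
    and source: "power_norm_sq \<rho>X fn I \<mu> e r \<theta>s < \<infinity>"
    and capacity: "trace_power I \<mu> b < \<infinity>"
    and c: "c > 0"
  shows "\<exists>\<delta>. decseq \<delta> \<and> \<delta> \<longlonglongrightarrow> 0 \<and>
    (\<forall>n\<ge>1. \<forall>\<gamma> reg :: real. \<gamma> = step_size c b r n \<longrightarrow> \<gamma> \<le> 1 / (2 * R\<^sup>2) \<longrightarrow> reg = 1 / (\<gamma> * real n) \<longrightarrow>
       (let excess_risk = (\<lambda>\<omega>.
              risk \<rho> (fn (sgd_average Kx \<gamma> reg \<theta>0 (\<lambda>k. x k \<omega>) (\<lambda>k. y k \<omega>) n)) - risk \<rho> \<theta>s)
        in integrable M excess_risk \<and>
           ennreal (LINT \<omega>|M. excess_risk \<omega>)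
           \<le> (ennreal ((27 + \<delta> n) * c powr (r - 1))
                  * power_norm_sq \<rho>X fn I \<mu> e r (\<lambda>u. fn \<theta>0 u - \<theta>s u)
               + ennreal (6 * \<sigma>\<^sup>2 * c powr b) * trace_power I \<mu> b)
             * ennreal (real n powr (- (1 - r) / (b + 1 - r)))))"
proof -
  interpret M: prob_space M by fact
  have rv: "(\<lambda>\<omega>. (x n \<omega>, y n \<omega>)) \<in> measurable M (N \<Otimes>\<^sub>M borel)" if "n \<ge> 1" for n
    using indep that by (auto simp: M.indep_vars_def)
  have "prob_space \<rho>"
    using M.prob_space_distr[OF rv[of 1]] law[of 1] by simp
  then interpret kernel_regression N \<rho> \<rho>X K fn Kx cov I \<mu> e \<theta>s R \<sigma>
    by (intro kernel_regression.intro sets_rho rhoX y_sq rkhs H_L2 cov cov_inj eigen minimizer R \<sigma>(2))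
  have gap: "\<exists>m>0. \<forall>i. m \<le> eigenvalue i" if "b = 0"
    using eigenvalue_gap capacity that by simp
  obtain \<delta> where \<delta>: "decseq \<delta>" "\<delta> \<longlonglongrightarrow> 0" "\<And>n. 0 \<le> \<delta> n"
    "\<And>n \<Lambda>. 1 \<le> n \<Longrightarrow> step_size c b r n * R\<^sup>2 \<le> 1/2 \<Longrightarrow> \<Lambda> = 1 / (step_size c b r n * real n) \<Longrightarrow>
      \<exists>\<kappa>. (\<forall>i. eigenvalue i / (eigenvalue i + \<Lambda>)\<^sup>2 \<le> \<kappa>) \<and>
        (\<forall>i. 12 * \<kappa> * R\<^sup>2 / real n * (\<Lambda> / (eigenvalue i + \<Lambda>)) * eigenvalue i
          \<le> (33/4 + \<delta> n) * (\<Lambda> powr (1 - r) * eigenvalue i powr r))"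
    using remainder_exists[OF c b(1) r rb R(1), of eigenvalue] mu_pos mu_le gap by metis
  show ?thesis
  proof (intro exI[of _ \<delta>] conjI \<delta>(1,2) allI impI)
    fix n :: nat and \<gamma> reg :: real
    assume n: "1 \<le> n" and \<gamma>: "\<gamma> = step_size c b r n" "\<gamma> \<le> 1 / (2 * R\<^sup>2)" and reg: "reg = 1 / (\<gamma> * real n)"
    have \<gamma>0: "0 < \<gamma>" unfolding \<gamma>(1) by (rule step_size_pos[OF c b(1) r rb R(1) n])
    have \<gamma>R: "\<gamma> * R\<^sup>2 \<le> 1/2" using \<gamma>(2) R(1) by (simp add: field_simps)
    interpret regression \<rho> basis I feature cov eigenvalue R \<gamma> n "error \<theta>0" noise \<sigma>
      by (rule regression[OF \<gamma>0 \<gamma>R n])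
    have lam: "lam = reg" by (simp add: lam_def reg)
    let ?p = "\<lambda>\<omega> i. (x i \<omega>, y i \<omega>)"
    let ?X = "\<lambda>\<omega>. \<lambda>i\<in>{1..n}. ?p \<omega> i"
    have sgd: "sgd_average Kx \<gamma> reg \<theta>0 (\<lambda>k. x k \<omega>) (\<lambda>k. y k \<omega>) n = \<theta>0 + total (?p \<omega>)" for \<omega>
      unfolding sgd_average_def
    proof (rule sgd_decomposition)
      have "\<gamma> * reg = q" using \<gamma>0 by (simp add: reg q_def)
      then show "sgd Kx \<gamma> reg \<theta>0 (\<lambda>k. x k \<omega>) (\<lambda>k. y k \<omega>) (Suc k)
          = (1 - q) *\<^sub>R sgd Kx \<gamma> reg \<theta>0 (\<lambda>k. x k \<omega>) (\<lambda>k. y k \<omega>) k + q *\<^sub>R \<theta>0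
            - (\<gamma> * inner (feature (?p \<omega> (Suc k))) (sgd Kx \<gamma> reg \<theta>0 (\<lambda>k. x k \<omega>) (\<lambda>k. y k \<omega>) k))
              *\<^sub>R feature (?p \<omega> (Suc k))
            + (\<gamma> * snd (?p \<omega> (Suc k))) *\<^sub>R feature (?p \<omega> (Suc k))" for k
        by (simp add: blinfun.diff_left blinfun.add_left blinfun.scaleR_left rank_one_apply feature_def
            mult.commute[of reg] inner_commute algebra_simps)
      show "snd z - inner (feature z) \<theta>0 = noise z - error \<theta>0 z" for z
        by (simp add: noise_def error_def)
    qed simp
    have ex: "risk \<rho> (fn (sgd_average Kx \<gamma> reg \<theta>0 (\<lambda>k. x k \<omega>) (\<lambda>k. y k \<omega>) n)) - risk \<rho> \<theta>s
        = excess (?X \<omega>)" for \<omega>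
    proof -
      have "total (?p \<omega>) = total (?X \<omega>)" by (rule total_cong) simp
      then show ?thesis unfolding sgd excess_risk_error excess_def by simp
    qed
    have law_X: "distr M (P n) ?X = P n" and X: "?X \<in> measurable M (P n)"
    proof -
      have iv: "M.indep_vars (\<lambda>_. N \<Otimes>\<^sub>M borel) (\<lambda>i \<omega>. ?p \<omega> i) {1..n}"
        by (rule M.indep_vars_subset[OF indep]) auto
      have "distr M (\<Pi>\<^sub>M i\<in>{1..n}. N \<Otimes>\<^sub>M borel) ?X = (\<Pi>\<^sub>M i\<in>{1..n}. distr M (N \<Otimes>\<^sub>M borel) (\<lambda>\<omega>. ?p \<omega> i))"
        using iv n by (subst (asm) M.indep_vars_iff_distr_eq_PiM') (auto intro: rv)
      also have "\<dots> = P n" unfolding P_def by (intro PiM_cong refl law) auto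
      finally have *: "distr M (\<Pi>\<^sub>M i\<in>{1..n}. N \<Otimes>\<^sub>M borel) ?X = P n" .
      have sets: "sets (P n) = sets (\<Pi>\<^sub>M i\<in>{1..n}. N \<Otimes>\<^sub>M borel)"
        unfolding P_def by (intro sets_PiM_cong refl sets_rho)
      show "distr M (P n) ?X = P n" using * distr_cong[OF refl sets, of M ?X ?X] by simp
      show "?X \<in> measurable M (P n)"
        unfolding measurable_cong_sets[OF refl sets] by (intro measurable_restrict rv) auto
    qed
    have lam_eq: "lam = 1 / (step_size c b r n * real n)" using lam reg by (simp only: \<gamma>(1)[symmetric])
    obtain \<kappa> where \<kappa>: "\<And>i. eigenvalue i / (eigenvalue i + lam)\<^sup>2 \<le> \<kappa>"
      "\<And>i. 12 * \<kappa> * R\<^sup>2 / real n * (lam / (eigenvalue i + lam)) * eigenvalue i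
          \<le> (33/4 + \<delta> n) * (lam powr (1 - r) * eigenvalue i powr r)"
      using \<delta>(4)[OF n \<gamma>R[unfolded \<gamma>(1)] lam_eq] by blast
    have cap: "(\<Sum>i. ennreal (eigenvalue i powr b * inner (basis i) (basis i))) < \<infinity>"
      using capacity by (simp add: trace_power_eq)
    note bound = excess_bound[OF r b \<kappa>(1) \<delta>(3) \<kappa>(2) cap]
    define \<nu> where "\<nu> = real n powr (- (1 - r) / (b + 1 - r))"
    have rates: "lam powr (1 - r) = c powr (r - 1) * \<nu>" "lam powr (- b) / real n = c powr b * \<nu>"
      unfolding lam_eq \<nu>_def
      by (rule bias_rate[OF c b(1) r rb R(1) n] variance_rate[OF c b(1) r rb R(1) n])+
    have int: "integrable M (\<lambda>\<omega>. excess (?X \<omega>))"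
      using integrable_distr_eq[OF X excess_measurable] bound(1) unfolding law_X by blast
    have "(LINT \<omega>|M. excess (?X \<omega>)) = (LINT p|P n. excess p)"
      using integral_distr[OF X excess_measurable] unfolding law_X by (rule sym)
    also have "ennreal (LINT p|P n. excess p)
      \<le> ennreal ((27 + \<delta> n) * lam powr (1 - r)) * power_norm_sq \<rho>X fn I \<mu> e r (\<lambda>u. fn \<theta>0 u - \<theta>s u)
        + ennreal (6 * \<sigma>\<^sup>2 / real n * lam powr (- b)) * trace_power I \<mu> b"
      using bound(2) by (simp only: power_norm_sq_error[OF target] trace_power_eq)
    also have "(27 + \<delta> n) * lam powr (1 - r) = (27 + \<delta> n) * c powr (r - 1) * \<nu>"
      by (simp add: rates mult.assoc)
    also have "6 * \<sigma>\<^sup>2 / real n * lam powr (- b) = 6 * \<sigma>\<^sup>2 * (lam powr (- b) / real n)" by simp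
    also have "\<dots> = 6 * \<sigma>\<^sup>2 * c powr b * \<nu>" unfolding rates by simp
    also have "ennreal ((27 + \<delta> n) * c powr (r - 1) * \<nu>) = ennreal ((27 + \<delta> n) * c powr (r - 1)) * ennreal \<nu>"
      using \<delta>(3)[of n] by (intro ennreal_mult) (auto simp: \<nu>_def)
    also have "ennreal (6 * \<sigma>\<^sup>2 * c powr b * \<nu>) = ennreal (6 * \<sigma>\<^sup>2 * c powr b) * ennreal \<nu>"
      by (intro ennreal_mult) (auto simp: \<nu>_def)
    also have "ennreal ((27 + \<delta> n) * c powr (r - 1)) * ennreal \<nu> * power_norm_sq \<rho>X fn I \<mu> e r (\<lambda>u. fn \<theta>0 u - \<theta>s u)
        + ennreal (6 * \<sigma>\<^sup>2 * c powr b) * ennreal \<nu> * trace_power I \<mu> b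
      = (ennreal ((27 + \<delta> n) * c powr (r - 1)) * power_norm_sq \<rho>X fn I \<mu> e r (\<lambda>u. fn \<theta>0 u - \<theta>s u)
        + ennreal (6 * \<sigma>\<^sup>2 * c powr b) * trace_power I \<mu> b) * ennreal \<nu>"
      by (simp only: distrib_left distrib_right mult_ac)
    finally have final: "ennreal (LINT \<omega>|M. excess (?X \<omega>))
      \<le> (ennreal ((27 + \<delta> n) * c powr (r - 1)) * power_norm_sq \<rho>X fn I \<mu> e r (\<lambda>u. fn \<theta>0 u - \<theta>s u)
        + ennreal (6 * \<sigma>\<^sup>2 * c powr b) * trace_power I \<mu> b) * ennreal \<nu>" .
    show "let excess_risk = (\<lambda>\<omega>.
              risk \<rho> (fn (sgd_average Kx \<gamma> reg \<theta>0 (\<lambda>k. x k \<omega>) (\<lambda>k. y k \<omega>) n)) - risk \<rho> \<theta>s)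
        in integrable M excess_risk \<and>
           ennreal (LINT \<omega>|M. excess_risk \<omega>)
           \<le> (ennreal ((27 + \<delta> n) * c powr (r - 1))
                  * power_norm_sq \<rho>X fn I \<mu> e r (\<lambda>u. fn \<theta>0 u - \<theta>s u)
               + ennreal (6 * \<sigma>\<^sup>2 * c powr b) * trace_power I \<mu> b)
             * ennreal (real n powr (- (1 - r) / (b + 1 - r)))"
      unfolding Let_def ex \<nu>_def[symmetric] by (rule conjI[OF int final])
  qed
qed

end
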